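(* Let $\lambda\vdash n$ and $r\ge 1$. The number of sequences $(\tau_1,\dots,\tau_r)$ such that each $\tau_i$ is a star transposition and $\tau_1\tau_2\cdots\tau_r\in\mathcal{C}_\lambda$ equals \[ \frac{|\mathcal{C}_\lambda|}{n!}\sum_{\mu\vdash n}\Big(\sum_{j\in\mu}d_{j_-(\mu)}\,c_{\mu,j}^{\,r}\Big)\chi^\mu_\lambda, \] where the inner sum is over the distinct parts $j$ of $\mu$.
   Context: $\mathfrak{S}_n$ is the symmetric group on $\{1,\dots,n\}$. A star transposition is a transposition $(j,n)$ with $1\le j\le n-1$. $\mathcal{C}_\lambda$ is the conjugacy class of permutations of cycle type $\lambda$; $\chi^\mu_\lambda$ is the irreducible character indexed by $\mu$ evaluated at cycle type $\lambda$. $d_\nu$ is the number of standard Young tableaux of shape $\nu$; $j_-(\mu)\vdash n-1$ is obtained from $\mu$ by replacing one part $j$ by $j-1$ (deleting it if $j=1$). $c_{\mu,j}:=j-\sum_{k\ge j}m_k(\mu)$, where $m_k(\mu)$ is the multiplicity of $k$ as a part of $\mu$. *)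

theory Defs
  imports
    Complex_Main
    "HOL-Library.Multiset"
    "HOL-Library.Function_Algebras"
    "HOL-Combinatorics.Combinatorics"
begin

text \<open>An integer partition is the multiset of its (positive) parts.\<close>

definition is_partition :: "nat multiset \<Rightarrow> nat \<Rightarrow> bool"  (infix "partition'_of" 50)
  where "mu partition_of n \<longleftrightarrow> 0 \<notin># mu \<and> \<Sum>\<^sub># mu = n"

definition lower_part :: "nat \<Rightarrow> nat multiset \<Rightarrow> nat multiset"
  where "lower_part j mu =
    (if j = 1 then mu - {#1#} else add_mset (j - 1) (mu - {#j#}))"

definition part_content :: "nat multiset \<Rightarrow> nat \<Rightarrow> int"
  where "part_content mu j = int j - (\<Sum>k | k \<in># mu \<and> j \<le> k. int (count mu k))"


subsection \<open>Permutations of \<open>{1..n}\<close>\<close>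

definition star_transpositions :: "nat \<Rightarrow> (nat \<Rightarrow> nat) set"
  where "star_transpositions n = {Transposition.transpose j n | j. 1 \<le> j \<and> j < n}"

text \<open>Fixed points are singleton orbits, so they contribute parts equal to 1.\<close>

definition cycle_type :: "nat \<Rightarrow> (nat \<Rightarrow> nat) \<Rightarrow> nat multiset"
  where "cycle_type n w = image_mset card (mset_set (orbit w ` {1..n}))"

definition cycle_class :: "nat multiset \<Rightarrow> (nat \<Rightarrow> nat) set"
  where "cycle_class la = {w. w permutes {1..\<Sum>\<^sub># la} \<and> cycle_type (\<Sum>\<^sub># la) w = la}"


subsection \<open>Young diagrams and tableaux\<close>

text \<open>Rows and columns are numbered from 0; row \<open>i\<close> has as many cells as the
  \<open>i\<close>-th entry of the weakly decreasing list of parts.\<close>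

definition young_diagram :: "nat multiset \<Rightarrow> (nat \<times> nat) set"
  where "young_diagram mu =
    (let ps = rev (sorted_list_of_multiset mu) in {(i, j). i < length ps \<and> j < ps ! i})"

text \<open>A tableau is a bijective filling of the diagram with \<open>1, \<dots>, n\<close>. The value 0 outside
  the diagram makes tableaux extensional, and it is fixed by every permutation of \<open>{1..n}\<close>,
  so that the action of such a permutation \<open>w\<close> on a tableau \<open>T\<close> is simply \<open>w \<circ> T\<close>.\<close>

definition tableaux :: "nat multiset \<Rightarrow> (nat \<times> nat \<Rightarrow> nat) set"
  where "tableaux mu = {T. bij_betw T (young_diagram mu) {1..\<Sum>\<^sub># mu} \<and>
                           (\<forall>c. c \<notin> young_diagram mu \<longrightarrow> T c = 0)}"

definition standard_tableaux :: "nat multiset \<Rightarrow> (nat \<times> nat \<Rightarrow> nat) set"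
  where "standard_tableaux mu = {T \<in> tableaux mu.
    (\<forall>i j j'. (i, j) \<in> young_diagram mu \<and> (i, j') \<in> young_diagram mu \<and> j < j'
              \<longrightarrow> T (i, j) < T (i, j')) \<and>
    (\<forall>i i' j. (i, j) \<in> young_diagram mu \<and> (i', j) \<in> young_diagram mu \<and> i < i'
              \<longrightarrow> T (i, j) < T (i', j))}"

definition num_syt :: "nat multiset \<Rightarrow> nat"
  where "num_syt mu = card (standard_tableaux mu)"


subsection \<open>Trace of an operator on a finite-dimensional space of complex functions\<close>

definition fun_scale :: "complex \<Rightarrow> ('x \<Rightarrow> complex) \<Rightarrow> 'x \<Rightarrow> complex"
  where "fun_scale c f = (\<lambda>x. c * f x)"

global_interpretation cfun: vector_space fun_scale
  by unfold_locales (auto simp: fun_scale_def fun_eq_iff algebra_simps)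

text \<open>Used only for an operator \<open>F\<close> mapping the subspace \<open>V\<close> linearly into itself,
  where the value does not depend on the chosen basis.\<close>

definition trace_on :: "('x \<Rightarrow> complex) set \<Rightarrow> (('x \<Rightarrow> complex) \<Rightarrow> ('x \<Rightarrow> complex)) \<Rightarrow> complex"
  where "trace_on V F =
    (let B = (SOME B. cfun.independent B \<and> cfun.span B = V)
     in \<Sum>b\<in>B. cfun.representation B (F b) b)"


subsection \<open>Specht modules and the irreducible characters\<close>

definition row_stabilizer :: "nat multiset \<Rightarrow> (nat \<times> nat \<Rightarrow> nat) \<Rightarrow> (nat \<Rightarrow> nat) set"
  where "row_stabilizer mu T = {p. p permutes {1..\<Sum>\<^sub># mu} \<and>
    (\<forall>i. let R = T ` {c \<in> young_diagram mu. fst c = i} in p ` R = R)}"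

definition column_stabilizer :: "nat multiset \<Rightarrow> (nat \<times> nat \<Rightarrow> nat) \<Rightarrow> (nat \<Rightarrow> nat) set"
  where "column_stabilizer mu T = {p. p permutes {1..\<Sum>\<^sub># mu} \<and>
    (\<forall>j. let C = T ` {c \<in> young_diagram mu. snd c = j} in p ` C = C)}"

text \<open>The tabloid of \<open>T\<close> is its row-equivalence class. The permutation module consists of the
  complex functions on tabloids, a tabloid being identified with its indicator function.\<close>

definition tabloid :: "nat multiset \<Rightarrow> (nat \<times> nat \<Rightarrow> nat) \<Rightarrow> (nat \<times> nat \<Rightarrow> nat) set"
  where "tabloid mu T = (\<lambda>p. p \<circ> T) ` row_stabilizer mu T"

definition polytabloid :: "nat multiset \<Rightarrow> (nat \<times> nat \<Rightarrow> nat) \<Rightarrow> (nat \<times> nat \<Rightarrow> nat) set \<Rightarrow> complex"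
  where "polytabloid mu T =
    (\<lambda>t. \<Sum>p\<in>column_stabilizer mu T. if tabloid mu (p \<circ> T) = t then of_int (sign p) else 0)"

definition specht_module :: "nat multiset \<Rightarrow> ((nat \<times> nat \<Rightarrow> nat) set \<Rightarrow> complex) set"
  where "specht_module mu = cfun.span (polytabloid mu ` tableaux mu)"

text \<open>Since \<open>w\<close> sends the indicator function of \<open>t\<close> to that of \<open>w \<cdot> t\<close>, it acts on functions
  through its inverse.\<close>

definition perm_action ::
    "(nat \<Rightarrow> nat) \<Rightarrow> ((nat \<times> nat \<Rightarrow> nat) set \<Rightarrow> complex) \<Rightarrow> (nat \<times> nat \<Rightarrow> nat) set \<Rightarrow> complex"
  where "perm_action w f = (\<lambda>t. f ((\<lambda>T. inv w \<circ> T) ` t))"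

definition specht_character :: "nat multiset \<Rightarrow> (nat \<Rightarrow> nat) \<Rightarrow> complex"
  where "specht_character mu w = trace_on (specht_module mu) (perm_action w)"

text \<open>A character is constant on \<open>cycle_class la\<close>, so any representative will do.\<close>

definition irr_char :: "nat multiset \<Rightarrow> nat multiset \<Rightarrow> complex"
  where "irr_char mu la = specht_character mu (SOME w. w \<in> cycle_class la)"

end

theory Submission
  imports Defs
begin

text \<open>
  Let \<open>J\<close> be the sum of the star transpositions. Writing the indicator function of the identity as
  \<open>1/n!\<close> times the sum of \<open>dim \<mu> \<cdot> \<chi>\<^sup>\<mu>\<close>, and using that a class sum acts on a Specht module by a scalar,
  the count becomes \<open>|C|/n!\<close> times the sum of \<open>\<chi>\<^sup>\<mu>\<close> on \<open>C\<close> times the trace of \<open>J\<^sup>r\<close> on the Specht module of \<open>\<mu>\<close>.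

  The column antisymmetrizer of \<open>T\<close> maps every function on tabloids to a multiple of the polytabloid
  of \<open>T\<close>; this yields Schur's lemma and the orthogonality of the characters, hence that the sum of
  \<open>(dim \<mu>)\<^sup>2\<close> is at most \<open>n!\<close>. Removing \<open>n\<close> from polytabloids with \<open>n\<close> in a corner bounds \<open>dim \<mu>\<close> from
  below by the number of standard tableaux, whose squares sum to \<open>n!\<close> by the commutation relation of
  the up and down operators on Young's lattice. So all these bounds are equalities: the characters
  are complete, and the filtration of the Specht module by the position of \<open>n\<close> has quotients the
  Specht modules of the \<open>j\<^sub>-(\<mu>)\<close>. Since the sum of all transpositions acts on a Specht module by the
  sum of the contents, \<open>J\<close> acts on such a quotient by the content of the removed corner.
\<close>

text \<open>Two classical inputs are avoided: the standard basis theorem with its Garnir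
  straightening, and a count of the irreducible representations. Both come out of squeezing a sum of
  squares between \<open>n!\<close> and itself. Invariant complements are avoided too, because only
  traces are wanted and a trace is additive along a filtration. The obstacle is
  \<open>trace_on\<close>, defined through an unknown basis, while the natural spanning family of a
  Specht module, all polytabloids, is linearly dependent. The family is however one orbit of the
  group, so the sum over all tableaux \<open>U\<close> of the rank-one maps sending \<open>v\<close>
  to \<open>alt_eval mu U v\<close> times \<open>polytabloid mu U\<close> commutes with the group
  and is a nonzero scalar on the module. Dividing by it turns sums over tableaux into traces.
  Invariance of characters is then a change of summation index, and a product of two characters
  becomes a matrix coefficient of an averaged rank-one operator. The pairing of polytabloids by
  \<open>alt_eval\<close> is symmetric and real. Hence the characters are real, and a vanishing sum
  of squares of their combinations forces each term to vanish.\<close>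

type_synonym tabfun = "(nat \<times> nat \<Rightarrow> nat) set \<Rightarrow> complex"

abbreviation "psize \<equiv> sum_mset :: nat multiset \<Rightarrow> nat"
abbreviation "entries mu \<equiv> {1..psize mu}"
abbreviation "diagram \<equiv> young_diagram"
abbreviation "colstab \<equiv> column_stabilizer"
abbreviation "lower \<equiv> lower_part"
abbreviation "act \<equiv> perm_action"
abbreviation "specht \<equiv> specht_module"
abbreviation "spechar \<equiv> specht_character"

subsection \<open>Traces and dimensions\<close>

abbreviation clinear :: "(('x \<Rightarrow> complex) \<Rightarrow> 'y \<Rightarrow> complex) \<Rightarrow> bool"
  where "clinear F \<equiv> Vector_Spaces.linear fun_scale fun_scale F"

abbreviation cfunctional :: "(('x \<Rightarrow> complex) \<Rightarrow> complex) \<Rightarrow> bool"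
  where "cfunctional f \<equiv> Vector_Spaces.linear fun_scale (*) f"

lemma fun_scale_apply [simp]: "fun_scale c f x = c * f x"
  by (simp add: fun_scale_def)

lemma sum_fun_apply: "(\<Sum>i\<in>I. f i) x = (\<Sum>i\<in>I. f i x)"
  for f :: "'i \<Rightarrow> 'x \<Rightarrow> complex"
  by (induction I rule: infinite_finite_induct) auto

lemma clinearI:
  assumes "\<And>x y. F (x + y) = F x + F y" "\<And>c x. F (fun_scale c x) = fun_scale c (F x)"
  shows "clinear F"
  using assms by unfold_locales auto

lemma clinear_iff:
  "clinear F \<longleftrightarrow> (\<forall>x y. F (x + y) = F x + F y) \<and> (\<forall>c x. F (fun_scale c x) = fun_scale c (F x))"
  using clinearI[of F] by (auto simp: module_hom.scale module_hom.add Vector_Spaces.linear_def)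

lemma vector_space_complex: "vector_space ((*) :: complex \<Rightarrow> complex \<Rightarrow> complex)"
  by unfold_locales (auto simp: algebra_simps)

lemma cfunctional_iff:
  "cfunctional f \<longleftrightarrow> (\<forall>x y. f (x + y) = f x + f y) \<and> (\<forall>c x. f (fun_scale c x) = c * f x)"
  by (auto simp: Vector_Spaces.linear_def module_hom_def module_hom_axioms_def
      vector_space_complex cfun.vector_space_axioms module_iff_vector_space)

lemma clinear_sum:
  assumes "clinear F" shows "F (\<Sum>i\<in>I. f i) = (\<Sum>i\<in>I. F (f i))"
  using assms module_hom.sum[of fun_scale fun_scale F f I] by (simp add: Vector_Spaces.linear_def)

lemma cfunctional_sum:
  assumes "cfunctional F" shows "F (\<Sum>i\<in>I. f i) = (\<Sum>i\<in>I. F (f i))"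
  using assms module_hom.sum[of fun_scale "(*)" F f I] by (simp add: Vector_Spaces.linear_def)

lemma finite_basis_exists:
  assumes "finite S" "cfun.span S = V"
  obtains B where "cfun.independent B" "cfun.span B = V" "finite B" "card B = cfun.dim V"
proof -
  obtain B where B: "B \<subseteq> S" "cfun.independent B" "S \<subseteq> cfun.span B"
    using cfun.maximal_independent_subset by blast
  have "cfun.span B = V"
    using B assms(2) by (metis cfun.span_mono cfun.span_span subset_antisym)
  moreover have "card B = cfun.dim V"
    using cfun.dim_span_eq_card_independent[OF B(2)] calculation by simp
  ultimately show ?thesis
    using that B(1,2) finite_subset[OF B(1) assms(1)] by blast
qed

lemma finite_spanned_subspace:
  assumes "finite S" "cfun.subspace W" "W \<subseteq> cfun.span S"
  obtains S' where "finite S'" "cfun.span S' = W"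
proof -
  obtain B where B: "B \<subseteq> W" "cfun.independent B" "W \<subseteq> cfun.span B"
    using cfun.maximal_independent_subset by blast
  have "finite B"
    using cfun.independent_span_bound[OF assms(1) B(2)] B(1) assms(3) by blast
  moreover have "cfun.span B = W"
    using B assms(2) by (metis cfun.span_eq_iff cfun.span_mono subset_antisym)
  ultimately show ?thesis using that by blast
qed

text \<open>The family \<open>u\<close> may be linearly dependent; all that is asked is that the
  functionals \<open>f i\<close> recover every vector. Expanding each basis vector by the frame
  splits the diagonal entries of \<open>F\<close> into sums over \<open>i\<close>, and summing over
  the basis first reassembles \<open>F (u i)\<close>.\<close>

lemma trace_on_frame:
  assumes "finite S" "cfun.span S = V"
    and F: "clinear F" "\<And>v. v \<in> V \<Longrightarrow> F v \<in> V"
    and u: "\<And>i. i \<in> I \<Longrightarrow> u i \<in> V"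
    and f: "\<And>i. i \<in> I \<Longrightarrow> cfunctional (f i)"
    and frame: "\<And>v. v \<in> V \<Longrightarrow> v = (\<Sum>i\<in>I. fun_scale (f i v) (u i))"
  shows "trace_on V F = (\<Sum>i\<in>I. f i (F (u i)))"
proof -
  define B where "B = (SOME B. cfun.independent B \<and> cfun.span B = V)"
  have B: "cfun.independent B" "cfun.span B = V"
    using finite_basis_exists[OF assms(1,2)] someI_ex[of "\<lambda>B. cfun.independent B \<and> cfun.span B = V"]
    unfolding B_def by blast+
  have finB: "finite B"
    using cfun.independent_span_bound[OF assms(1) B(1)] B(2) assms(2) cfun.span_superset by blast
  have "trace_on V F = (\<Sum>b\<in>B. cfun.representation B (F b) b)"
    by (simp add: trace_on_def Let_def B_def)
  also have "\<dots> = (\<Sum>b\<in>B. \<Sum>i\<in>I. f i b * cfun.representation B (F (u i)) b)"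
  proof (rule sum.cong[OF refl])
    fix b assume b: "b \<in> B"
    then have bV: "b \<in> V" using B(2) cfun.span_superset by blast
    have "F b = F (\<Sum>i\<in>I. fun_scale (f i b) (u i))"
      using frame[OF bV] by metis
    also have "\<dots> = (\<Sum>i\<in>I. fun_scale (f i b) (F (u i)))"
      using F(1) by (subst clinear_sum[OF F(1)]) (simp add: clinear_iff)
    finally have "F b = (\<Sum>i\<in>I. fun_scale (f i b) (F (u i)))" .
    moreover have "fun_scale (f i b) (F (u i)) \<in> cfun.span B" if "i \<in> I" for i
      using that B(2) F(2) u cfun.span_scale by blast
    ultimately have "cfun.representation B (F b) b
        = (\<Sum>i\<in>I. cfun.representation B (fun_scale (f i b) (F (u i))) b)"
      using cfun.representation_sum[OF B(1), of I "\<lambda>i. fun_scale (f i b) (F (u i))"] by simp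
    also have "\<dots> = (\<Sum>i\<in>I. f i b * cfun.representation B (F (u i)) b)"
      using B F(2) u by (intro sum.cong) (auto simp: cfun.representation_scale)
    finally show "cfun.representation B (F b) b = (\<Sum>i\<in>I. f i b * cfun.representation B (F (u i)) b)" .
  qed
  also have "\<dots> = (\<Sum>i\<in>I. \<Sum>b\<in>B. f i b * cfun.representation B (F (u i)) b)"
    by (rule sum.swap)
  also have "\<dots> = (\<Sum>i\<in>I. f i (F (u i)))"
  proof (rule sum.cong[OF refl])
    fix i assume i: "i \<in> I"
    have "F (u i) = (\<Sum>b\<in>B. fun_scale (cfun.representation B (F (u i)) b) b)"
      using cfun.sum_representation_eq[OF B(1) _ finB subset_refl] B(2) F(2) u i by simp
    then have "f i (F (u i)) = f i (\<Sum>b\<in>B. fun_scale (cfun.representation B (F (u i)) b) b)"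
      by metis
    also have "\<dots> = (\<Sum>b\<in>B. f i b * cfun.representation B (F (u i)) b)"
      using f[OF i] by (subst cfunctional_sum[OF f[OF i]]) (simp add: cfunctional_iff mult.commute)
    finally show "(\<Sum>b\<in>B. f i b * cfun.representation B (F (u i)) b) = f i (F (u i))" by simp
  qed
  finally show ?thesis .
qed

text \<open>\<open>cfun.representation B\<close> is zero off the span of \<open>B\<close>, so in
  general it is not linear on the whole space, whereas \<open>cfunctional\<close> asks for a global
  functional. Extending \<open>B\<close> to a basis of everything supplies one.\<close>

lemma representation_functional:
  assumes "cfun.independent B"
  obtains f where "\<And>b. cfunctional (f b)" "\<And>v b. v \<in> cfun.span B \<Longrightarrow> f b v = cfun.representation B v b"
proof
  let ?E = "cfun.extend_basis B"
  show "cfunctional (\<lambda>v. cfun.representation ?E v b)" for b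
    using assms cfun.linear_representation cfun.independent_extend_basis cfun.span_extend_basis by blast
  show "cfun.representation ?E v b = cfun.representation B v b" if "v \<in> cfun.span B" for v b
    using cfun.representation_extend[OF cfun.independent_extend_basis[OF assms] that
        cfun.extend_basis_superset[OF assms]] by simp
qed

lemma trace_on_basis:
  assumes "finite B" "cfun.independent B" "cfun.span B = V"
    and F: "clinear F" "\<And>v. v \<in> V \<Longrightarrow> F v \<in> V"
  shows "trace_on V F = (\<Sum>b\<in>B. cfun.representation B (F b) b)"
proof -
  obtain f where f: "\<And>b. cfunctional (f b)"
      "\<And>v b. v \<in> cfun.span B \<Longrightarrow> f b v = cfun.representation B v b"
    using representation_functional[OF assms(2)] by blast
  have "trace_on V F = (\<Sum>b\<in>B. f b (F b))"
  proof (rule trace_on_frame[OF assms(1,3) F])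
    show "b \<in> V" if "b \<in> B" for b using that assms(3) cfun.span_superset by blast
    show "v = (\<Sum>b\<in>B. fun_scale (f b v) b)" if "v \<in> V" for v
      using cfun.sum_representation_eq[OF assms(2) _ assms(1) subset_refl, of v] that assms(3) f(2)
      by simp
  qed (use f in auto)
  also have "\<dots> = (\<Sum>b\<in>B. cfun.representation B (F b) b)"
    using f(2) F(2) assms(3) by (intro sum.cong) (auto simp: cfun.span_base)
  finally show ?thesis .
qed

lemma trace_on_id:
  assumes "finite S" "cfun.span S = V"
  shows "trace_on V (\<lambda>v. v) = of_nat (cfun.dim V)"
proof -
  obtain B where B: "cfun.independent B" "cfun.span B = V" "finite B" "card B = cfun.dim V"
    using finite_basis_exists[OF assms] by blast
  have "trace_on V (\<lambda>v. v) = (\<Sum>b\<in>B. cfun.representation B b b)"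
    by (rule trace_on_basis[OF B(3,1,2)]) (auto simp: clinear_iff)
  also have "\<dots> = (\<Sum>b\<in>B. 1)"
    by (intro sum.cong) (auto simp: cfun.representation_basis B(1))
  finally show ?thesis by (simp add: B(4))
qed

lemma adapted_basis_exists:
  assumes "finite S" "cfun.span S = V" "cfun.subspace W" "W \<subseteq> V"
  obtains A B where "finite B" "A \<subseteq> B" "cfun.independent B" "cfun.span A = W" "cfun.span B = V"
    "cfun.dim W = card A" "cfun.dim V = card B"
proof -
  obtain S' where "finite S'" "cfun.span S' = W"
    using finite_spanned_subspace[OF assms(1,3)] assms(2,4) by blast
  then obtain A where A: "cfun.independent A" "cfun.span A = W" "finite A" "card A = cfun.dim W"
    using finite_basis_exists by blast
  obtain B where B: "A \<subseteq> B" "B \<subseteq> V" "cfun.independent B" "V \<subseteq> cfun.span B"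
    using cfun.maximal_independent_subset_extend[of A V] A assms(4) cfun.span_superset by blast
  have sB: "cfun.span B = V"
    using B assms(2) by (metis cfun.span_mono cfun.span_span subset_antisym)
  have "finite B"
    using cfun.independent_span_bound[OF assms(1) B(3)] B(2) assms(2) by blast
  moreover have "cfun.dim V = card B"
    using cfun.dim_span_eq_card_independent[OF B(3)] sB by simp
  ultimately show ?thesis
    using that[of B A] A B(1,3) sB by simp
qed

text \<open>In a basis adapted to \<open>W\<close> the operator is block triangular, with the scalar
  \<open>c\<close> as its block on \<open>V/W\<close>.\<close>

lemma trace_on_triangular:
  assumes S: "finite S" "cfun.span S = V" and W: "cfun.subspace W" "W \<subseteq> V"
    and F: "clinear F" "\<And>v. v \<in> W \<Longrightarrow> F v \<in> W" "\<And>v. v \<in> V \<Longrightarrow> F v - fun_scale c v \<in> W"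
  shows "trace_on V F = trace_on W F + c * (of_nat (cfun.dim V) - of_nat (cfun.dim W))"
proof -
  obtain A B where B: "finite B" "A \<subseteq> B" "cfun.independent B" "cfun.span A = W" "cfun.span B = V"
    "cfun.dim W = card A" "cfun.dim V = card B"
    using adapted_basis_exists[OF S W] .
  have A: "cfun.independent A" "finite A"
    using B cfun.independent_mono finite_subset by blast+
  have sub: "cfun.subspace V" using S by auto
  have FV: "F v \<in> V" if "v \<in> V" for v
  proof -
    have "F v = (F v - fun_scale c v) + fun_scale c v" by simp
    then show ?thesis
      using F(3)[OF that] that W(2) sub by (metis cfun.subspace_add cfun.subspace_scale in_mono)
  qed
  have rep: "cfun.representation B v = cfun.representation A v" if "v \<in> W" for v
    using cfun.representation_extend[OF B(3) _ B(2)] that B(4) by blast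
  have "trace_on V F = (\<Sum>b\<in>B. cfun.representation B (F b) b)"
    by (rule trace_on_basis[OF B(1,3,5) F(1) FV])
  also have "\<dots> = (\<Sum>b\<in>A. cfun.representation B (F b) b) + (\<Sum>b\<in>B - A. cfun.representation B (F b) b)"
    using sum.subset_diff[OF B(2,1)] by (simp add: add.commute)
  also have "(\<Sum>b\<in>A. cfun.representation B (F b) b) = (\<Sum>b\<in>A. cfun.representation A (F b) b)"
  proof (rule sum.cong[OF refl])
    fix b assume "b \<in> A"
    then have "b \<in> W" using B(4) cfun.span_base by blast
    then show "cfun.representation B (F b) b = cfun.representation A (F b) b"
      using rep[OF F(2)] by simp
  qed
  also have "\<dots> = trace_on W F"
    using trace_on_basis[OF A(2,1) B(4) F(1,2)] by simp
  also have "(\<Sum>b\<in>B - A. cfun.representation B (F b) b) = (\<Sum>b\<in>B - A. c)"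
  proof (rule sum.cong[OF refl])
    fix b assume b: "b \<in> B - A"
    then have bV: "b \<in> V" using B(5) cfun.span_base by blast
    define w where "w = F b - fun_scale c b"
    have w: "w \<in> W" unfolding w_def by (rule F(3)[OF bV])
    have "F b = w + fun_scale c b" by (simp add: w_def)
    moreover have "w \<in> cfun.span B" "b \<in> cfun.span B" "fun_scale c b \<in> cfun.span B"
      using w W(2) bV B(5) sub cfun.subspace_scale by auto
    ultimately have "cfun.representation B (F b) b = cfun.representation B w b + c * cfun.representation B b b"
      by (simp add: cfun.representation_add[OF B(3)] cfun.representation_scale[OF B(3)])
    moreover have "cfun.representation B w b = 0"
      using rep[OF w] b cfun.representation_ne_zero by (metis DiffD2)
    moreover have "cfun.representation B b b = 1"
      using b B(3) by (simp add: cfun.representation_basis)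
    ultimately show "cfun.representation B (F b) b = c" by simp
  qed
  also have "(\<Sum>b\<in>B - A. c) = c * (of_nat (cfun.dim V) - of_nat (cfun.dim W))"
    using B A by (simp add: card_Diff_subset of_nat_diff card_mono)
  finally show ?thesis .
qed

text \<open>Rank and nullity when \<open>W\<close> is only known to lie inside the kernel. If the
  dimensions add up, the images of the basis vectors outside \<open>W\<close> are independent, so a
  vector killed by \<open>f\<close> has no component along them.\<close>

lemma
  assumes S: "finite S" "cfun.span S = V" and W: "cfun.subspace W" "W \<subseteq> V"
    and f: "clinear f" "\<And>v. v \<in> W \<Longrightarrow> f v = 0"
  shows dim_kernel_image_le: "cfun.dim W + cfun.dim (f ` V) \<le> cfun.dim V"
    and kernel_subset_if_dim_le:
      "\<lbrakk>cfun.dim V \<le> cfun.dim W + cfun.dim (f ` V); v \<in> V; f v = 0\<rbrakk> \<Longrightarrow> v \<in> W"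
proof -
  obtain A B where B: "finite B" "A \<subseteq> B" "cfun.independent B" "cfun.span A = W" "cfun.span B = V"
    "cfun.dim W = card A" "cfun.dim V = card B"
    using adapted_basis_exists[OF S W] .
  interpret f: Vector_Spaces.linear fun_scale fun_scale f by (rule f(1))
  interpret vp: vector_space_pair fun_scale fun_scale by unfold_locales
  define C where "C = B - A"
  have finC: "finite C" using B(1) by (simp add: C_def)
  have BC: "B = A \<union> C" using B(2) by (auto simp: C_def)
  have card: "card B = card A + card C"
    using B(1,2) by (simp add: C_def card_Diff_subset finite_subset card_mono)
  have split: "\<exists>w\<in>W. \<exists>x\<in>cfun.span C. v = w + x" if "v \<in> V" for v
    using that B(4,5) unfolding BC cfun.span_Un by auto
  have img: "f ` V \<subseteq> cfun.span (f ` C)"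
  proof
    fix y assume "y \<in> f ` V"
    then obtain v where "v \<in> V" "y = f v" by blast
    moreover obtain w x where "w \<in> W" "x \<in> cfun.span C" "v = w + x"
      using split[OF \<open>v \<in> V\<close>] by blast
    ultimately have "y = f x" using f(2) by (simp add: f.add)
    then show "y \<in> cfun.span (f ` C)" using \<open>x \<in> cfun.span C\<close> f.span_image by blast
  qed
  have le: "cfun.dim (f ` V) \<le> card (f ` C)"
    by (rule cfun.dim_le_card[OF img]) (simp add: finC)
  then show "cfun.dim W + cfun.dim (f ` V) \<le> cfun.dim V"
    using card_image_le[OF finC, of f] card B(6,7) by linarith
  assume ge: "cfun.dim V \<le> cfun.dim W + cfun.dim (f ` V)" and v: "v \<in> V" "f v = 0"
  have eq: "card (f ` C) = card C" "cfun.dim (f ` V) = card C"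
    using ge le card_image_le[OF finC, of f] card B(6,7) by linarith+
  have inj: "inj_on f C" using eq(1) finC by (simp add: eq_card_imp_inj_on)
  obtain D where D: "D \<subseteq> f ` C" "cfun.independent D" "f ` C \<subseteq> cfun.span D"
    using cfun.maximal_independent_subset by blast
  have "finite D" using D(1) finC finite_subset by blast
  have "f ` V \<subseteq> cfun.span D"
    using img D(3) by (metis cfun.span_minimal cfun.subspace_span subset_trans)
  then have "card C \<le> card D" using cfun.dim_le_card \<open>finite D\<close> eq(2) by metis
  then have "D = f ` C" using D(1) finC eq(1) by (metis card_subset_eq card_mono finite_imageI le_antisym)
  then have indep: "cfun.independent (f ` C)" using D(2) by simp
  obtain w x where wx: "w \<in> W" "x \<in> cfun.span C" "v = w + x" using split[OF v(1)] by blast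
  then have "f x = 0" using v(2) f(2) by (simp add: f.add)
  then have "x = 0"
    using vp.linear_indep_image_lemma[OF f(1) finC indep inj wx(2)] by blast
  then show "v \<in> W" using wx by simp
qed

subsection \<open>Diagrams, tableaux and tabloids\<close>

text \<open>The conjugate partition. It is read off the multiset without sorting, and lowering a
  part changes it in a single column, whereas the list of rows would have to be sorted
  again.\<close>

definition col_length :: "nat multiset \<Rightarrow> nat \<Rightarrow> nat"
  where "col_length mu j = size (filter_mset (\<lambda>k. j < k) mu)"

text \<open>In a weakly decreasing list the entries exceeding \<open>j\<close> form an initial
  segment.\<close>

lemma nth_gt_iff_less_length_filter:
  fixes ps :: "nat list"
  assumes "sorted_wrt (\<ge>) ps"
  shows "(i < length ps \<and> j < ps ! i) \<longleftrightarrow> i < length (filter (\<lambda>k. j < k) ps)"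
  using assms
proof (induction ps arbitrary: i)
  case (Cons p ps)
  show ?case
  proof (cases "j < p")
    case True
    then show ?thesis using Cons by (cases i) auto
  next
    case False
    then have "\<forall>k\<in>set (p # ps). \<not> j < k" using Cons.prems by auto
    then have "filter (\<lambda>k. j < k) (p # ps) = []" "\<forall>i < length (p # ps). \<not> j < (p # ps) ! i"
      using nth_mem by (auto simp only: filter_empty_conv)
    then show ?thesis by auto
  qed
qed simp

lemma diagram_iff: "(i, j) \<in> diagram mu \<longleftrightarrow> i < col_length mu j"
proof -
  define ps where "ps = rev (sorted_list_of_multiset mu)"
  have "sorted_wrt (\<ge>) ps"
    using sorted_sorted_list_of_multiset[of mu] by (simp add: ps_def sorted_wrt_rev)
  moreover have "length (filter (\<lambda>k. j < k) ps) = col_length mu j"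
  proof -
    have "mset (filter (\<lambda>k. j < k) ps) = filter_mset (\<lambda>k. j < k) mu"
      by (simp add: ps_def mset_filter)
    then show ?thesis unfolding col_length_def by (metis size_mset)
  qed
  ultimately show ?thesis
    using nth_gt_iff_less_length_filter[of ps i j]
    by (simp add: young_diagram_def ps_def[symmetric] Let_def)
qed

lemma col_length_antimono: "j \<le> j' \<Longrightarrow> col_length mu j' \<le> col_length mu j"
  unfolding col_length_def by (intro size_mset_mono) (auto simp: subseteq_mset_def)

lemma col_length_eq_0: "(\<And>k. k \<in># mu \<Longrightarrow> k \<le> j) \<Longrightarrow> col_length mu j = 0"
  by (force simp: col_length_def filter_mset_eq_conv)

lemma col_length_add_mset: "col_length (add_mset k mu) j = col_length mu j + (if j < k then 1 else 0)"
  by (simp add: col_length_def)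

lemma count_eq_col_length_diff:
  "count mu (Suc j) = col_length mu j - col_length mu (Suc j)"
  "col_length mu j = col_length mu (Suc j) + count mu (Suc j)"
proof -
  have "filter_mset (\<lambda>k. j < k) mu = filter_mset (\<lambda>k. Suc j < k) mu + filter_mset (\<lambda>k. k = Suc j) mu"
    by (rule multiset_eqI) auto
  moreover have "filter_mset (\<lambda>k. k = Suc j) mu = replicate_mset (count mu (Suc j)) (Suc j)"
    by (rule multiset_eqI) auto
  ultimately show "col_length mu j = col_length mu (Suc j) + count mu (Suc j)"
    by (simp add: col_length_def)
  then show "count mu (Suc j) = col_length mu j - col_length mu (Suc j)" by simp
qed

lemma part_le_sum: "k \<in># mu \<Longrightarrow> k \<le> psize mu" for mu :: "nat multiset"
  using sum_mset.remove[of k mu] by simp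

lemma sum_col_length:
  assumes "\<And>k. k \<in># mu \<Longrightarrow> k \<le> N"
  shows "(\<Sum>j<N. col_length mu j) = psize mu"
  using assms
proof (induction mu)
  case (add k mu)
  have "(\<Sum>j<N. if j < k then 1 else 0 :: nat) = card ({..<N} \<inter> {j. j < k})"
    by (simp add: sum.If_cases)
  also have "{..<N} \<inter> {j. j < k} = {..<k}" using add.prems[of k] by auto
  finally show ?case using add by (simp add: col_length_add_mset sum.distrib)
qed (simp add: col_length_def)

lemma diagram_eq_Sigma:
  "diagram mu = prod.swap ` (SIGMA j:{..<psize mu}. {..<col_length mu j})"
proof -
  have "j < psize mu" if "i < col_length mu j" for i j
  proof (rule ccontr)
    assume "\<not> j < psize mu"
    then have "col_length mu j = 0" using part_le_sum by (intro col_length_eq_0) (meson le_trans not_less)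
    then show False using that by simp
  qed
  then show ?thesis by (force simp: diagram_iff image_iff)
qed

lemma finite_diagram [simp]: "finite (diagram mu)"
  by (simp add: diagram_eq_Sigma)

lemma card_diagram: "card (diagram mu) = psize mu"
  using sum_col_length[of mu "psize mu"] part_le_sum
  by (simp add: diagram_eq_Sigma card_image)

text \<open>A diagram does not see parts equal to \<open>0\<close>, hence the two side conditions;
  all other multiplicities are differences of neighbouring column lengths.\<close>

lemma diagram_inject:
  assumes "diagram mu = diagram nu" "0 \<notin># mu" "0 \<notin># nu"
  shows "mu = nu"
proof (rule multiset_eqI)
  fix k
  have "col_length mu j = col_length nu j" for j
    using assms(1) diagram_iff by (metis nat_neq_iff)
  then show "count mu k = count nu k"
    using assms(2,3) by (cases k) (auto simp: count_eq_col_length_diff(1) not_in_iff)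
qed

section \<open>Positions of entries, and permutations acting on tableaux\<close>

definition cell :: "nat multiset \<Rightarrow> (nat \<times> nat \<Rightarrow> nat) \<Rightarrow> nat \<Rightarrow> nat \<times> nat"
  where "cell mu T = inv_into (diagram mu) T"

abbreviation row_of where "row_of mu T a \<equiv> fst (cell mu T a)"
abbreviation col_of where "col_of mu T a \<equiv> snd (cell mu T a)"

lemma tableauxD:
  assumes "T \<in> tableaux mu"
  shows "bij_betw T (diagram mu) (entries mu)" "c \<notin> diagram mu \<Longrightarrow> T c = 0"
  using assms unfolding tableaux_def by blast+

lemma
  assumes "T \<in> tableaux mu" "a \<in> entries mu"
  shows cell_in: "cell mu T a \<in> diagram mu" and tableau_cell: "T (cell mu T a) = a"
  using tableauxD(1)[OF assms(1)] assms(2) unfolding cell_def bij_betw_def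
  by (metis inv_into_into, metis f_inv_into_f)

lemma
  assumes "T \<in> tableaux mu" "c \<in> diagram mu"
  shows cell_tableau: "cell mu T (T c) = c" and tableau_in: "T c \<in> entries mu"
  using tableauxD(1)[OF assms(1)] assms(2) unfolding cell_def bij_betw_def
  by (simp, blast)

lemma cell_inject:
  assumes "T \<in> tableaux mu" "a \<in> entries mu" "b \<in> entries mu" "cell mu T a = cell mu T b"
  shows "a = b"
  using assms by (metis tableau_cell)

lemma bij_betw_cell: "T \<in> tableaux mu \<Longrightarrow> bij_betw (cell mu T) (entries mu) (diagram mu)"
  unfolding cell_def by (intro bij_betw_inv_into tableauxD(1))

lemma permutes_cancel:
  assumes "w permutes A"
  shows "inv w \<circ> (w \<circ> f) = f" "w \<circ> (inv w \<circ> f) = f"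
  using permutes_inv_o[OF assms] by (simp_all add: comp_assoc[symmetric])

lemma tableau_comp:
  assumes "w permutes entries mu" "T \<in> tableaux mu"
  shows "w \<circ> T \<in> tableaux mu"
proof -
  have "bij_betw (w \<circ> T) (diagram mu) (entries mu)"
    using tableauxD(1)[OF assms(2)] permutes_imp_bij[OF assms(1)] by (rule bij_betw_trans)
  moreover have "w 0 = 0" using assms(1) by (simp add: permutes_def)
  ultimately show ?thesis using tableauxD(2)[OF assms(2)] by (simp add: tableaux_def)
qed

lemma cell_comp:
  assumes "w permutes entries mu" "T \<in> tableaux mu" "a \<in> entries mu"
  shows "cell mu (w \<circ> T) a = cell mu T (inv w a)"
proof -
  have i: "inv w a \<in> entries mu" using assms(1,3) by (metis permutes_in_image permutes_inv)
  have "(w \<circ> T) (cell mu T (inv w a)) = a"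
    using tableau_cell[OF assms(2) i] assms(1) by (simp add: permutes_inverses)
  then show ?thesis
    using cell_tableau[OF tableau_comp[OF assms(1,2)] cell_in[OF assms(2) i]] by simp
qed

lemma cell_comp':
  assumes "w permutes entries mu" "T \<in> tableaux mu" "a \<in> entries mu"
  shows "cell mu (w \<circ> T) (w a) = cell mu T a"
  using cell_comp[OF assms(1,2), of "w a"] assms permutes_in_image[OF assms(1)] permutes_inverses(2)[OF assms(1)]
  by auto

lemma tableau_eq_comp:
  assumes "T \<in> tableaux mu" "U \<in> tableaux mu"
  obtains p where "p permutes entries mu" "U = p \<circ> T"
proof -
  let ?N = "entries mu"
  define p where "p a = (if a \<in> ?N then U (cell mu T a) else a)" for a
  have "bij_betw (U \<circ> cell mu T) ?N ?N"
    using bij_betw_cell[OF assms(1)] tableauxD(1)[OF assms(2)] by (rule bij_betw_trans)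
  then have "bij_betw p ?N ?N" by (rule bij_betw_cong[THEN iffD1, rotated]) (simp add: p_def)
  then have "p permutes ?N" by (rule bij_imp_permutes) (simp only: p_def if_False)
  moreover have "U c = (p \<circ> T) c" for c
    using cell_tableau[OF assms(1), of c] tableau_in[OF assms(1), of c] tableauxD(2)[OF assms(1), of c]
      tableauxD(2)[OF assms(2), of c] by (cases "c \<in> diagram mu") (auto simp: p_def)
  ultimately show ?thesis using that by (metis ext)
qed

lemma comp_tableau_inj:
  assumes "T \<in> tableaux mu" "p permutes entries mu" "q permutes entries mu" "p \<circ> T = q \<circ> T"
  shows "p = q"
proof
  fix a
  show "p a = q a"
  proof (cases "a \<in> entries mu")
    case True
    then show ?thesis using tableau_cell[OF assms(1) True] assms(4) by (metis comp_apply)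
  qed (use assms in \<open>auto simp: permutes_def\<close>)
qed

lemma bij_betw_perms_tableaux:
  assumes "T \<in> tableaux mu"
  shows "bij_betw (\<lambda>p. p \<circ> T) {p. p permutes entries mu} (tableaux mu)"
  unfolding bij_betw_def inj_on_def
  using comp_tableau_inj[OF assms] tableau_comp[OF _ assms] tableau_eq_comp[OF assms] by blast

lemma tableaux_nonempty: "tableaux mu \<noteq> {}"
proof -
  obtain f where f: "bij_betw f (diagram mu) (entries mu)"
    using finite_same_card_bij[of "diagram mu" "entries mu"] card_diagram by auto
  define T where "T c = (if c \<in> diagram mu then f c else 0)" for c
  have "bij_betw T (diagram mu) (entries mu)"
    using f by (rule bij_betw_cong[THEN iffD1, rotated]) (simp add: T_def)
  then have "T \<in> tableaux mu" by (auto simp: tableaux_def T_def)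
  then show ?thesis by blast
qed

lemma finite_tableaux [simp]: "finite (tableaux mu)"
proof -
  obtain T where "T \<in> tableaux mu" using tableaux_nonempty by blast
  from bij_betw_finite[OF bij_betw_perms_tableaux[OF this]] show ?thesis
    by (simp add: finite_permutations)
qed

lemma tableau_image_cells:
  assumes "T \<in> tableaux mu"
  shows "T ` {c \<in> diagram mu. P c} = {a \<in> entries mu. P (cell mu T a)}"
proof -
  have "a \<in> T ` {c \<in> diagram mu. P c}" if "a \<in> entries mu" "P (cell mu T a)" for a
    using that cell_in[OF assms] tableau_cell[OF assms] by (metis (mono_tags, lifting) image_iff mem_Collect_eq)
  then show ?thesis using cell_tableau[OF assms] tableau_in[OF assms] by auto
qed

text \<open>The stabilizers are defined by images of whole rows and columns, the arguments below
  follow single entries. On a finite set an injection of a fibre into itself is onto, so the two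
  descriptions agree.\<close>

lemma permutes_image_fibre_iff:
  assumes "p permutes A" "finite A"
  shows "(\<forall>i. p ` {a \<in> A. f a = i} = {a \<in> A. f a = i}) \<longleftrightarrow> (\<forall>a\<in>A. f (p a) = f a)"
proof
  assume R: "\<forall>a\<in>A. f (p a) = f a"
  show "\<forall>i. p ` {a \<in> A. f a = i} = {a \<in> A. f a = i}"
  proof
    fix i
    have "p ` {a \<in> A. f a = i} \<subseteq> {a \<in> A. f a = i}"
      using R permutes_in_image[OF assms(1)] by auto
    moreover have "card (p ` {a \<in> A. f a = i}) = card {a \<in> A. f a = i}"
      using permutes_inj[OF assms(1)] by (simp add: card_image inj_on_subset)
    ultimately show "p ` {a \<in> A. f a = i} = {a \<in> A. f a = i}"
      using assms(2) by (intro card_subset_eq) auto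
  qed
qed blast

lemma colstab_iff:
  assumes "T \<in> tableaux mu"
  shows "p \<in> colstab mu T \<longleftrightarrow>
    p permutes entries mu \<and> (\<forall>a\<in>entries mu. col_of mu T (p a) = col_of mu T a)"
  using permutes_image_fibre_iff[of p "entries mu" "\<lambda>a. col_of mu T a"]
  unfolding column_stabilizer_def Let_def by (auto simp: tableau_image_cells[OF assms])

lemma row_stabilizer_iff:
  assumes "T \<in> tableaux mu"
  shows "p \<in> row_stabilizer mu T \<longleftrightarrow>
    p permutes entries mu \<and> (\<forall>a\<in>entries mu. row_of mu T (p a) = row_of mu T a)"
  using permutes_image_fibre_iff[of p "entries mu" "\<lambda>a. row_of mu T a"]
  unfolding row_stabilizer_def Let_def by (auto simp: tableau_image_cells[OF assms])

section \<open>Tabloids as assignments of rows to entries\<close>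

lemma tabloid_eq_rows:
  assumes "T \<in> tableaux mu"
  shows "tabloid mu T = {U \<in> tableaux mu. \<forall>a\<in>entries mu. row_of mu U a = row_of mu T a}"
proof (intro set_eqI iffI)
  fix U assume "U \<in> tabloid mu T"
  then obtain p where p: "p permutes entries mu" "U = p \<circ> T"
      "\<And>a. a \<in> entries mu \<Longrightarrow> row_of mu T (p a) = row_of mu T a"
    by (auto simp: tabloid_def row_stabilizer_iff[OF assms])
  have "row_of mu U a = row_of mu T a" if a: "a \<in> entries mu" for a
  proof -
    have "inv p a \<in> entries mu" using a p(1) by (metis permutes_in_image permutes_inv)
    then show ?thesis
      using p(3)[of "inv p a"] cell_comp[OF p(1) assms a] p(1,2) by (simp add: permutes_inverses)
  qed
  then show "U \<in> {U \<in> tableaux mu. \<forall>a\<in>entries mu. row_of mu U a = row_of mu T a}"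
    using p tableau_comp[OF p(1) assms] by simp
next
  fix U assume U: "U \<in> {U \<in> tableaux mu. \<forall>a\<in>entries mu. row_of mu U a = row_of mu T a}"
  then obtain p where p: "p permutes entries mu" "U = p \<circ> T"
    using tableau_eq_comp[OF assms] by blast
  have "row_of mu T (p a) = row_of mu T a" if a: "a \<in> entries mu" for a
  proof -
    have "p a \<in> entries mu" using a permutes_in_image[OF p(1)] by blast
    then have "row_of mu U (p a) = row_of mu T (p a)" using U by blast
    then show ?thesis using cell_comp'[OF p(1) assms a] p(2) by simp
  qed
  then show "U \<in> tabloid mu T"
    using p by (auto simp: tabloid_def row_stabilizer_iff[OF assms])
qed

lemma tabloid_eq_iff:
  assumes "T \<in> tableaux mu" "U \<in> tableaux mu"
  shows "tabloid mu T = tabloid mu U \<longleftrightarrow> (\<forall>a\<in>entries mu. row_of mu T a = row_of mu U a)"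
  using assms by (auto simp: tabloid_eq_rows)

lemma tabloid_comp_eq_iff:
  assumes "w permutes entries mu" "T \<in> tableaux mu" "U \<in> tableaux mu"
  shows "tabloid mu (w \<circ> T) = tabloid mu (w \<circ> U) \<longleftrightarrow> tabloid mu T = tabloid mu U"
proof -
  have "(\<forall>a\<in>entries mu. P (inv w a)) \<longleftrightarrow> (\<forall>a\<in>entries mu. P a)" for P
    using permutes_image[OF permutes_inv[OF assms(1)]] by (metis (full_types) image_iff)
  from this[of "\<lambda>a. row_of mu T a = row_of mu U a"] show ?thesis
    using assms by (simp add: tabloid_eq_iff tableau_comp cell_comp)
qed

lemma image_tabloid:
  assumes "w permutes entries mu" "T \<in> tableaux mu"
  shows "(\<lambda>U. w \<circ> U) ` tabloid mu T = tabloid mu (w \<circ> T)"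
proof -
  have *: "(\<lambda>U. w \<circ> U) ` tabloid mu T \<subseteq> tabloid mu (w \<circ> T)"
    if w: "w permutes entries mu" and T: "T \<in> tableaux mu" for w T
  proof
    fix V assume "V \<in> (\<lambda>U. w \<circ> U) ` tabloid mu T"
    then obtain U where U: "U \<in> tabloid mu T" "V = w \<circ> U" by blast
    then have "U \<in> tableaux mu" "tabloid mu U = tabloid mu T"
      using T by (auto simp: tabloid_eq_rows)
    then have "tabloid mu V = tabloid mu (w \<circ> T)" "V \<in> tableaux mu"
      using U(2) w T by (simp_all add: tabloid_comp_eq_iff tableau_comp)
    then show "V \<in> tabloid mu (w \<circ> T)"
      using tabloid_eq_rows by blast
  qed
  have "V \<in> (\<lambda>U. w \<circ> U) ` tabloid mu T" if "V \<in> tabloid mu (w \<circ> T)" for V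
  proof -
    have "inv w \<circ> V \<in> tabloid mu (inv w \<circ> (w \<circ> T))"
      using * [OF permutes_inv[OF assms(1)] tableau_comp[OF assms]] that by blast
    then have "inv w \<circ> V \<in> tabloid mu T" by (simp only: permutes_cancel[OF assms(1)])
    moreover have "V = w \<circ> (inv w \<circ> V)" by (simp only: permutes_cancel[OF assms(1)])
    ultimately show ?thesis by blast
  qed
  then show ?thesis using *[OF assms] by blast
qed

section \<open>The action on functions of tabloids\<close>

lemma act_tabloid:
  assumes "w permutes entries mu" "T \<in> tableaux mu"
  shows "act w v (tabloid mu T) = v (tabloid mu (inv w \<circ> T))"
  using image_tabloid[OF permutes_inv[OF assms(1)] assms(2)] by (simp add: perm_action_def)

lemma act_comp:
  assumes "u permutes A" "w permutes A"
  shows "act (u \<circ> w) v = act u (act w v)"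
proof -
  have "inv (u \<circ> w) = inv w \<circ> inv u"
    using assms by (simp add: o_inv_distrib permutes_bij)
  then show ?thesis by (simp add: perm_action_def image_image comp_assoc)
qed

lemma act_id [simp]: "act id v = v"
  by (simp add: perm_action_def)

lemma clinear_act: "clinear (act w)"
  by (auto simp: clinear_iff perm_action_def fun_eq_iff)

subsection \<open>Column antisymmetrizers\<close>

text \<open>The permutation module of \<open>mu\<close>. All shapes share one function type, so the
  module is cut out by its support.\<close>

definition tabloid_space :: "nat multiset \<Rightarrow> tabfun set"
  where "tabloid_space mu = {v. \<forall>t. t \<notin> tabloid mu ` tableaux mu \<longrightarrow> v t = 0}"

text \<open>The inner product of \<open>v\<close> with \<open>polytabloid mu T\<close> in the
  bilinear form for which the tabloids are orthonormal. By \<open>col_antisym_eq\<close> it is also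
  the coefficient with which the column antisymmetrizer of \<open>T\<close> produces that
  polytabloid.\<close>

definition alt_eval :: "nat multiset \<Rightarrow> (nat \<times> nat \<Rightarrow> nat) \<Rightarrow> tabfun \<Rightarrow> complex"
  where "alt_eval mu T v = (\<Sum>p\<in>colstab mu T. of_int (sign p) * v (tabloid mu (p \<circ> T)))"

definition col_antisym ::
    "nat multiset \<Rightarrow> (nat \<times> nat \<Rightarrow> nat) \<Rightarrow> tabfun \<Rightarrow> tabfun"
  where "col_antisym mu T v =
    (\<Sum>p\<in>colstab mu T. fun_scale (of_int (sign p)) (act p v))"

text \<open>The obstruction in the dominance lemma; the two shapes may differ. A conflicting pair
  gives a transposition in the column stabilizer of \<open>T\<close> that fixes the tabloid of
  \<open>U\<close>.\<close>

definition conflict ::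
    "nat multiset \<Rightarrow> (nat \<times> nat \<Rightarrow> nat) \<Rightarrow> nat multiset \<Rightarrow> (nat \<times> nat \<Rightarrow> nat) \<Rightarrow> bool"
  where "conflict mu T nu U \<longleftrightarrow> (\<exists>a\<in>entries mu. \<exists>b\<in>entries mu. a \<noteq> b \<and>
    col_of mu T a = col_of mu T b \<and> row_of nu U a = row_of nu U b)"

lemma colstab_permutes:
  "p \<in> colstab mu T \<Longrightarrow> p permutes entries mu"
  by (simp add: column_stabilizer_def)

lemma finite_colstab [simp]: "finite (colstab mu T)"
  by (rule finite_subset[OF _ finite_permutations[of "entries mu"]])
    (auto simp: column_stabilizer_def)

lemma
  assumes T: "T \<in> tableaux mu"
  shows id_in_colstab: "id \<in> colstab mu T"
    and comp_in_colstab: "\<lbrakk>p \<in> colstab mu T; q \<in> colstab mu T\<rbrakk>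
      \<Longrightarrow> p \<circ> q \<in> colstab mu T"
    and inv_in_colstab: "p \<in> colstab mu T \<Longrightarrow> inv p \<in> colstab mu T"
proof -
  show "id \<in> colstab mu T" by (simp add: colstab_iff[OF T] permutes_id)
next
  assume pq: "p \<in> colstab mu T" "q \<in> colstab mu T"
  have "p permutes entries mu" "q permutes entries mu"
    using pq colstab_permutes by blast+
  moreover have "col_of mu T (p (q a)) = col_of mu T a" if "a \<in> entries mu" for a
    using pq that permutes_in_image[OF calculation(2)] unfolding colstab_iff[OF T] by metis
  ultimately show "p \<circ> q \<in> colstab mu T"
    unfolding colstab_iff[OF T] by (simp add: permutes_compose)
next
  assume p: "p \<in> colstab mu T"
  then have pp: "p permutes entries mu" by (rule colstab_permutes)
  have "col_of mu T (inv p a) = col_of mu T a" if "a \<in> entries mu" for a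
  proof -
    have "inv p a \<in> entries mu" using that pp by (metis permutes_in_image permutes_inv)
    then have "col_of mu T (p (inv p a)) = col_of mu T (inv p a)"
      using p unfolding colstab_iff[OF T] by blast
    then show ?thesis using pp by (simp add: permutes_inverses)
  qed
  then show "inv p \<in> colstab mu T"
    using permutes_inv[OF pp] unfolding colstab_iff[OF T] by blast
qed

lemma sum_left_translate:
  assumes "g permutes A" "\<And>x. x \<in> X \<Longrightarrow> g \<circ> x \<in> X" "\<And>x. x \<in> X \<Longrightarrow> inv g \<circ> x \<in> X"
  shows "(\<Sum>x\<in>X. f (g \<circ> x)) = (\<Sum>x\<in>X. f x)"
  by (rule sum.reindex_bij_witness[of _ "\<lambda>x. inv g \<circ> x" "\<lambda>x. g \<circ> x"])
    (auto simp: permutes_cancel[OF assms(1)] assms)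

lemma sum_colstab_left:
  assumes "T \<in> tableaux mu" "q \<in> colstab mu T"
  shows "(\<Sum>p\<in>colstab mu T. g (q \<circ> p)) = (\<Sum>p\<in>colstab mu T. g p)"
  using assms comp_in_colstab inv_in_colstab
  by (intro sum_left_translate[OF colstab_permutes[OF assms(2)]]) auto

lemma sum_colstab_inv:
  assumes "T \<in> tableaux mu"
  shows "(\<Sum>p\<in>colstab mu T. g (inv p)) = (\<Sum>p\<in>colstab mu T. g p)"
proof -
  have "inv (inv p) = p" if "p \<in> colstab mu T" for p
    using colstab_permutes[OF that] permutes_inv_inv by blast
  then show ?thesis
    by (intro sum.reindex_bij_witness[of _ inv inv]) (auto intro: inv_in_colstab[OF assms])
qed

lemma sign_permutes_comp:
  assumes "p permutes {1..n::nat}" "q permutes {1..n}"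
  shows "sign (p \<circ> q) = sign p * sign q"
  using assms by (intro sign_compose) (auto simp: permutation_permutes)

lemma sign_permutes_inv: "p permutes {1..n::nat} \<Longrightarrow> sign (inv p) = sign p"
  by (intro sign_inverse) (auto simp: permutation_permutes)

lemma sign_mult_self: "of_int (sign p) * of_int (sign p) = (1 :: complex)"
  by (simp add: sign_def)

text \<open>Translating the summation index by the odd element \<open>q\<close> negates the
  sum.\<close>

lemma alternating_sum_eq_0:
  assumes T: "T \<in> tableaux mu" and q: "q \<in> colstab mu T" "sign q = - 1"
    and g: "\<And>p. p \<in> colstab mu T \<Longrightarrow> g (q \<circ> p) = g p"
  shows "(\<Sum>p\<in>colstab mu T. of_int (sign p) * g p) = (0 :: complex)"
proof -
  let ?C = "colstab mu T"
  have "(\<Sum>p\<in>?C. of_int (sign p) * g p) = (\<Sum>p\<in>?C. of_int (sign (q \<circ> p)) * g (q \<circ> p))"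
    using sum_colstab_left[OF T q(1), of "\<lambda>p. of_int (sign p) * g p"] by simp
  also have "\<dots> = (\<Sum>p\<in>?C. - (of_int (sign p) * g p))"
    using g q sign_permutes_comp[OF colstab_permutes[OF q(1)] colstab_permutes]
    by (intro sum.cong) auto
  finally show ?thesis by (simp add: sum_negf)
qed

lemma transpose_permutes: "\<lbrakk>a \<in> A; b \<in> A\<rbrakk> \<Longrightarrow> transpose a b permutes A"
  by (rule permutes_swap_id)

lemma conflict_transpose:
  assumes T: "T \<in> tableaux mu" and U: "U \<in> tableaux nu" and n: "psize mu = psize nu"
    and "conflict mu T nu U"
  obtains q where "q \<in> colstab mu T" "sign q = - 1" "inv q = q"
    "tabloid nu (q \<circ> U) = tabloid nu U"
proof -
  obtain a b where ab: "a \<in> entries mu" "b \<in> entries mu" "a \<noteq> b"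
      "col_of mu T a = col_of mu T b" "row_of nu U a = row_of nu U b"
    using assms(4) unfolding conflict_def by blast
  let ?q = "transpose a b"
  have q: "?q permutes entries mu" using ab by (intro transpose_permutes)
  have "?q \<in> colstab mu T"
    using q ab(4) unfolding colstab_iff[OF T] by (auto simp: transpose_def)
  moreover have "sign ?q = - 1" using ab by (simp add: sign_swap_id)
  moreover have "tabloid nu (?q \<circ> U) = tabloid nu U"
    using q n U ab(5)
    by (subst tabloid_eq_iff) (auto simp: tableau_comp cell_comp[where T = U] transpose_def)
  ultimately show ?thesis using that[of ?q] by simp
qed

text \<open>The transposition of the conflicting entries makes the signed terms cancel in
  pairs.\<close>

lemma col_antisym_conflict:
  assumes T: "T \<in> tableaux mu" and U: "U \<in> tableaux nu" and n: "psize mu = psize nu"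
    and "conflict mu T nu U"
  shows "col_antisym mu T v (tabloid nu U) = 0"
proof -
  obtain q where q: "q \<in> colstab mu T" "sign q = - 1" "inv q = q"
    "tabloid nu (q \<circ> U) = tabloid nu U" using conflict_transpose[OF assms] .
  have "col_antisym mu T v (tabloid nu U)
      = (\<Sum>p\<in>colstab mu T. of_int (sign p) * v (tabloid nu (inv p \<circ> U)))"
    unfolding col_antisym_def using colstab_permutes[of _ mu T] n U
    by (auto simp: sum_fun_apply act_tabloid intro!: sum.cong)
  also have "\<dots> = 0"
  proof (rule alternating_sum_eq_0[OF T q(1,2)])
    fix p assume "p \<in> colstab mu T"
    then have p: "p permutes entries mu" and qq: "q permutes entries mu"
      using q(1) colstab_permutes by blast+
    then have "inv (q \<circ> p) = inv p \<circ> q"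
      using q(3) by (simp add: o_inv_distrib permutes_bij)
    then show "v (tabloid nu (inv (q \<circ> p) \<circ> U)) = v (tabloid nu (inv p \<circ> U))"
      using tabloid_comp_eq_iff[of "inv p" nu "q \<circ> U" U] permutes_inv[OF p] tableau_comp[of q nu U] qq U n q(4)
      by (simp add: comp_assoc)
  qed
  finally show ?thesis .
qed

lemma polytabloid_at_tabloid:
  "polytabloid mu T (tabloid mu U)
    = (\<Sum>p\<in>colstab mu T. of_int (sign p) * (if tabloid mu (p \<circ> T) = tabloid mu U then 1 else 0))"
  unfolding polytabloid_def by (rule sum.cong) auto

lemma polytabloid_conflict:
  assumes T: "T \<in> tableaux mu" and U: "U \<in> tableaux mu" and "conflict mu T mu U"
  shows "polytabloid mu T (tabloid mu U) = 0"
proof -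
  obtain q where q: "q \<in> colstab mu T" "sign q = - 1" "inv q = q"
    "tabloid mu (q \<circ> U) = tabloid mu U" using conflict_transpose[OF T U refl assms(3)] .
  have qp: "q permutes entries mu" using q(1) colstab_permutes by blast
  have "tabloid mu ((q \<circ> p) \<circ> T) = tabloid mu U \<longleftrightarrow> tabloid mu (p \<circ> T) = tabloid mu U"
    if "p \<in> colstab mu T" for p
    using tabloid_comp_eq_iff[OF qp tableau_comp[OF colstab_permutes[OF that] T] U] q(4)
    by (simp add: comp_assoc)
  then show ?thesis
    unfolding polytabloid_at_tabloid by (intro alternating_sum_eq_0[OF T q(1,2)]) auto
qed

text \<open>Comparing these numbers for all \<open>k\<close> is the dominance order.\<close>

definition rows_below :: "nat multiset \<Rightarrow> nat \<Rightarrow> nat"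
  where "rows_below mu k = card {c \<in> diagram mu. fst c < k}"



lemma card_eq_sum_fibres:
  assumes "finite A" "\<And>a. a \<in> A \<Longrightarrow> f a < (m :: nat)"
  shows "card A = (\<Sum>j<m. card {a \<in> A. f a = j})"
proof -
  have "(\<Sum>j<m. card {a \<in> A. f a = j}) = card (\<Union>j<m. {a \<in> A. f a = j})"
    using assms(1) by (subst card_UN_disjoint) auto
  also have "(\<Union>j<m. {a \<in> A. f a = j}) = A" using assms(2) by auto
  finally show ?thesis by simp
qed

lemma diagram_col_less: "c \<in> diagram mu \<Longrightarrow> snd c < psize mu"
  unfolding diagram_eq_Sigma by auto

lemma rows_below_eq: "rows_below mu k = (\<Sum>j<psize mu. min k (col_length mu j))"
proof -
  have "rows_below mu k = (\<Sum>j<psize mu. card {c \<in> {c \<in> diagram mu. fst c < k}. snd c = j})"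
    unfolding rows_below_def by (rule card_eq_sum_fibres) (auto dest: diagram_col_less)
  moreover have "{c \<in> {c \<in> diagram mu. fst c < k}. snd c = j} = (\<lambda>i. (i, j)) ` {..<min k (col_length mu j)}" for j
    by (auto simp: diagram_iff)
  ultimately show ?thesis by (simp add: card_image inj_on_def)
qed

lemma card_column_le:
  assumes T: "T \<in> tableaux mu"
  shows "card {a \<in> entries mu. col_of mu T a = j} \<le> col_length mu j"
proof -
  let ?B = "{a \<in> entries mu. col_of mu T a = j}"
  have "inj_on (row_of mu T) ?B" using cell_inject[OF T] by (auto simp: inj_on_def prod_eq_iff)
  moreover have "row_of mu T ` ?B \<subseteq> {..<col_length mu j}"
    using cell_in[OF T] diagram_iff by fastforce
  ultimately show ?thesis
    using card_inj_on_le[of "row_of mu T" ?B "{..<col_length mu j}"] by auto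
qed

text \<open>Without a conflict the entries in one row of \<open>U\<close> lie in distinct columns of
  \<open>T\<close>, so a column of \<open>T\<close> holds at most \<open>k\<close> entries from the
  first \<open>k\<close> rows of \<open>U\<close>. Summed over the columns this is the dominance
  lemma.\<close>

lemma
  assumes T: "T \<in> tableaux mu" and U: "U \<in> tableaux nu" and n: "psize mu = psize nu"
    and nc: "\<not> conflict mu T nu U"
  shows no_conflict_card_le: "card {a \<in> entries mu. row_of nu U a < k \<and> col_of mu T a = j} \<le> min k (col_length mu j)"
    and no_conflict_card_sum: "rows_below nu k
      = (\<Sum>j<psize mu. card {a \<in> entries mu. row_of nu U a < k \<and> col_of mu T a = j})"
proof -
  let ?N = "entries mu"
  let ?A = "{a \<in> ?N. row_of nu U a < k \<and> col_of mu T a = j}"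
  have "inj_on (row_of nu U) ?A"
    using nc unfolding conflict_def inj_on_def by fastforce
  then have 1: "card ?A \<le> k"
    using card_inj_on_le[of "row_of nu U" ?A "{..<k}"] by auto
  have "card ?A \<le> card {a \<in> ?N. col_of mu T a = j}" by (rule card_mono) auto
  with 1 card_column_le[OF T, of j] show "card ?A \<le> min k (col_length mu j)" by simp
  have "rows_below nu k = card (U ` {c \<in> diagram nu. fst c < k})"
    unfolding rows_below_def
    by (rule card_image[symmetric]) (use tableauxD(1)[OF U] in \<open>auto simp: bij_betw_def inj_on_def\<close>)
  also have "U ` {c \<in> diagram nu. fst c < k} = {a \<in> ?N. row_of nu U a < k}"
    using tableau_image_cells[OF U, of "\<lambda>c. fst c < k"] n by simp
  also have "card \<dots> = (\<Sum>j<psize mu. card {a \<in> {a \<in> ?N. row_of nu U a < k}. col_of mu T a = j})"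
    using diagram_col_less cell_in[OF T] by (intro card_eq_sum_fibres) auto
  finally show "rows_below nu k = (\<Sum>j<psize mu. card {a \<in> ?N. row_of nu U a < k \<and> col_of mu T a = j})"
    by (simp add: conj_assoc)
qed

lemma no_conflict_dominates:
  assumes "T \<in> tableaux mu" "U \<in> tableaux nu" "psize mu = psize nu" "\<not> conflict mu T nu U"
  shows "rows_below nu k \<le> rows_below mu k"
  using no_conflict_card_le[OF assms] unfolding no_conflict_card_sum[OF assms] rows_below_eq[of mu]
  by (intro sum_mono) auto

text \<open>Consecutive differences are the row lengths, which determine the diagram. The diagram is
  known here through its columns, so the length of row \<open>i\<close> is first obtained as the
  first column that does not reach row \<open>i\<close>.\<close>

lemma rows_below_inject:
  assumes "\<And>k. rows_below mu k = rows_below nu k" "0 \<notin># mu" "0 \<notin># nu"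
  shows "mu = nu"
proof -
  have row: "\<exists>l. \<forall>j. (i, j) \<in> diagram mu \<longleftrightarrow> j < l" for i mu
  proof -
    have "col_length mu (psize mu) = 0"
      by (rule col_length_eq_0) (rule part_le_sum)
    then have "\<exists>j. col_length mu j \<le> i" by (metis le0)
    define l where "l = (LEAST j. col_length mu j \<le> i)"
    have "col_length mu l \<le> i" unfolding l_def using \<open>\<exists>j. col_length mu j \<le> i\<close> by (rule LeastI_ex)
    then have "i < col_length mu j \<longleftrightarrow> j < l" for j
      using not_less_Least[of j "\<lambda>j. col_length mu j \<le> i"] col_length_antimono[of l j mu]
      unfolding l_def[symmetric] by (meson leD leI order_trans)
    then show ?thesis unfolding diagram_iff by blast
  qed
  define l where "l mu i = (SOME l. \<forall>j. (i, j) \<in> diagram mu \<longleftrightarrow> j < l)" for mu i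
  have l: "(i, j) \<in> diagram mu \<longleftrightarrow> j < l mu i" for mu i j
    using someI_ex[OF row[of i mu]] unfolding l_def by blast
  have "rows_below mu (Suc i) = rows_below mu i + l mu i" for mu i
  proof -
    have "{c \<in> diagram mu. fst c < Suc i}
        = {c \<in> diagram mu. fst c < i} \<union> (\<lambda>j. (i, j)) ` {..<l mu i}"
      by (auto simp: l less_Suc_eq)
    then show ?thesis
      unfolding rows_below_def by (simp, subst card_Un_disjoint) (auto simp: card_image inj_on_def)
  qed
  then have "l mu i = l nu i" for i using assms(1) by (metis add_left_cancel)
  then have "diagram mu = diagram nu" using l by auto
  then show ?thesis using assms(2,3) by (rule diagram_inject)
qed

text \<open>Equal shapes force equality in the counting bound, so the row of an entry in
  \<open>U\<close> always exists in its column of \<open>T\<close>. Placing every entry in its row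
  of \<open>U\<close> and its column of \<open>T\<close> therefore gives a tableau \<open>V\<close>,
  row equivalent to \<open>U\<close> and column equivalent to \<open>T\<close>.\<close>

lemma no_conflict_same_shape:
  assumes T: "T \<in> tableaux mu" and U: "U \<in> tableaux mu" and nc: "\<not> conflict mu T mu U"
  obtains p where "p \<in> colstab mu T" "tabloid mu (p \<circ> T) = tabloid mu U"
proof -
  let ?N = "entries mu"
  have bound: "row_of mu U a < col_length mu (col_of mu T a)" if a: "a \<in> ?N" for a
  proof -
    define j where "j = col_of mu T a"
    \<comment> \<open>With \<open>k\<close> the height of column \<open>j\<close>, equality in the
      bound says that all entries of this column of \<open>T\<close> lie in the first
      \<open>k\<close> rows of \<open>U\<close>.\<close>
    define k where "k = col_length mu j"
    let ?A = "{a \<in> ?N. row_of mu U a < k \<and> col_of mu T a = j}"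
    let ?B = "{a \<in> ?N. col_of mu T a = j}"
    have "j < psize mu" using a cell_in[OF T] diagram_col_less j_def by blast
    have "(\<Sum>j<psize mu. card {a \<in> ?N. row_of mu U a < k \<and> col_of mu T a = j})
        = (\<Sum>j<psize mu. min k (col_length mu j))"
      using no_conflict_card_sum[OF T U refl nc] rows_below_eq by metis
    then have "card ?A = min k (col_length mu j)"
      by (rule sum_mono_inv) (use no_conflict_card_le[OF T U refl nc] \<open>j < _\<close> in auto)
    moreover have "card ?B \<le> k" using card_column_le[OF T] k_def by blast
    ultimately have "?A = ?B" by (intro card_seteq) (auto simp: k_def)
    then show ?thesis using a j_def k_def by blast
  qed
  define f where "f a = (row_of mu U a, col_of mu T a)" for a
  have "inj_on f ?N" using nc by (auto simp: f_def inj_on_def conflict_def)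
  moreover have "f ` ?N \<subseteq> diagram mu" using bound by (auto simp: f_def diagram_iff)
  ultimately have bij: "bij_betw f ?N (diagram mu)"
    using card_diagram[of mu] by (intro bij_betw_imageI card_subset_eq) (auto simp: card_image)
  define V where "V c = (if c \<in> diagram mu then inv_into ?N f c else 0)" for c
  have "bij_betw V (diagram mu) ?N"
    using bij_betw_inv_into[OF bij] by (rule bij_betw_cong[THEN iffD1, rotated]) (simp add: V_def)
  then have V: "V \<in> tableaux mu" unfolding tableaux_def by (simp add: V_def)
  have cellV: "cell mu V a = f a" if "a \<in> ?N" for a
  proof -
    have "V (f a) = a" "f a \<in> diagram mu"
      using that bij by (auto simp: V_def bij_betw_def)
    then show ?thesis using cell_tableau[OF V] by metis
  qed
  obtain p where p: "p permutes ?N" "V = p \<circ> T" using tableau_eq_comp[OF T V] .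
  have "col_of mu T (p a) = col_of mu T a" if a: "a \<in> ?N" for a
  proof -
    have "p a \<in> ?N" using a permutes_in_image[OF p(1)] by blast
    then show ?thesis using cellV[of "p a"] cell_comp'[OF p(1) T a] p(2) by (metis f_def snd_conv)
  qed
  then have "p \<in> colstab mu T" using p(1) unfolding colstab_iff[OF T] by blast
  moreover have "tabloid mu V = tabloid mu U"
    using cellV by (auto simp: tabloid_eq_iff[OF V U] f_def)
  ultimately show ?thesis using that p(2) by blast
qed

text \<open>The entry that \<open>q\<close> sends to \<open>p a\<close> has both the row and the
  column of \<open>a\<close> in \<open>T\<close>, so it is \<open>a\<close>. Hence the tabloids in a
  polytabloid are distinct and its nonzero values are signs.\<close>

lemma colstab_row_trivial:
  assumes T: "T \<in> tableaux mu" and p: "p \<in> colstab mu T" "q \<in> colstab mu T"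
    and eq: "tabloid mu (p \<circ> T) = tabloid mu (q \<circ> T)"
  shows "p = q"
proof
  fix a
  have pp: "p permutes entries mu" and qp: "q permutes entries mu"
    using p colstab_permutes by blast+
  show "p a = q a"
  proof (cases "a \<in> entries mu")
    case True
    define b where "b = inv q (p a)"
    have pa: "p a \<in> entries mu" using True permutes_in_image[OF pp] by blast
    then have b: "b \<in> entries mu" using permutes_in_image[OF permutes_inv[OF qp]] b_def by blast
    have qb: "q b = p a" unfolding b_def using permutes_inverses(1)[OF qp] .
    have "row_of mu (p \<circ> T) (p a) = row_of mu (q \<circ> T) (p a)"
      using eq pa tabloid_eq_iff[OF tableau_comp[OF pp T] tableau_comp[OF qp T]] by blast
    then have "row_of mu T a = row_of mu T b"
      using cell_comp'[OF pp T True] cell_comp'[OF qp T b] qb by simp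
    moreover have "col_of mu T a = col_of mu T b"
      using p True b qb unfolding colstab_iff[OF T] by metis
    ultimately have "a = b" using cell_inject[OF T True b] by (simp add: prod_eq_iff)
    then show ?thesis using qb by simp
  qed (use pp qp in \<open>auto simp: permutes_def\<close>)
qed

lemma polytabloid_at_column_perm:
  assumes T: "T \<in> tableaux mu" and p: "p \<in> colstab mu T"
  shows "polytabloid mu T (tabloid mu (p \<circ> T)) = of_int (sign p)"
proof -
  have "polytabloid mu T (tabloid mu (p \<circ> T)) = (\<Sum>q\<in>colstab mu T. if q = p then of_int (sign q) else 0)"
    unfolding polytabloid_def using colstab_row_trivial[OF T _ p]
    by (intro sum.cong) auto
  then show ?thesis using p by simp
qed

lemma tabloid_space_eqI:
  assumes "u \<in> tabloid_space mu" "v \<in> tabloid_space mu"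
    "\<And>U. U \<in> tableaux mu \<Longrightarrow> u (tabloid mu U) = v (tabloid mu U)"
  shows "u = v"
proof
  fix t show "u t = v t"
    using assms by (cases "t \<in> tabloid mu ` tableaux mu") (auto simp: tabloid_space_def)
qed

lemma subspace_tabloid_space: "cfun.subspace (tabloid_space mu)"
  by (auto simp: cfun.subspace_def tabloid_space_def)

lemma polytabloid_in_tabloid_space:
  assumes "T \<in> tableaux mu" shows "polytabloid mu T \<in> tabloid_space mu"
  using tableau_comp[OF colstab_permutes assms]
  by (auto simp: tabloid_space_def polytabloid_def intro!: sum.neutral)

lemma act_in_tabloid_space:
  assumes "w permutes entries mu" "v \<in> tabloid_space mu"
  shows "act w v \<in> tabloid_space mu"
proof -
  have "t \<in> tabloid mu ` tableaux mu" if t: "(\<lambda>T. inv w \<circ> T) ` t \<in> tabloid mu ` tableaux mu" for t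
  proof -
    obtain T where T: "T \<in> tableaux mu" "(\<lambda>T. inv w \<circ> T) ` t = tabloid mu T"
      using t by (auto simp: image_iff)
    have "t = (\<lambda>T. w \<circ> T) ` (\<lambda>T. inv w \<circ> T) ` t"
      by (simp only: image_image permutes_cancel[OF assms(1)] image_ident)
    also have "\<dots> = tabloid mu (w \<circ> T)" using T image_tabloid[OF assms(1)] by simp
    finally show ?thesis using tableau_comp[OF assms(1) T(1)] by blast
  qed
  then have *: "v ((\<lambda>T. inv w \<circ> T) ` t) = 0" if "t \<notin> tabloid mu ` tableaux mu" for t
    using assms(2) that unfolding tabloid_space_def mem_Collect_eq by metis
  show ?thesis unfolding tabloid_space_def perm_action_def mem_Collect_eq by (intro allI impI *)
qed

lemma col_antisym_in_tabloid_space: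
  assumes "psize mu = psize nu" "v \<in> tabloid_space nu"
  shows "col_antisym mu T v \<in> tabloid_space nu"
  unfolding col_antisym_def
  using act_in_tabloid_space[OF _ assms(2)] colstab_permutes[of _ mu T] assms(1)
  by (intro cfun.subspace_sum cfun.subspace_scale subspace_tabloid_space) auto

text \<open>Compare values at the tabloid of \<open>U\<close>. If \<open>U\<close> conflicts with
  \<open>T\<close>, both sides vanish. Otherwise \<open>U\<close> is row equivalent to
  \<open>p \<circ> T\<close> for a column permutation \<open>p\<close>, and absorbing
  \<open>p\<close> into the summation index costs the factor \<open>sign p\<close>, which is the
  value of the polytabloid there. Schur's lemma rests on this one-dimensional image.\<close>

lemma col_antisym_eq:
  assumes T: "T \<in> tableaux mu" and v: "v \<in> tabloid_space mu"
  shows "col_antisym mu T v = fun_scale (alt_eval mu T v) (polytabloid mu T)"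
proof (rule tabloid_space_eqI)
  show "col_antisym mu T v \<in> tabloid_space mu"
    using v by (intro col_antisym_in_tabloid_space) auto
  show "fun_scale (alt_eval mu T v) (polytabloid mu T) \<in> tabloid_space mu"
    using polytabloid_in_tabloid_space[OF T] by (intro cfun.subspace_scale subspace_tabloid_space)
  fix U assume U: "U \<in> tableaux mu"
  let ?C = "colstab mu T"
  show "col_antisym mu T v (tabloid mu U) = fun_scale (alt_eval mu T v) (polytabloid mu T) (tabloid mu U)"
  proof (cases "conflict mu T mu U")
    case True
    then show ?thesis using col_antisym_conflict[OF T U refl] polytabloid_conflict[OF T U] by simp
  next
    case False
    then obtain p where p: "p \<in> ?C" "tabloid mu (p \<circ> T) = tabloid mu U"
      using no_conflict_same_shape[OF T U] by blast
    have pp: "p permutes entries mu" using p(1) by (rule colstab_permutes)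
    have "col_antisym mu T v (tabloid mu U) = (\<Sum>q\<in>?C. of_int (sign q) * v (tabloid mu (inv q \<circ> (p \<circ> T))))"
      unfolding col_antisym_def p(2)[symmetric]
      using colstab_permutes[of _ mu T] tableau_comp[OF pp T]
      by (auto simp: sum_fun_apply act_tabloid intro!: sum.cong)
    also have "\<dots> = (\<Sum>q\<in>?C. of_int (sign (inv q)) * v (tabloid mu (inv (inv q) \<circ> (p \<circ> T))))"
      by (rule sum_colstab_inv[OF T, symmetric])
    also have "\<dots> = (\<Sum>q\<in>?C. of_int (sign q) * v (tabloid mu (q \<circ> (p \<circ> T))))"
    proof (rule sum.cong[OF refl])
      fix q assume "q \<in> ?C"
      then have q: "q permutes entries mu" by (rule colstab_permutes)
      show "of_int (sign (inv q)) * v (tabloid mu (inv (inv q) \<circ> (p \<circ> T)))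
          = of_int (sign q) * v (tabloid mu (q \<circ> (p \<circ> T)))"
        using sign_permutes_inv[OF q] permutes_inv_inv[OF q] by simp
    qed
    also have "\<dots> = (\<Sum>q\<in>?C. of_int (sign p) * (of_int (sign (q \<circ> p)) * v (tabloid mu ((q \<circ> p) \<circ> T))))"
    proof (rule sum.cong[OF refl])
      fix q assume "q \<in> ?C"
      then have "sign (q \<circ> p) = sign q * sign p"
        using sign_permutes_comp[OF colstab_permutes pp] by blast
      then have "of_int (sign p) * of_int (sign (q \<circ> p)) = (of_int (sign q) :: complex)"
        using sign_mult_self[of p] by simp
      then show "of_int (sign q) * v (tabloid mu (q \<circ> (p \<circ> T)))
          = of_int (sign p) * (of_int (sign (q \<circ> p)) * v (tabloid mu ((q \<circ> p) \<circ> T)))"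
        by (metis comp_assoc mult.assoc)
    qed
    also have "\<dots> = of_int (sign p) * (\<Sum>q\<in>?C. of_int (sign (q \<circ> p)) * v (tabloid mu ((q \<circ> p) \<circ> T)))"
      by (simp add: sum_distrib_left)
    also have "(\<Sum>q\<in>?C. of_int (sign (q \<circ> p)) * v (tabloid mu ((q \<circ> p) \<circ> T))) = alt_eval mu T v"
      unfolding alt_eval_def
    proof (rule sum.reindex_bij_witness[of _ "\<lambda>q. q \<circ> inv p" "\<lambda>q. q \<circ> p"])
      show "(q \<circ> p) \<circ> inv p = q" "(q \<circ> inv p) \<circ> p = q" for q
        using permutes_inv_o[OF pp] by (simp_all add: comp_assoc)
    qed (use p(1) comp_in_colstab[OF T] inv_in_colstab[OF T] in auto)
    finally show ?thesis
      using polytabloid_at_column_perm[OF T p(1)] p(2) by (simp add: mult.commute)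
  qed
qed

section \<open>Conjugation of column stabilizers\<close>

lemma conj_in_colstab:
  assumes T: "T \<in> tableaux mu" and w: "w permutes entries mu" and p: "p \<in> colstab mu T"
  shows "w \<circ> p \<circ> inv w \<in> colstab mu (w \<circ> T)"
  unfolding colstab_iff[OF tableau_comp[OF w T]]
proof (intro conjI ballI)
  have pp: "p permutes entries mu" using p by (rule colstab_permutes)
  show "w \<circ> p \<circ> inv w permutes entries mu"
    using w pp by (intro permutes_compose permutes_inv)
  fix a assume a: "a \<in> entries mu"
  then have i: "inv w a \<in> entries mu" using permutes_in_image[OF permutes_inv[OF w]] by blast
  then have "p (inv w a) \<in> entries mu" using permutes_in_image[OF pp] by blast
  then show "col_of mu (w \<circ> T) ((w \<circ> p \<circ> inv w) a) = col_of mu (w \<circ> T) a"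
    using cell_comp'[OF w T] cell_comp[OF w T a] p i unfolding colstab_iff[OF T] by simp
qed

lemma sum_colstab_conj:
  assumes T: "T \<in> tableaux mu" and w: "w permutes entries mu"
  shows "(\<Sum>p\<in>colstab mu (w \<circ> T). g p) = (\<Sum>p\<in>colstab mu T. g (w \<circ> p \<circ> inv w))"
proof (rule sum.reindex_bij_witness[of _ "\<lambda>p. w \<circ> p \<circ> inv w" "\<lambda>p. inv w \<circ> p \<circ> w"])
  note o = permutes_inv_o[OF w]
  show "w \<circ> (inv w \<circ> p \<circ> w) \<circ> inv w = p" "inv w \<circ> (w \<circ> p \<circ> inv w) \<circ> w = p" for p
    using o by (simp_all add: comp_assoc permutes_cancel[OF w])
  show "inv w \<circ> p \<circ> w \<in> colstab mu T" if "p \<in> colstab mu (w \<circ> T)" for p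
    using conj_in_colstab[OF tableau_comp[OF w T] permutes_inv[OF w] that]
    by (simp add: permutes_inv_inv[OF w] permutes_cancel[OF w])
  show "g (w \<circ> (inv w \<circ> p \<circ> w) \<circ> inv w) = g p" for p
    using o by (simp add: comp_assoc permutes_cancel[OF w])
qed (use conj_in_colstab[OF T w] in auto)

lemma sign_conj:
  assumes "p permutes {1..n::nat}" "w permutes {1..n}"
  shows "sign (w \<circ> p \<circ> inv w) = sign p"
  using assms sign_permutes_comp[of w n p] sign_permutes_comp[of "w \<circ> p" n "inv w"]
    sign_permutes_inv[of w n] permutes_compose[of p _ w] permutes_inv[of w]
  by (auto simp: sign_def)

lemma act_polytabloid:
  assumes T: "T \<in> tableaux mu" and w: "w permutes entries mu"
  shows "act w (polytabloid mu T) = polytabloid mu (w \<circ> T)"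
proof
  fix t
  have im: "tabloid mu (p \<circ> T) = (\<lambda>T. inv w \<circ> T) ` t \<longleftrightarrow> tabloid mu (w \<circ> (p \<circ> T)) = t"
    if "p \<in> colstab mu T" for p
  proof -
    have "tabloid mu (w \<circ> (p \<circ> T)) = (\<lambda>T. w \<circ> T) ` tabloid mu (p \<circ> T)"
      using image_tabloid[OF w tableau_comp[OF colstab_permutes[OF that] T]] by simp
    then show ?thesis
      using permutes_inv_o[OF w] by (auto simp: image_image comp_assoc[symmetric])
  qed
  have "polytabloid mu (w \<circ> T) t = (\<Sum>p\<in>colstab mu T.
      if tabloid mu (w \<circ> (p \<circ> T)) = t then of_int (sign p) else 0)"
    unfolding polytabloid_def sum_colstab_conj[OF T w]
  proof (rule sum.cong[OF refl])
    fix p assume p: "p \<in> colstab mu T"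
    have "w \<circ> p \<circ> inv w \<circ> (w \<circ> T) = w \<circ> (p \<circ> T)" by (simp only: comp_assoc permutes_cancel[OF w])
    then show "(if tabloid mu (w \<circ> p \<circ> inv w \<circ> (w \<circ> T)) = t then of_int (sign (w \<circ> p \<circ> inv w)) else 0)
        = (if tabloid mu (w \<circ> (p \<circ> T)) = t then complex_of_int (sign p) else 0)"
      using sign_conj[OF colstab_permutes[OF p] w] by simp
  qed
  then show "act w (polytabloid mu T) t = polytabloid mu (w \<circ> T) t"
    unfolding perm_action_def polytabloid_def using im by (auto intro!: sum.cong)
qed

subsection \<open>Schur's lemma and orthogonality of the characters\<close>

abbreviation perms :: "nat \<Rightarrow> (nat \<Rightarrow> nat) set"
  where "perms n \<equiv> {w. w permutes {1..n}}"

lemma finite_perms [simp]: "finite (perms n)"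
  by (simp add: finite_permutations)

lemma sum_perms_left:
  assumes "g permutes {1..n}"
  shows "(\<Sum>w\<in>perms n. f (g \<circ> w)) = (\<Sum>w\<in>perms n. f w)"
  using assms by (intro sum_left_translate[OF assms]) (auto intro: permutes_compose permutes_inv)

lemma sum_tableaux_comp:
  assumes "g permutes entries mu"
  shows "(\<Sum>U\<in>tableaux mu. f (g \<circ> U)) = (\<Sum>U\<in>tableaux mu. f U)"
  by (intro sum_left_translate[OF assms] tableau_comp assms permutes_inv)

lemma polytabloid_in_specht: "T \<in> tableaux mu \<Longrightarrow> polytabloid mu T \<in> specht mu"
  unfolding specht_module_def by (intro cfun.span_base) auto

lemma subspace_specht: "cfun.subspace (specht mu)"
  unfolding specht_module_def by simp

lemma specht_span:
  "finite (polytabloid mu ` tableaux mu)" "cfun.span (polytabloid mu ` tableaux mu) = specht mu"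
  by (simp_all add: specht_module_def)

lemma specht_subset_tabloid_space: "specht mu \<subseteq> tabloid_space mu"
  unfolding specht_module_def
  by (intro cfun.span_minimal subspace_tabloid_space) (auto intro: polytabloid_in_tabloid_space)

lemma specht_induct:
  assumes "v \<in> specht mu" "cfun.subspace {v. P v}" "\<And>T. T \<in> tableaux mu \<Longrightarrow> P (polytabloid mu T)"
  shows "P v"
proof -
  have "specht mu \<subseteq> {v. P v}"
    unfolding specht_module_def using assms(2,3) by (intro cfun.span_minimal) auto
  then show ?thesis using assms(1) by blast
qed

lemma subspace_clinear_vimage:
  assumes "clinear F" "cfun.subspace V" shows "cfun.subspace {v. F v \<in> V}"
  using assms by (auto simp: cfun.subspace_def clinear_iff)
    (metis cfun.scale_zero_left)

lemma subspace_clinear_eq: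
  assumes "clinear F" "clinear H" shows "cfun.subspace {v. F v = H v}"
  using assms by (auto simp: cfun.subspace_def clinear_iff)
    (metis cfun.scale_zero_left)

lemma act_in_specht:
  assumes "w permutes entries mu" "v \<in> specht mu"
  shows "act w v \<in> specht mu"
  using assms(2)
  by (rule specht_induct[OF _ subspace_clinear_vimage[OF clinear_act subspace_specht]])
    (simp add: act_polytabloid[OF _ assms(1)] polytabloid_in_specht tableau_comp[OF assms(1)])

lemma cfunctional_alt_eval: "cfunctional (alt_eval mu T)"
  by (auto simp: cfunctional_iff alt_eval_def algebra_simps sum.distrib sum_distrib_left intro!: sum.cong)

lemma alt_eval_sum: "alt_eval mu T (\<Sum>i\<in>I. f i) = (\<Sum>i\<in>I. alt_eval mu T (f i))"
  by (rule cfunctional_sum[OF cfunctional_alt_eval])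

lemma alt_eval_scale: "alt_eval mu T (fun_scale c v) = c * alt_eval mu T v"
  using cfunctional_alt_eval by (auto simp: cfunctional_iff)

text \<open>Gram matrix of the polytabloids. Its symmetry makes characters invariant under
  inversion, its reality makes them real, and both make the frame constant nonzero.\<close>

abbreviation "gram mu T U \<equiv> alt_eval mu T (polytabloid mu U)"

lemma gram_eq:
  "gram mu T U = (\<Sum>p\<in>colstab mu T. \<Sum>q\<in>colstab mu U.
    of_int (sign p) * of_int (sign q) * (if tabloid mu (q \<circ> U) = tabloid mu (p \<circ> T) then 1 else 0))"
  by (auto simp: alt_eval_def polytabloid_at_tabloid sum_distrib_left intro!: sum.cong)

lemma gram_commute:
  "gram mu T U = gram mu U T"
  unfolding gram_eq by (subst sum.swap) (auto intro!: sum.cong)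

lemma gram_real: "gram mu T U \<in> \<real>"
  unfolding gram_eq by (intro sum_in_Reals Reals_mult) auto

lemma gram_self:
  assumes "T \<in> tableaux mu"
  shows "gram mu T T = of_nat (card (colstab mu T))"
  using polytabloid_at_column_perm[OF assms] by (simp add: alt_eval_def sign_mult_self)

lemma card_colstab_pos: "T \<in> tableaux mu \<Longrightarrow> card (colstab mu T) > 0"
  using id_in_colstab by (auto simp: card_gt_0_iff)

lemma alt_eval_comp:
  assumes T: "T \<in> tableaux mu" and w: "w permutes entries mu"
  shows "alt_eval mu (w \<circ> T) v = alt_eval mu T (act (inv w) v)"
  unfolding alt_eval_def sum_colstab_conj[OF T w]
proof (rule sum.cong[OF refl])
  fix p assume "p \<in> colstab mu T"
  then have p: "p permutes entries mu" by (rule colstab_permutes)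
  have "w \<circ> p \<circ> inv w \<circ> (w \<circ> T) = w \<circ> (p \<circ> T)" by (simp only: comp_assoc permutes_cancel[OF w])
  then show "of_int (sign (w \<circ> p \<circ> inv w)) * v (tabloid mu (w \<circ> p \<circ> inv w \<circ> (w \<circ> T)))
      = of_int (sign p) * act (inv w) v (tabloid mu (p \<circ> T))"
    using sign_conj[OF p w] act_tabloid[OF permutes_inv[OF w] tableau_comp[OF p T]]
    by (simp add: permutes_inv_inv[OF w])
qed

lemma col_antisym_polytabloid:
  assumes "T \<in> tableaux mu"
  shows "col_antisym mu T (polytabloid mu T) = fun_scale (of_nat (card (colstab mu T))) (polytabloid mu T)"
  using col_antisym_eq[OF assms polytabloid_in_tabloid_space[OF assms]] gram_self[OF assms]
  by simp

text \<open>Since the function type is the same for all shapes, a homomorphism between modules of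
  different shapes is still an operator on one space, and one definition serves both halves of
  Schur's lemma.\<close>

definition equivariant ::
    "nat \<Rightarrow> (tabfun \<Rightarrow> tabfun) \<Rightarrow> bool"
  where "equivariant n A \<longleftrightarrow> clinear A \<and>
    (\<forall>w v. w permutes {1..n} \<longrightarrow> A (act w v) = act w (A v))"

lemma equivariantD:
  assumes "equivariant n A"
  shows "clinear A" "w permutes {1..n} \<Longrightarrow> A (act w v) = act w (A v)"
  using assms by (auto simp: equivariant_def)

lemma equivariant_col_antisym:
  assumes "equivariant (psize mu) A"
  shows "A (col_antisym mu T v) = col_antisym mu T (A v)"
proof -
  note A = equivariantD[OF assms]
  have "A (fun_scale c (act p v)) = fun_scale c (act p (A v))"
    if "p \<in> colstab mu T" for c p
    using A(1) A(2)[OF colstab_permutes[OF that]] by (simp add: clinear_iff)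
  then show ?thesis unfolding col_antisym_def clinear_sum[OF A(1)] by (intro sum.cong) auto
qed

text \<open>A polytabloid is fixed by its own column antisymmetrizer up to the order of the column
  stabilizer, and \<open>A\<close> commutes with antisymmetrizers. So the image of the polytabloid
  is again an antisymmetrized function.\<close>

lemma equivariant_polytabloid:
  assumes T: "T \<in> tableaux mu" and A: "equivariant (psize mu) A"
  shows "A (polytabloid mu T)
    = fun_scale (1 / of_nat (card (colstab mu T))) (col_antisym mu T (A (polytabloid mu T)))"
proof -
  let ?c = "of_nat (card (colstab mu T)) :: complex"
  have "col_antisym mu T (A (polytabloid mu T)) = A (col_antisym mu T (polytabloid mu T))"
    using equivariant_col_antisym[OF A] by simp
  also have "\<dots> = fun_scale ?c (A (polytabloid mu T))"
    using equivariantD(1)[OF A] col_antisym_polytabloid[OF T] by (simp add: clinear_iff)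
  finally show ?thesis
    using card_colstab_pos[OF T] by (auto simp: fun_eq_iff simp del: card_gt_0_iff)
qed

text \<open>By \<open>col_antisym_eq\<close> an antisymmetrized function is a multiple of the
  polytabloid, and the factor is the same for all tableaux because they form one orbit. It suffices
  that \<open>A\<close> maps into the permutation module. The second conclusion serves to compute
  the scalar.\<close>

lemma schur_scalar:
  assumes A: "equivariant (psize mu) A"
    and into: "\<And>T. T \<in> tableaux mu \<Longrightarrow> A (polytabloid mu T) \<in> tabloid_space mu"
  obtains s where "\<And>v. v \<in> specht mu \<Longrightarrow> A v = fun_scale s v"
    "\<And>T. T \<in> tableaux mu \<Longrightarrow>
      s * of_nat (card (colstab mu T)) = alt_eval mu T (A (polytabloid mu T))"
proof -
  obtain T where T: "T \<in> tableaux mu" using tableaux_nonempty by blast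
  define s where "s = alt_eval mu T (A (polytabloid mu T)) / of_nat (card (colstab mu T))"
  have AT: "A (polytabloid mu T) = fun_scale s (polytabloid mu T)"
    unfolding s_def using equivariant_polytabloid[OF T A] col_antisym_eq[OF T into[OF T]] by (simp add: fun_eq_iff)
  have AU: "A (polytabloid mu U) = fun_scale s (polytabloid mu U)" if U: "U \<in> tableaux mu" for U
  proof -
    obtain w where w: "w permutes entries mu" "U = w \<circ> T" using tableau_eq_comp[OF T U] .
    have "A (polytabloid mu U) = act w (A (polytabloid mu T))"
      using equivariantD(2)[OF A w(1)] act_polytabloid[OF T w(1)] w(2) by metis
    also have "\<dots> = fun_scale s (polytabloid mu U)"
      using AT clinear_act act_polytabloid[OF T w(1)] w(2) by (simp add: clinear_iff)
    finally show ?thesis .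
  qed
  have "clinear (\<lambda>v. fun_scale s v)" by (auto simp: clinear_iff fun_eq_iff algebra_simps)
  then have "A v = fun_scale s v" if "v \<in> specht mu" for v
    using specht_induct[OF that subspace_clinear_eq[OF equivariantD(1)[OF A]]] AU by blast
  moreover have "s * of_nat (card (colstab mu U)) = alt_eval mu U (A (polytabloid mu U))"
    if U: "U \<in> tableaux mu" for U
    using AU[OF U] alt_eval_scale gram_self[OF U] by simp
  ultimately show ?thesis using that by blast
qed

text \<open>If every tableau of shape \<open>mu\<close> conflicts with \<open>T\<close>, the
  antisymmetrizer of \<open>T\<close> kills the permutation module of \<open>mu\<close>.\<close>

lemma schur_zero:
  assumes n: "psize nu = psize mu" and A: "equivariant (psize nu) A"
    and into: "\<And>T. T \<in> tableaux nu \<Longrightarrow> A (polytabloid nu T) \<in> tabloid_space mu"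
    and conflict: "\<And>T U. \<lbrakk>T \<in> tableaux nu; U \<in> tableaux mu\<rbrakk> \<Longrightarrow> conflict nu T mu U"
    and T: "T \<in> tableaux nu"
  shows "A (polytabloid nu T) = 0"
proof -
  have "col_antisym nu T (A (polytabloid nu T)) = 0"
  proof (rule tabloid_space_eqI)
    show "col_antisym nu T (A (polytabloid nu T)) \<in> tabloid_space mu"
      by (rule col_antisym_in_tabloid_space[OF n into[OF T]])
    show "0 \<in> tabloid_space mu" by (rule cfun.subspace_0[OF subspace_tabloid_space])
    show "col_antisym nu T (A (polytabloid nu T)) (tabloid mu U) = 0 (tabloid mu U)" if "U \<in> tableaux mu" for U
      using col_antisym_conflict[OF T that n conflict[OF T that]] by simp
  qed
  then show ?thesis using equivariant_polytabloid[OF T A] by simp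
qed

section \<open>Averaged operators and the frame of polytabloids\<close>

lemma act_inverse:
  assumes "w permutes A"
  shows "act w (act (inv w) v) = v" "act (inv w) (act w v) = v"
  using act_comp[OF assms permutes_inv[OF assms], of v] act_comp[OF permutes_inv[OF assms] assms, of v]
    permutes_inv_o[OF assms] by simp_all

text \<open>The unnormalized group average, by conjugation, of the rank-one operator sending
  \<open>v\<close> to \<open>alt_eval nu T' v\<close> times \<open>polytabloid mu T\<close>.\<close>

definition average_op where
  "average_op mu T nu T' v = (\<Sum>w\<in>perms (psize nu).
    fun_scale (alt_eval nu T' (act (inv w) v)) (act w (polytabloid mu T)))"

lemma equivariant_average_op: "equivariant (psize nu) (average_op mu T nu T')"
  unfolding equivariant_def
proof (intro conjI allI impI)
  show "clinear (average_op mu T nu T')"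
    using cfunctional_alt_eval[of nu T'] clinear_act unfolding average_op_def
    by (intro clinearI)
      (auto simp: cfunctional_iff clinear_iff cfun.scale_left_distrib sum.distrib cfun.scale_sum_right)
  fix g v assume g: "g permutes entries nu"
  let ?h = "\<lambda>v w. fun_scale (alt_eval nu T' (act (inv w) v)) (act w (polytabloid mu T))"
  have "average_op mu T nu T' (act g v) = (\<Sum>w\<in>perms (psize nu). ?h (act g v) (g \<circ> w))"
    unfolding average_op_def by (rule sum_perms_left[OF g, symmetric])
  also have "\<dots> = (\<Sum>w\<in>perms (psize nu). act g (?h v w))"
  proof (rule sum.cong[OF refl])
    fix w assume "w \<in> perms (psize nu)"
    then have w: "w permutes entries nu" by simp
    have "inv (g \<circ> w) = inv w \<circ> inv g" using g w by (simp add: o_inv_distrib permutes_bij)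
    then have "act (inv (g \<circ> w)) (act g v) = act (inv w) v"
      using act_comp[OF permutes_inv[OF w] permutes_inv[OF g]] act_inverse(2)[OF g] by simp
    then show "?h (act g v) (g \<circ> w) = act g (?h v w)"
      using act_comp[OF g w] clinear_act[of g] by (simp add: clinear_iff)
  qed
  also have "\<dots> = act g (average_op mu T nu T' v)"
    unfolding average_op_def by (rule clinear_sum[OF clinear_act, symmetric])
  finally show "average_op mu T nu T' (act g v) = act g (average_op mu T nu T' v)" .
qed

text \<open>By Schur's lemma this operator is a scalar on the Specht module, so the polytabloids form a
  tight frame there, and traces can be computed without choosing a basis.\<close>

definition frame_op where
  "frame_op mu v = (\<Sum>U\<in>tableaux mu. fun_scale (alt_eval mu U v) (polytabloid mu U))"

text \<open>The tableaux of one shape form a free orbit, so summing over tableaux is summing over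
  the group.\<close>

lemma frame_op_eq_average_op:
  assumes T: "T \<in> tableaux mu"
  shows "frame_op mu = average_op mu T mu T"
proof
  fix v
  have "frame_op mu v
      = (\<Sum>w\<in>perms (psize mu). fun_scale (alt_eval mu (w \<circ> T) v) (polytabloid mu (w \<circ> T)))"
    unfolding frame_op_def by (rule sum.reindex_bij_betw[OF bij_betw_perms_tableaux[OF T], symmetric])
  then show "frame_op mu v = average_op mu T mu T v"
    unfolding average_op_def using alt_eval_comp[OF T] act_polytabloid[OF T] by simp
qed

lemma equivariant_frame_op: "equivariant (psize mu) (frame_op mu)"
  using tableaux_nonempty[of mu] frame_op_eq_average_op equivariant_average_op by fastforce

text \<open>By Schur's lemma the scalar times \<open>card (colstab mu T)\<close> is a sum of squares
  of real Gram entries, and the summand at \<open>U = T\<close> is positive.\<close>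

lemma frame_op_scalar:
  obtains q where "q \<in> \<real>" "q \<noteq> 0" "\<And>v. v \<in> specht mu \<Longrightarrow> frame_op mu v = fun_scale q v"
proof -
  have "frame_op mu v \<in> tabloid_space mu" for v
    unfolding frame_op_def using polytabloid_in_tabloid_space
    by (intro cfun.subspace_sum cfun.subspace_scale subspace_tabloid_space) auto
  then obtain q where q: "\<And>v. v \<in> specht mu \<Longrightarrow> frame_op mu v = fun_scale q v"
    "\<And>T. T \<in> tableaux mu \<Longrightarrow>
      q * of_nat (card (colstab mu T)) = alt_eval mu T (frame_op mu (polytabloid mu T))"
    using schur_scalar[OF equivariant_frame_op, of mu] by blast
  obtain T where T: "T \<in> tableaux mu" using tableaux_nonempty by blast
  define c where "c = real (card (colstab mu T))"
  have c: "c > 0" using card_colstab_pos[OF T] by (simp add: c_def)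
  define r where "r U = Re (gram mu T U)" for U
  have r: "gram mu T U = of_real (r U)" for U
    using gram_real by (simp add: r_def)
  have "alt_eval mu T (frame_op mu (polytabloid mu T)) = (\<Sum>U\<in>tableaux mu. of_real (r U * r U))"
    unfolding frame_op_def alt_eval_sum alt_eval_scale
    using gram_commute r by (intro sum.cong) auto
  also have "\<dots> = of_real (\<Sum>U\<in>tableaux mu. r U * r U)" by simp
  finally have "q * of_real c = of_real (\<Sum>U\<in>tableaux mu. r U * r U)"
    using q(2)[OF T] by (simp add: c_def)
  then have qr: "q = of_real ((\<Sum>U\<in>tableaux mu. r U * r U) / c)" using c by (simp add: field_simps)
  have "r T = c" using gram_self[OF T] by (simp add: r_def c_def)
  then have "(\<Sum>U\<in>tableaux mu. r U * r U) > 0"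
    using T c by (intro sum_pos2[of _ T]) auto
  then have "q \<noteq> 0" using qr c unfolding qr of_real_eq_0_iff by simp
  then show ?thesis using that[of q] q(1) qr Reals_of_real by metis
qed

text \<open>By \<open>specht_dim_eq\<close> this is the factorial of the size times the order of a
  column stabilizer, divided by the dimension, as column stabilizers of one shape are
  conjugate.\<close>

definition frame_const :: "nat multiset \<Rightarrow> complex" where
  "frame_const mu = (SOME q. q \<in> \<real> \<and> q \<noteq> 0 \<and> (\<forall>v\<in>specht mu. frame_op mu v = fun_scale q v))"

lemma
  shows frame_const_real: "frame_const mu \<in> \<real>"
    and frame_const_nonzero: "frame_const mu \<noteq> 0"
    and frame_op_eq: "v \<in> specht mu \<Longrightarrow> frame_op mu v = fun_scale (frame_const mu) v"
proof -
  let ?P = "\<lambda>q. q \<in> \<real> \<and> q \<noteq> 0 \<and> (\<forall>v\<in>specht mu. frame_op mu v = fun_scale q v)"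
  have "\<exists>q. ?P q" using frame_op_scalar[of mu] by metis
  then have "?P (frame_const mu)" unfolding frame_const_def by (rule someI_ex)
  then show "frame_const mu \<in> \<real>" "frame_const mu \<noteq> 0"
    "v \<in> specht mu \<Longrightarrow> frame_op mu v = fun_scale (frame_const mu) v" by auto
qed

lemma specht_frame:
  assumes "v \<in> specht mu"
  shows "v = (\<Sum>U\<in>tableaux mu. fun_scale (alt_eval mu U v / frame_const mu) (polytabloid mu U))"
proof -
  have "v = fun_scale (1 / frame_const mu) (frame_op mu v)"
    using frame_op_eq[OF assms] frame_const_nonzero[of mu] by (simp add: fun_eq_iff)
  also have "\<dots> = (\<Sum>U\<in>tableaux mu. fun_scale (alt_eval mu U v / frame_const mu) (polytabloid mu U))"
    unfolding frame_op_def cfun.scale_sum_right by (simp add: cfun.scale_scale)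
  finally show ?thesis .
qed

lemma cfunctional_divide: "cfunctional f \<Longrightarrow> cfunctional (\<lambda>v. f v / c)"
  by (simp add: cfunctional_iff add_divide_distrib)

lemma trace_on_specht:
  assumes "clinear F" "\<And>v. v \<in> specht mu \<Longrightarrow> F v \<in> specht mu"
  shows "trace_on (specht mu) F
    = (\<Sum>U\<in>tableaux mu. alt_eval mu U (F (polytabloid mu U))) / frame_const mu"
  unfolding sum_divide_distrib
  by (rule trace_on_frame[OF specht_span assms])
    (auto simp: polytabloid_in_specht cfunctional_divide[OF cfunctional_alt_eval] intro: specht_frame)

text \<open>The left-hand side is the frame formula for the trace of the operator sending
  \<open>v\<close> to \<open>f v\<close> times \<open>u\<close>.\<close>

lemma trace_on_specht_rank_one:
  assumes f: "cfunctional f" and u: "u \<in> specht mu"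
  shows "(\<Sum>U\<in>tableaux mu. alt_eval mu U (fun_scale (f (polytabloid mu U)) u)) / frame_const mu = f u"
proof -
  have "f u = f (\<Sum>U\<in>tableaux mu. fun_scale (alt_eval mu U u / frame_const mu) (polytabloid mu U))"
    using specht_frame[OF u] by metis
  also have "\<dots> = (\<Sum>U\<in>tableaux mu. (alt_eval mu U u / frame_const mu) * f (polytabloid mu U))"
    using f by (subst cfunctional_sum[OF f]) (simp add: cfunctional_iff)
  finally show ?thesis by (simp add: alt_eval_scale sum_divide_distrib mult.commute)
qed

section \<open>Characters as sums over tableaux\<close>

abbreviation specht_dim :: "nat multiset \<Rightarrow> nat"
  where "specht_dim mu \<equiv> cfun.dim (specht mu)"

lemma spechar_eq:
  assumes "w permutes entries mu"
  shows "spechar mu w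
    = (\<Sum>U\<in>tableaux mu. alt_eval mu U (act w (polytabloid mu U))) / frame_const mu"
  unfolding specht_character_def
  by (rule trace_on_specht[OF clinear_act act_in_specht[OF assms]])

lemma specht_dim_eq:
  "of_nat (specht_dim mu) = (\<Sum>U\<in>tableaux mu. of_nat (card (colstab mu U))) / frame_const mu"
  using trace_on_specht[of "\<lambda>v. v" mu] trace_on_id[OF specht_span, of mu]
  by (simp add: clinear_iff gram_self)

lemma specht_dim_nonzero: "specht_dim mu \<noteq> 0"
proof -
  obtain T where "T \<in> tableaux mu" using tableaux_nonempty by blast
  then have "(\<Sum>U\<in>tableaux mu. card (colstab mu U)) > 0"
    using card_colstab_pos by (intro sum_pos2[of _ T]) auto
  then have "complex_of_nat (\<Sum>U\<in>tableaux mu. card (colstab mu U)) \<noteq> 0"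
    by (metis of_nat_eq_0_iff less_numeral_extra(3))
  then have "complex_of_nat (specht_dim mu) \<noteq> 0"
    unfolding specht_dim_eq[of mu] using frame_const_nonzero[of mu] by simp
  then show ?thesis by (simp only: of_nat_eq_0_iff not_False_eq_True)
qed

lemma spechar_id: "spechar mu id = of_nat (specht_dim mu)"
  using trace_on_id[OF specht_span, of mu] unfolding specht_character_def act_id .

text \<open>\<open>w\<close> is moved to the other side of the invariant form, which is symmetric on
  polytabloids.\<close>

lemma spechar_inv:
  assumes w: "w permutes entries mu"
  shows "spechar mu (inv w) = spechar mu w"
proof -
  have "(\<Sum>U\<in>tableaux mu. alt_eval mu U (act (inv w) (polytabloid mu U)))
      = (\<Sum>U\<in>tableaux mu. alt_eval mu (w \<circ> U) (polytabloid mu U))"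
    using alt_eval_comp[OF _ w] by (intro sum.cong) auto
  also have "\<dots> = (\<Sum>U\<in>tableaux mu. alt_eval mu U (act w (polytabloid mu U)))"
    using act_polytabloid[OF _ w] gram_commute by (intro sum.cong) auto
  finally show ?thesis
    using spechar_eq[OF w] spechar_eq[OF permutes_inv[OF w]] by simp
qed

lemma spechar_real:
  assumes w: "w permutes entries mu"
  shows "spechar mu w \<in> \<real>"
  unfolding spechar_eq[OF w]
  using frame_const_real gram_real act_polytabloid[OF _ w]
  by (intro Reals_divide sum_in_Reals) auto

lemma spechar_conj:
  assumes g: "g permutes entries mu" and w: "w permutes entries mu"
  shows "spechar mu (g \<circ> w \<circ> inv g) = spechar mu w"
proof -
  let ?h = "\<lambda>U. alt_eval mu U (act (g \<circ> w \<circ> inv g) (polytabloid mu U))"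
  have "(\<Sum>U\<in>tableaux mu. ?h U) = (\<Sum>U\<in>tableaux mu. ?h (g \<circ> U))"
    by (rule sum_tableaux_comp[OF g, symmetric])
  also have "\<dots> = (\<Sum>U\<in>tableaux mu. alt_eval mu U (act w (polytabloid mu U)))"
  proof (rule sum.cong[OF refl])
    fix U assume U: "U \<in> tableaux mu"
    have "act (g \<circ> w \<circ> inv g) (polytabloid mu (g \<circ> U))
        = act g (act w (act (inv g) (act g (polytabloid mu U))))"
      using act_polytabloid[OF U g] act_comp[OF permutes_compose[OF w g] permutes_inv[OF g]]
        act_comp[OF g w] by simp
    then show "?h (g \<circ> U) = alt_eval mu U (act w (polytabloid mu U))"
      using alt_eval_comp[OF U g] act_inverse(2)[OF g] by simp
  qed
  finally show ?thesis
    using spechar_eq[OF w] spechar_eq[OF permutes_compose[OF permutes_inv[OF g] permutes_compose[OF w g]]]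
    by simp
qed

section \<open>Orthogonality\<close>

lemma average_op_in_specht:
  assumes "psize nu = psize mu" "T \<in> tableaux mu"
  shows "average_op mu T nu T' v \<in> specht mu"
  unfolding average_op_def using assms
  by (intro cfun.subspace_sum cfun.subspace_scale subspace_specht)
    (auto intro: act_in_specht polytabloid_in_specht)

text \<open>Both characters are expanded over tableaux. For fixed \<open>T\<close> and
  \<open>T'\<close> the sum over the group of a product of two matrix coefficients is one matrix
  coefficient of an averaged operator, to which Schur's lemma applies.\<close>

lemma character_product_sum:
  assumes n: "psize nu = psize mu"
  shows "(\<Sum>w\<in>perms (psize mu). spechar mu w * spechar nu (inv w))
    = (\<Sum>T\<in>tableaux mu. \<Sum>T'\<in>tableaux nu. alt_eval mu T (average_op mu T nu T' (polytabloid nu T')))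
      / (frame_const mu * frame_const nu)"
proof -
  let ?f = "\<lambda>w T T'. alt_eval mu T (act w (polytabloid mu T)) * alt_eval nu T' (act (inv w) (polytabloid nu T'))"
  have "spechar mu w * spechar nu (inv w)
      = (\<Sum>T\<in>tableaux mu. \<Sum>T'\<in>tableaux nu. ?f w T T') / (frame_const mu * frame_const nu)"
    if "w \<in> perms (psize mu)" for w
  proof -
    have w: "w permutes entries mu" "inv w permutes entries nu"
      using that n permutes_inv by auto
    show ?thesis unfolding spechar_eq[OF w(1)] spechar_eq[OF w(2)]
      by (simp add: sum_product)
  qed
  then have "(\<Sum>w\<in>perms (psize mu). spechar mu w * spechar nu (inv w))
      = (\<Sum>w\<in>perms (psize mu). \<Sum>T\<in>tableaux mu. \<Sum>T'\<in>tableaux nu. ?f w T T') / (frame_const mu * frame_const nu)"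
    by (simp add: sum_divide_distrib)
  also have "(\<Sum>w\<in>perms (psize mu). \<Sum>T\<in>tableaux mu. \<Sum>T'\<in>tableaux nu. ?f w T T')
      = (\<Sum>T\<in>tableaux mu. \<Sum>T'\<in>tableaux nu. \<Sum>w\<in>perms (psize mu). ?f w T T')"
    by (subst sum.swap, rule sum.cong[OF refl], rule sum.swap)
  moreover have "(\<Sum>w\<in>perms (psize mu). ?f w T T') = alt_eval mu T (average_op mu T nu T' (polytabloid nu T'))" for T T'
    unfolding average_op_def alt_eval_sum alt_eval_scale n by (simp add: mult.commute)
  ultimately show ?thesis by simp
qed

lemma character_orthogonal_aux:
  assumes n: "psize nu = psize mu"
    and conflict: "\<And>T U. \<lbrakk>T \<in> tableaux nu; U \<in> tableaux mu\<rbrakk> \<Longrightarrow> conflict nu T mu U"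
  shows "(\<Sum>w\<in>perms (psize mu). spechar mu w * spechar nu (inv w)) = 0"
proof -
  have "average_op mu T nu T' (polytabloid nu T') = 0" if "T \<in> tableaux mu" "T' \<in> tableaux nu" for T T'
    using average_op_in_specht[OF n that(1)] specht_subset_tabloid_space
    by (intro schur_zero[OF n equivariant_average_op _ conflict that(2)]) blast
  then show ?thesis
    unfolding character_product_sum[OF n] by (simp add: alt_eval_def)
qed

text \<open>Conflict-free pairs in both directions would make the shapes dominate each other and
  hence coincide. So Schur's lemma gives zero for at least one order of the two characters, and
  inversion invariance makes the order immaterial.\<close>

lemma character_orthogonal:
  assumes n: "psize nu = psize mu" and "0 \<notin># mu" "0 \<notin># nu" "mu \<noteq> nu"
  shows "(\<Sum>w\<in>perms (psize mu). spechar mu w * spechar nu w) = 0"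
proof -
  have "(\<forall>T\<in>tableaux nu. \<forall>U\<in>tableaux mu. conflict nu T mu U) \<or>
        (\<forall>T\<in>tableaux mu. \<forall>U\<in>tableaux nu. conflict mu T nu U)"
  proof (rule ccontr)
    assume "\<not> ?thesis"
    then have "rows_below mu k \<le> rows_below nu k \<and> rows_below nu k \<le> rows_below mu k" for k
      using no_conflict_dominates n by metis
    then have "mu = nu" using assms(2,3) by (intro rows_below_inject) (auto intro: antisym)
    then show False using assms(4) by simp
  qed
  then have "(\<Sum>w\<in>perms (psize mu). spechar mu w * spechar nu (inv w)) = 0 \<or>
        (\<Sum>w\<in>perms (psize mu). spechar nu w * spechar mu (inv w)) = 0"
    using character_orthogonal_aux[OF n] character_orthogonal_aux[OF n[symmetric]] n by metis
  moreover have "spechar mu (inv w) = spechar mu w"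
      "spechar nu (inv w) = spechar nu w" if "w \<in> perms (psize mu)" for w
    using that spechar_inv n by auto
  ultimately show ?thesis by (auto simp: mult.commute)
qed

text \<open>For equal shapes the averaged operators are scalars, found by comparing traces. What is
  left is a sum of products of Gram entries, which the frame operator evaluates.\<close>

lemma character_norm:
  "(\<Sum>w\<in>perms (psize mu). spechar mu w * spechar mu w) = fact (psize mu)"
proof -
  let ?d = "of_nat (specht_dim mu) :: complex"
  let ?q = "frame_const mu"
  have d: "?d \<noteq> 0" using specht_dim_nonzero[of mu] by simp
  have avg: "alt_eval mu T (average_op mu T mu T' (polytabloid mu T'))
      = fact (psize mu) / ?d * (gram mu T' T * gram mu T T')"
    if T: "T \<in> tableaux mu" "T' \<in> tableaux mu" for T T'
  proof -
    have "average_op mu T mu T' v \<in> tabloid_space mu" for v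
      using average_op_in_specht[OF refl T(1)] specht_subset_tabloid_space by blast
    then obtain s where s: "\<And>v. v \<in> specht mu \<Longrightarrow> average_op mu T mu T' v = fun_scale s v"
      using schur_scalar[OF equivariant_average_op, of mu mu T T'] by metis
    let ?F = "\<lambda>w v. fun_scale (alt_eval mu T' (act (inv w) v)) (act w (polytabloid mu T))"
    \<comment> \<open>The trace of the average in two ways: it is the trace of the scalar
      \<open>s\<close>, and each of its rank-one summands contributes the same value
      \<open>gram mu T' T\<close>.\<close>
    have "s * ?d = (\<Sum>U\<in>tableaux mu. alt_eval mu U (fun_scale s (polytabloid mu U))) / ?q"
      unfolding specht_dim_eq alt_eval_scale
      by (simp add: gram_self sum_distrib_left)
    also have "\<dots> = (\<Sum>U\<in>tableaux mu. alt_eval mu U (average_op mu T mu T' (polytabloid mu U))) / ?q"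
      using s polytabloid_in_specht by simp
    also have "\<dots> = (\<Sum>w\<in>perms (psize mu). (\<Sum>U\<in>tableaux mu. alt_eval mu U (?F w (polytabloid mu U))) / ?q)"
      unfolding average_op_def alt_eval_sum by (subst sum.swap) (simp add: sum_divide_distrib)
    also have "\<dots> = (\<Sum>w\<in>perms (psize mu). gram mu T' T)"
    proof (rule sum.cong[OF refl])
      fix w assume "w \<in> perms (psize mu)"
      then have w: "w permutes entries mu" by simp
      have "cfunctional (\<lambda>v. alt_eval mu T' (act (inv w) v))"
        using cfunctional_alt_eval[of mu T'] clinear_act[of "inv w"]
        by (simp add: cfunctional_iff clinear_iff)
      from trace_on_specht_rank_one[OF this act_in_specht[OF w polytabloid_in_specht[OF T(1)]]]
      show "(\<Sum>U\<in>tableaux mu. alt_eval mu U (?F w (polytabloid mu U))) / ?q = gram mu T' T"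
        using act_inverse(2)[OF w] by simp
    qed
    also have "\<dots> = fact (psize mu) * gram mu T' T"
      using card_permutations[of "entries mu"] by simp
    finally have "s = fact (psize mu) / ?d * gram mu T' T"
      using d by (simp add: field_simps)
    then show ?thesis using s[OF polytabloid_in_specht[OF T(2)]] alt_eval_scale by simp
  qed
  have inner: "(\<Sum>T'\<in>tableaux mu. gram mu T' T * gram mu T T')
      = ?q * of_nat (card (colstab mu T))" if T: "T \<in> tableaux mu" for T
  proof -
    have "(\<Sum>T'\<in>tableaux mu. gram mu T' T * gram mu T T')
        = alt_eval mu T (frame_op mu (polytabloid mu T))"
      unfolding frame_op_def alt_eval_sum alt_eval_scale ..
    then show ?thesis
      using frame_op_eq[OF polytabloid_in_specht[OF T]] gram_self[OF T] alt_eval_scale by simp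
  qed
  have "(\<Sum>w\<in>perms (psize mu). spechar mu w * spechar mu w)
      = (\<Sum>w\<in>perms (psize mu). spechar mu w * spechar mu (inv w))"
    using spechar_inv by (intro sum.cong) auto
  also have "\<dots> = (\<Sum>T\<in>tableaux mu. \<Sum>T'\<in>tableaux mu.
      fact (psize mu) / ?d * (gram mu T' T * gram mu T T')) / (?q * ?q)"
    unfolding character_product_sum[OF refl] by (simp add: avg)
  also have "\<dots> = (\<Sum>T\<in>tableaux mu. fact (psize mu) / ?d * (?q * of_nat (card (colstab mu T)))) / (?q * ?q)"
    using inner by (simp only: sum_distrib_left[symmetric] cong: sum.cong)
  also have "\<dots> = fact (psize mu) / ?d * ((\<Sum>T\<in>tableaux mu. of_nat (card (colstab mu T))) / ?q)"
    using frame_const_nonzero[of mu] unfolding sum_distrib_left[symmetric] by simp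
  also have "\<dots> = fact (psize mu)" using d specht_dim_eq[of mu] by simp
  finally show ?thesis .
qed

subsection \<open>The sum of all transpositions\<close>

definition ordered_pairs :: "nat \<Rightarrow> (nat \<times> nat) set"
  where "ordered_pairs n = {(a, b). a \<in> {1..n} \<and> b \<in> {1..n} \<and> a \<noteq> b}"

text \<open>Every transposition occurs twice in this sum.\<close>

definition transp_sum where
  "transp_sum n v = (\<Sum>(a, b)\<in>ordered_pairs n. act (transpose a b) v)"

text \<open>Twice the sum of the contents (column minus row) of the cells: the pairs in one row,
  minus the pairs in one column. The factor matches \<open>transp_sum\<close>.\<close>

definition content_sum :: "nat multiset \<Rightarrow> int"
  where "content_sum mu = (\<Sum>c\<in>diagram mu. \<Sum>d\<in>diagram mu.
    of_bool (fst c = fst d) - of_bool (snd c = snd d))"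

lemma finite_ordered_pairs [simp]: "finite (ordered_pairs n)"
  by (rule finite_subset[of _ "{1..n} \<times> {1..n}"]) (auto simp: ordered_pairs_def)

lemma comp_transpose:
  assumes "inj g" shows "g \<circ> transpose a b = transpose (g a) (g b) \<circ> g"
  using assms by (auto simp: fun_eq_iff transpose_def inj_eq)

lemma clinear_sum_act: "clinear (\<lambda>v. \<Sum>i\<in>I. act (f i) v)"
  using clinear_act by (intro clinearI) (simp_all add: clinear_iff sum.distrib cfun.scale_sum_right)

text \<open>Shared by the sum of transpositions and the class sums.\<close>

lemma equivariant_conj_invariant_sum:
  assumes f: "\<And>i. i \<in> I \<Longrightarrow> f i permutes {1..n}"
    and conj: "\<And>g (h :: _ \<Rightarrow> tabfun). g permutes {1..n} \<Longrightarrow> (\<Sum>i\<in>I. h (g \<circ> f i \<circ> inv g)) = (\<Sum>i\<in>I. h (f i))"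
  shows "equivariant n (\<lambda>v. \<Sum>i\<in>I. act (f i) v)"
  unfolding equivariant_def
proof (intro conjI allI impI clinear_sum_act)
  fix g v assume g: "g permutes {1..n}"
  have "(\<Sum>i\<in>I. act (f i) (act g v)) = (\<Sum>i\<in>I. act (g \<circ> f i \<circ> inv g) (act g v))"
    by (rule conj[OF g, of "\<lambda>w. act w (act g v)", symmetric])
  also have "\<dots> = (\<Sum>i\<in>I. act g (act (f i) v))"
    using act_comp[OF permutes_compose[OF f g] permutes_inv[OF g]] act_comp[OF g f] act_inverse(2)[OF g]
    by (intro sum.cong) auto
  also have "\<dots> = act g (\<Sum>i\<in>I. act (f i) v)"
    by (rule clinear_sum[OF clinear_act, symmetric])
  finally show "(\<Sum>i\<in>I. act (f i) (act g v)) = act g (\<Sum>i\<in>I. act (f i) v)" .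
qed

lemma equivariant_transp_sum: "equivariant n (transp_sum n)"
  unfolding transp_sum_def case_prod_unfold
proof (rule equivariant_conj_invariant_sum)
  show "transpose (fst i) (snd i) permutes {1..n}" if "i \<in> ordered_pairs n" for i
    using that by (intro transpose_permutes) (auto simp: ordered_pairs_def)
  fix g and h :: "_ \<Rightarrow> tabfun" assume g: "g permutes {1..n}"
  have conj: "g \<circ> transpose a b \<circ> inv g = transpose (g a) (g b)" for a b
    using comp_transpose[OF permutes_inj[OF g]] permutes_inv_o(1)[OF g] by (simp add: comp_assoc)
  have pairs: "(u a, u b) \<in> ordered_pairs n" if "(a, b) \<in> ordered_pairs n" "u permutes {1..n}" for u a b
    using that permutes_in_image[OF that(2)] permutes_inj[OF that(2)]
    by (auto simp: ordered_pairs_def inj_eq simp del: atLeastAtMost_iff)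
  show "(\<Sum>i\<in>ordered_pairs n. h (g \<circ> transpose (fst i) (snd i) \<circ> inv g))
      = (\<Sum>i\<in>ordered_pairs n. h (transpose (fst i) (snd i)))"
    unfolding conj
    by (rule sum.reindex_bij_witness[of _ "\<lambda>(a, b). (inv g a, inv g b)" "\<lambda>(a, b). (g a, g b)"])
      (use pairs g permutes_inv[OF g] permutes_inverses[OF g] in auto)
qed

text \<open>Let \<open>c\<close> be the entry in the smaller of the two columns and in the row of
  the other entry; that cell lies in the diagram. In \<open>T\<close> it shares its column with one
  of \<open>a\<close> and \<open>b\<close>, and the exchange brings exactly that one into the row of
  \<open>c\<close>.\<close>

lemma conflict_diagonal_transposition:
  assumes T: "T \<in> tableaux mu" and ab: "a \<in> entries mu" "b \<in> entries mu"
    and rows: "row_of mu T a < row_of mu T b" and cols: "col_of mu T a \<noteq> col_of mu T b"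
  shows "conflict mu T mu (transpose a b \<circ> T)"
proof -
  define i j i' j' where ij: "i = row_of mu T a" "j = col_of mu T a" "i' = row_of mu T b" "j' = col_of mu T b"
  have ca: "cell mu T a = (i, j)" and cb: "cell mu T b = (i', j')" by (simp_all add: ij)
  have D: "i < col_length mu j" "i' < col_length mu j'"
    using cell_in[OF T ab(1)] cell_in[OF T ab(2)] by (auto simp: ca cb diagram_iff)
  have rows': "i < i'" and cols': "j \<noteq> j'" using rows cols unfolding ij .
  note perm = transpose_permutes[OF ab]
  have cell: "cell mu (transpose a b \<circ> T) c = cell mu T (transpose a b c)" if "c \<in> entries mu" for c
    using cell_comp[OF perm T that] by simp
  show ?thesis
  proof (cases "j' < j")
    case True
    define c where "c = T (i, j')"
    have "(i, j') \<in> diagram mu" using D rows' by (simp add: diagram_iff)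
    then have c: "c \<in> entries mu" "cell mu T c = (i, j')"
      unfolding c_def using tableau_in[OF T] cell_tableau[OF T] by blast+
    then have "c \<noteq> a" "c \<noteq> b" using ca cb rows' True by auto
    then show ?thesis
      unfolding conflict_def using c ab ca cb cell[OF c(1)] cell[OF ab(2)]
      by (intro bexI[of _ b] bexI[of _ c]) auto
  next
    case False
    then have jj: "j < j'" using cols' by simp
    define c where "c = T (i', j)"
    have "(i', j) \<in> diagram mu"
      using D(2) col_length_antimono[of j j' mu] jj by (simp add: diagram_iff)
    then have c: "c \<in> entries mu" "cell mu T c = (i', j)"
      unfolding c_def using tableau_in[OF T] cell_tableau[OF T] by blast+
    then have "c \<noteq> a" "c \<noteq> b" using ca cb rows' jj by auto
    then show ?thesis
      unfolding conflict_def using c ab ca cb cell[OF c(1)] cell[OF ab(1)]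
      by (intro bexI[of _ a] bexI[of _ c]) auto
  qed
qed

text \<open>In a common row the exchange does not change the tabloid; in a common column it is an
  odd column permutation; otherwise it creates a conflict.\<close>

lemma polytabloid_transposition:
  assumes T: "T \<in> tableaux mu" and ab: "a \<in> entries mu" "b \<in> entries mu" "a \<noteq> b"
  shows "polytabloid mu T (tabloid mu (transpose a b \<circ> T))
    = of_int (of_bool (row_of mu T a = row_of mu T b) - of_bool (col_of mu T a = col_of mu T b))"
proof -
  let ?t = "transpose a b"
  have perm: "?t permutes entries mu" using ab by (intro transpose_permutes)
  have neq: "cell mu T a \<noteq> cell mu T b" using cell_inject[OF T] ab by blast
  consider (row) "row_of mu T a = row_of mu T b" "col_of mu T a \<noteq> col_of mu T b"
    | (col) "row_of mu T a \<noteq> row_of mu T b" "col_of mu T a = col_of mu T b"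
    | (none) "row_of mu T a \<noteq> row_of mu T b" "col_of mu T a \<noteq> col_of mu T b"
    using neq by (auto simp: prod_eq_iff)
  then show ?thesis
  proof cases
    case row
    have "tabloid mu (?t \<circ> T) = tabloid mu (id \<circ> T)"
      using row cell_comp[OF perm T] T
      by (subst tabloid_eq_iff) (auto simp: tableau_comp[OF perm T] transpose_def)
    then show ?thesis using polytabloid_at_column_perm[OF T id_in_colstab[OF T]] row by (simp add: sign_id)
  next
    case col
    then have "?t \<in> colstab mu T"
      using perm unfolding colstab_iff[OF T] by (auto simp: transpose_def)
    then show ?thesis
      using polytabloid_at_column_perm[OF T] col ab by (simp add: sign_swap_id)
  next
    case none
    have "conflict mu T mu (?t \<circ> T)"
    proof (cases "row_of mu T a < row_of mu T b")
      case True
      then show ?thesis using conflict_diagonal_transposition[OF T ab(1,2)] none by blast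
    next
      case False
      then have "row_of mu T b < row_of mu T a" using none by simp
      then have "conflict mu T mu (transpose b a \<circ> T)"
        using conflict_diagonal_transposition[OF T ab(2,1)] none by metis
      then show ?thesis by (simp add: transpose_commute)
    qed
    then show ?thesis using polytabloid_conflict[OF T tableau_comp[OF perm T]] none by simp
  qed
qed

lemma sum_ordered_pairs_cells:
  fixes f :: "nat \<times> nat \<Rightarrow> nat \<times> nat \<Rightarrow> int"
  assumes T: "T \<in> tableaux mu" and diag: "\<And>c. f c c = 0"
  shows "(\<Sum>(a, b)\<in>ordered_pairs (psize mu). f (cell mu T a) (cell mu T b))
    = (\<Sum>c\<in>diagram mu. \<Sum>d\<in>diagram mu. f c d)"
proof -
  let ?N = "entries mu"
  note bij = bij_betw_cell[OF T]
  have "(\<Sum>c\<in>diagram mu. \<Sum>d\<in>diagram mu. f c d)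
      = (\<Sum>a\<in>?N. \<Sum>b\<in>?N. f (cell mu T a) (cell mu T b))"
    using sum.reindex_bij_betw[OF bij, of "\<lambda>c. \<Sum>d\<in>diagram mu. f c d"]
      sum.reindex_bij_betw[OF bij, of "f _"] by simp
  also have "\<dots> = (\<Sum>(a, b)\<in>?N \<times> ?N. f (cell mu T a) (cell mu T b))"
    by (simp add: sum.cartesian_product)
  also have "\<dots> = (\<Sum>(a, b)\<in>ordered_pairs (psize mu). f (cell mu T a) (cell mu T b))"
    by (rule sum.mono_neutral_right) (auto simp: ordered_pairs_def diag)
  finally show ?thesis by simp
qed

text \<open>The polytabloid is the antisymmetrized tabloid \<open>v\<close> of \<open>T\<close>, and
  the central operator may be applied before antisymmetrizing. The eigenvalue is thus the sum of the
  values of the polytabloid at the tabloids obtained from \<open>T\<close> by one exchange.\<close>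

lemma transp_sum_polytabloid:
  assumes T: "T \<in> tableaux mu"
  shows "transp_sum (psize mu) (polytabloid mu T) = fun_scale (of_int (content_sum mu)) (polytabloid mu T)"
proof -
  let ?n = "psize mu"
  define v :: "tabfun" where "v t = (if t = tabloid mu T then 1 else 0)" for t
  have v: "v \<in> tabloid_space mu" using T by (auto simp: tabloid_space_def v_def)
  have eval: "alt_eval mu T (act q v) = polytabloid mu T (tabloid mu (q \<circ> T))"
    if q: "q permutes {1..?n}" for q
  proof -
    have "act q v (tabloid mu (p \<circ> T)) = (if tabloid mu (p \<circ> T) = tabloid mu (q \<circ> T) then 1 else 0)"
      if "p \<in> colstab mu T" for p
    proof -
      have pT: "p \<circ> T \<in> tableaux mu" using tableau_comp[OF colstab_permutes[OF that] T] .
      show ?thesis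
        using act_tabloid[OF q pT] tabloid_comp_eq_iff[OF q tableau_comp[OF permutes_inv[OF q] pT] T]
        by (simp add: v_def permutes_cancel[OF q])
    qed
    then show ?thesis unfolding alt_eval_def polytabloid_at_tabloid by (intro sum.cong) auto
  qed
  have "alt_eval mu T v = 1"
    using eval[OF permutes_id] polytabloid_at_column_perm[OF T id_in_colstab[OF T]] by (simp add: sign_id)
  then have "polytabloid mu T = col_antisym mu T v" using col_antisym_eq[OF T v] by simp
  then have "transp_sum ?n (polytabloid mu T) = col_antisym mu T (transp_sum ?n v)"
    using equivariant_col_antisym[OF equivariant_transp_sum] by metis
  also have "\<dots> = fun_scale (alt_eval mu T (transp_sum ?n v)) (polytabloid mu T)"
  proof (rule col_antisym_eq[OF T])
    show "transp_sum ?n v \<in> tabloid_space mu"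
      unfolding transp_sum_def using v
      by (intro cfun.subspace_sum subspace_tabloid_space)
        (auto simp: ordered_pairs_def intro!: act_in_tabloid_space transpose_permutes)
  qed
  also have "alt_eval mu T (transp_sum ?n v)
      = (\<Sum>(a, b)\<in>ordered_pairs ?n. polytabloid mu T (tabloid mu (transpose a b \<circ> T)))"
    unfolding transp_sum_def alt_eval_sum
    by (intro sum.cong) (auto simp: ordered_pairs_def intro!: eval transpose_permutes)
  also have "\<dots> = of_int (\<Sum>(a, b)\<in>ordered_pairs ?n.
      of_bool (row_of mu T a = row_of mu T b) - of_bool (col_of mu T a = col_of mu T b))"
    unfolding of_int_sum using polytabloid_transposition[OF T]
    by (intro sum.cong) (auto simp: ordered_pairs_def)
  also have "\<dots> = of_int (content_sum mu)"
    unfolding content_sum_def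
    using sum_ordered_pairs_cells[OF T, of "\<lambda>c d. of_bool (fst c = fst d) - of_bool (snd c = snd d)"] by simp
  finally show ?thesis .
qed

lemma transp_sum_specht:
  assumes "v \<in> specht mu"
  shows "transp_sum (psize mu) v = fun_scale (of_int (content_sum mu)) v"
proof (rule specht_induct[OF assms])
  have "clinear (\<lambda>v. fun_scale (of_int (content_sum mu)) v)" for v
    by (auto simp: clinear_iff fun_eq_iff algebra_simps)
  then show "cfun.subspace {v. transp_sum (psize mu) v = fun_scale (of_int (content_sum mu)) v}"
    by (intro subspace_clinear_eq equivariantD(1)[OF equivariant_transp_sum])
qed (rule transp_sum_polytabloid)

subsection \<open>Removable corners\<close>

text \<open>Lowering a part \<open>j\<close> removes the last cell of the last row of length
  \<open>j\<close>, since rows are sorted; \<open>col_length mu (j - 1)\<close> counts the rows of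
  length at least \<open>j\<close>.\<close>

definition corner :: "nat multiset \<Rightarrow> nat \<Rightarrow> nat \<times> nat"
  where "corner mu j = (col_length mu (j - 1) - 1, j - 1)"

lemma
  assumes "j \<in># mu" "j > 0"
  shows col_length_lower: "col_length (lower j mu) k = col_length mu k - of_bool (k = j - 1)"
    and sum_lower: "psize (lower j mu) + 1 = psize mu"
    and zero_notin_lower: "0 \<notin># mu \<Longrightarrow> 0 \<notin># lower j mu"
    and col_length_corner: "col_length mu j < col_length mu (j - 1)"
proof -
  obtain M where M: "mu = add_mset j M" using assms(1) by (metis insert_DiffM)
  show "col_length (lower j mu) k = col_length mu k - of_bool (k = j - 1)"
    using assms(2) by (auto simp: M lower_part_def col_length_add_mset)
  show "psize (lower j mu) + 1 = psize mu" "0 \<notin># mu \<Longrightarrow> 0 \<notin># lower j mu"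
    using assms(2) by (auto simp: M lower_part_def)
  have "col_length mu (j - 1) = col_length mu (Suc (j - 1)) + count mu (Suc (j - 1))"
    by (rule count_eq_col_length_diff(2))
  then show "col_length mu j < col_length mu (j - 1)"
    using assms by simp
qed

lemma
  assumes "j \<in># mu" "j > 0"
  shows diagram_lower: "diagram mu = insert (corner mu j) (diagram (lower j mu))"
    and corner_notin: "corner mu j \<notin> diagram (lower j mu)"
proof -
  note l = col_length_lower[OF assms] col_length_corner[OF assms]
  have "(i, k) \<in> diagram mu \<longleftrightarrow> (i, k) = corner mu j \<or> (i, k) \<in> diagram (lower j mu)" for i k
    using l by (auto simp: diagram_iff corner_def)
  then show "diagram mu = insert (corner mu j) (diagram (lower j mu))" by auto
  show "corner mu j \<notin> diagram (lower j mu)"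
    using l by (simp add: diagram_iff corner_def)
qed

text \<open>Column \<open>j - 1\<close> minus row \<open>col_length mu (j - 1) - 1\<close>: this
  identifies \<open>part_content mu j\<close> as the content of the corner.\<close>

lemma part_content_eq: "j > 0 \<Longrightarrow> part_content mu j = int j - int (col_length mu (j - 1))"
proof -
  assume "j > 0"
  then have "size (filter_mset (\<lambda>k. j - 1 < k) mu) = (\<Sum>k\<in>set_mset (filter_mset (\<lambda>k. j - 1 < k) mu). count (filter_mset (\<lambda>k. j - 1 < k) mu) k)"
    by (simp add: size_multiset_overloaded_eq)
  also have "\<dots> = (\<Sum>k | k \<in># mu \<and> j \<le> k. count mu k)"
    using \<open>j > 0\<close> by (intro sum.cong) auto
  finally show ?thesis by (simp add: part_content_def col_length_def)
qed

text \<open>The corner ends both its row and its column, so the cells it shares them with are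
  counted by its coordinates. Each pair containing the corner occurs in two orders, hence the factor
  2.\<close>

lemma content_sum_lower:
  assumes "j \<in># mu" "j > 0"
  shows "content_sum mu = content_sum (lower j mu) + 2 * part_content mu j"
proof -
  define D where "D = diagram (lower j mu)"
  define x where "x = corner mu j"
  define f where "f c d = (of_bool (fst c = fst d) - of_bool (snd c = snd d) :: int)" for c d :: "nat \<times> nat"
  have D: "diagram mu = insert x D" "x \<notin> D" "finite D"
    unfolding D_def x_def using diagram_lower[OF assms] corner_notin[OF assms] by auto
  have sym: "f c d = f d c" "f c c = 0" for c d by (auto simp: f_def)
  note l = col_length_lower[OF assms] col_length_corner[OF assms]
  have pos: "col_length mu (j - 1) > 0" using l(2) by simp
  have row: "{d \<in> D. fst d = fst x} = (\<lambda>k. (fst x, k)) ` {..<j - 1}"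
  proof -
    have "col_length mu (j - 1) - 1 < col_length mu k - of_bool (k = j - 1) \<longleftrightarrow> k < j - 1" for k
    proof -
      consider "k < j - 1" | "k = j - 1" | "j \<le> k" using assms(2) by linarith
      then show ?thesis
        using pos l(2) col_length_antimono[of k "j - 1" mu] col_length_antimono[of j k mu] by cases auto
    qed
    then have "(fst x, k) \<in> D \<longleftrightarrow> k < j - 1" for k
      by (simp only: D_def x_def corner_def diagram_iff l(1) fst_conv)
    then show ?thesis by force
  qed
  have col: "{d \<in> D. snd d = snd x} = (\<lambda>i. (i, snd x)) ` {..<col_length mu (j - 1) - 1}"
  proof -
    have "(i, snd x) \<in> D \<longleftrightarrow> i < col_length mu (j - 1) - 1" for i
      by (simp only: D_def x_def corner_def diagram_iff l(1) snd_conv of_bool_eq simp_thms)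
    then show ?thesis by force
  qed
  have "(\<Sum>d\<in>D. f x d) = (\<Sum>d\<in>D. of_bool (fst d = fst x)) - (\<Sum>d\<in>D. of_bool (snd d = snd x))"
    by (simp add: f_def sum_subtractf eq_commute)
  also have "\<dots> = int (card {d \<in> D. fst d = fst x}) - int (card {d \<in> D. snd d = snd x})"
    using D(3) by (simp add: of_bool_def sum.If_cases Int_def)
  also have "\<dots> = int (j - 1) - int (col_length mu (j - 1) - 1)"
    unfolding row col by (simp add: card_image inj_on_def)
  also have "\<dots> = part_content mu j"
    using assms(2) pos by (simp add: part_content_eq of_nat_diff)
  finally have fx: "(\<Sum>d\<in>D. f x d) = part_content mu j" .
  have "content_sum mu = (\<Sum>c\<in>insert x D. \<Sum>d\<in>insert x D. f c d)"
    by (simp add: content_sum_def D f_def)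
  also have "\<dots> = (\<Sum>c\<in>D. \<Sum>d\<in>D. f c d) + 2 * (\<Sum>d\<in>D. f x d)"
    using D(2,3) sym by (simp add: sum.distrib)
  finally show ?thesis using fx by (simp add: content_sum_def D_def f_def)
qed

subsection \<open>Branching\<close>

lemma parts_pos: "0 \<notin># mu \<Longrightarrow> j \<in># mu \<Longrightarrow> j > (0 :: nat)"
  by (metis gr0I)

context
  fixes mu :: "nat multiset" and j :: nat
  assumes j: "j \<in># mu" "j > 0"
begin

lemma entries_lower: "entries mu = insert (psize mu) (entries (lower j mu))"
  using sum_lower[OF j] by auto

abbreviation "extend U \<equiv> U(corner mu j := psize mu)"

lemma extend_tableau:
  assumes U: "U \<in> tableaux (lower j mu)"
  shows "extend U \<in> tableaux mu"
proof -
  let ?V = "extend U" and ?D = "diagram (lower j mu)"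
  have "bij_betw ?V ?D (entries (lower j mu))"
    using tableauxD(1)[OF U] corner_notin[OF j]
    by (subst bij_betw_cong[of _ _ U]) auto
  then have "bij_betw ?V (?D \<union> {corner mu j}) (entries (lower j mu) \<union> {?V (corner mu j)})"
    using corner_notin[OF j] sum_lower[OF j] by (subst notIn_Un_bij_betw3[symmetric]) auto
  then have "bij_betw ?V (diagram mu) (entries mu)"
    unfolding entries_lower diagram_lower[OF j] by simp
  moreover have "?V c = 0" if "c \<notin> diagram mu" for c
    using that tableauxD(2)[OF U, of c] unfolding diagram_lower[OF j] by auto
  ultimately show ?thesis unfolding tableaux_def by blast
qed

lemma cell_extend_tableau:
  assumes U: "U \<in> tableaux (lower j mu)"
  shows "a \<in> entries (lower j mu) \<Longrightarrow>
      cell mu (extend U) a = cell (lower j mu) U a"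
    and "cell mu (extend U) (psize mu) = corner mu j"
proof -
  let ?V = "extend U"
  note V = extend_tableau[OF U]
  show "cell mu ?V (psize mu) = corner mu j"
    using cell_tableau[OF V, of "corner mu j"] diagram_lower[OF j] by simp
  assume a: "a \<in> entries (lower j mu)"
  let ?c = "cell (lower j mu) U a"
  have "?c \<noteq> corner mu j" "?c \<in> diagram mu"
    using cell_in[OF U a] corner_notin[OF j] diagram_lower[OF j] by auto
  then show "cell mu ?V a = ?c"
    using cell_tableau[OF V, of ?c] tableau_cell[OF U a] by simp
qed

lemma restrict_tableau:
  assumes T: "T \<in> tableaux mu" "T (corner mu j) = psize mu"
  shows "T(corner mu j := 0) \<in> tableaux (lower j mu)"
proof -
  let ?V = "T(corner mu j := 0)" and ?D = "diagram (lower j mu)"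
  have "bij_betw T (?D \<union> {corner mu j}) (entries (lower j mu) \<union> {T (corner mu j)})"
    using tableauxD(1)[OF T(1)] T(2) unfolding entries_lower diagram_lower[OF j] by simp
  then have "bij_betw T ?D (entries (lower j mu))"
    using corner_notin[OF j] sum_lower[OF j] T(2) by (subst notIn_Un_bij_betw3) auto
  then have "bij_betw ?V ?D (entries (lower j mu))"
    using corner_notin[OF j] by (subst bij_betw_cong[of _ _ T]) auto
  moreover have "?V c = 0" if "c \<notin> ?D" for c
    using that tableauxD(2)[OF T(1), of c] unfolding diagram_lower[OF j] by auto
  ultimately show ?thesis unfolding tableaux_def by blast
qed

lemma tabloid_extend_eq_iff:
  assumes U: "U \<in> tableaux (lower j mu)" and V: "V \<in> tableaux (lower j mu)"
  shows "tabloid mu (extend U) = tabloid mu (extend V)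
    \<longleftrightarrow> tabloid (lower j mu) U = tabloid (lower j mu) V"
  unfolding tabloid_eq_iff[OF extend_tableau[OF U] extend_tableau[OF V]] tabloid_eq_iff[OF U V] entries_lower
  using cell_extend_tableau[OF U] cell_extend_tableau[OF V] by simp

text \<open>James's branching map: it deletes the largest entry from the tabloids that have it in
  the row of the corner and sends all other tabloids to zero. By
  \<open>tabloid_extend_eq_iff\<close> the choice of \<open>U\<close> does not matter.\<close>

definition restrict_op :: "tabfun \<Rightarrow> tabfun"
  where "restrict_op v t =
    (if t \<in> tabloid (lower j mu) ` tableaux (lower j mu)
     then v (tabloid mu ((SOME U. U \<in> tableaux (lower j mu) \<and> tabloid (lower j mu) U = t)
       (corner mu j := psize mu)))
     else 0)"

lemma restrict_op_tabloid:
  assumes U: "U \<in> tableaux (lower j mu)"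
  shows "restrict_op v (tabloid (lower j mu) U) = v (tabloid mu (extend U))"
proof -
  define V where "V = (SOME V. V \<in> tableaux (lower j mu) \<and> tabloid (lower j mu) V = tabloid (lower j mu) U)"
  have V: "V \<in> tableaux (lower j mu)" "tabloid (lower j mu) V = tabloid (lower j mu) U"
    unfolding V_def using someI[of "\<lambda>V. V \<in> tableaux (lower j mu) \<and> tabloid (lower j mu) V = tabloid (lower j mu) U" U] U
    by auto
  then show ?thesis
    unfolding restrict_op_def V_def[symmetric] using tabloid_extend_eq_iff[OF V(1) U] U by auto
qed

lemma clinear_restrict_op: "clinear restrict_op"
  by (intro clinearI) (auto simp: restrict_op_def fun_eq_iff)

lemma restrict_op_in_tabloid_space: "restrict_op v \<in> tabloid_space (lower j mu)"
  by (simp add: tabloid_space_def restrict_op_def)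

lemma restrict_op_act:
  assumes w: "w permutes entries (lower j mu)"
  shows "restrict_op (act w v) = act w (restrict_op v)"
proof (rule tabloid_space_eqI)
  show "restrict_op (act w v) \<in> tabloid_space (lower j mu)"
    "act w (restrict_op v) \<in> tabloid_space (lower j mu)"
    using restrict_op_in_tabloid_space act_in_tabloid_space[OF w] by blast+
  fix U assume U: "U \<in> tableaux (lower j mu)"
  have w': "w permutes entries mu" using sum_lower[OF j] by (intro permutes_subset[OF w]) auto
  have "inv w (psize mu) = psize mu"
    using permutes_not_in[OF permutes_inv[OF w], of "psize mu"] sum_lower[OF j] by auto
  then have "inv w \<circ> (extend U) = extend (inv w \<circ> U)"
    by (auto simp: fun_eq_iff)
  then show "restrict_op (act w v) (tabloid (lower j mu) U)
      = act w (restrict_op v) (tabloid (lower j mu) U)"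
    using restrict_op_tabloid[OF U] act_tabloid[OF w' extend_tableau[OF U]]
      act_tabloid[OF w U] restrict_op_tabloid[OF tableau_comp[OF permutes_inv[OF w] U]] by simp
qed

text \<open>\<open>inv p (psize mu)\<close> is the entry of \<open>T\<close> in the cell where
  \<open>p \<circ> T\<close> has the largest entry.\<close>

lemma colstab_extend_position:
  assumes T: "T \<in> tableaux mu" and U: "U \<in> tableaux (lower j mu)"
    and p: "p \<in> colstab mu T" and eq: "tabloid mu (p \<circ> T) = tabloid mu (extend U)"
  shows "inv p (psize mu) \<in> entries mu" "row_of mu T (inv p (psize mu)) = fst (corner mu j)"
    "col_of mu T (inv p (psize mu)) = col_of mu T (psize mu)"
proof -
  have pp: "p permutes entries mu" by (rule colstab_permutes[OF p])
  have n: "psize mu \<in> entries mu" using sum_lower[OF j] by auto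
  show "inv p (psize mu) \<in> entries mu" using n permutes_in_image[OF permutes_inv[OF pp]] by blast
  show "row_of mu T (inv p (psize mu)) = fst (corner mu j)"
    using eq n tabloid_eq_iff[OF tableau_comp[OF pp T] extend_tableau[OF U]] cell_comp[OF pp T n]
      cell_extend_tableau(2)[OF U] by metis
  show "col_of mu T (inv p (psize mu)) = col_of mu T (psize mu)"
    using inv_in_colstab[OF T p] n unfolding colstab_iff[OF T] by blast
qed

text \<open>A column permutation contributes only if it leaves the largest entry in the row of the
  corner. Being confined to the column of the corner, that entry is then fixed, and the column
  permutations fixing it are those of the smaller tableau.\<close>

lemma restrict_op_polytabloid:
  assumes T: "T \<in> tableaux mu" and n: "T (corner mu j) = psize mu"
  shows "restrict_op (polytabloid mu T) = polytabloid (lower j mu) (T(corner mu j := 0))"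
proof (rule tabloid_space_eqI[OF restrict_op_in_tabloid_space])
  let ?nu = "lower j mu" and ?n = "psize mu" and ?m = "psize (lower j mu)"
  define S where "S = T(corner mu j := 0)"
  have S: "S \<in> tableaux ?nu" unfolding S_def by (rule restrict_tableau[OF T n])
  have TS: "T = extend S" using n by (auto simp: S_def)
  have nm: "?m + 1 = ?n" by (rule sum_lower[OF j])
  note N = entries_lower
  show "polytabloid ?nu (T(corner mu j := 0)) \<in> tabloid_space ?nu"
    using polytabloid_in_tabloid_space[OF S] unfolding S_def .
  fix U assume U: "U \<in> tableaux ?nu"
  let ?U = "extend U"
  note cS = cell_extend_tableau[OF S, folded TS]
  have fixn: "p ?n = ?n" if p: "p \<in> colstab mu T" and eq: "tabloid mu (p \<circ> T) = tabloid mu ?U" for p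
  proof -
    note pos = colstab_extend_position[OF T U p eq]
    have "cell mu T (inv p ?n) = cell mu T ?n" using pos(2,3) cS(2) by (simp add: prod_eq_iff)
    then have "inv p ?n = ?n" using cell_inject[OF T pos(1)] nm by auto
    then show ?thesis using permutes_inverses(1)[OF colstab_permutes[OF p]] by metis
  qed
  have stab: "p \<in> colstab ?nu S \<longleftrightarrow> p \<in> colstab mu T \<and> p ?n = ?n" for p
  proof
    assume p: "p \<in> colstab ?nu S"
    then have pp: "p permutes {1..?m}" by (rule colstab_permutes)
    then have "p permutes {1..?n}" using nm by (intro permutes_subset[OF pp]) auto
    moreover have pn: "p ?n = ?n" using permutes_not_in[OF pp, of ?n] nm by auto
    moreover have "col_of mu T (p a) = col_of mu T a" if "a \<in> {1..?m}" for a
    proof -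
      have "p a \<in> {1..?m}" using that permutes_in_image[OF pp] by blast
      then show ?thesis using cS(1) that p unfolding colstab_iff[OF S] by metis
    qed
    ultimately show "p \<in> colstab mu T \<and> p ?n = ?n"
      unfolding colstab_iff[OF T] N by simp
  next
    assume p: "p \<in> colstab mu T \<and> p ?n = ?n"
    then have pp: "p permutes {1..?n}" using colstab_permutes by blast
    have pm: "p permutes {1..?m}"
    proof (rule permutes_superset[OF pp])
      fix a assume "a \<in> {1..?n} - {1..?m}"
      then have "a = ?n" using nm by auto
      then show "p a = a" using p by simp
    qed
    have "col_of ?nu S (p a) = col_of ?nu S a" if a: "a \<in> {1..?m}" for a
    proof -
      have "p a \<in> {1..?m}" using that permutes_in_image[OF pm] by blast
      moreover have "col_of mu T (p a) = col_of mu T a"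
        using p a unfolding colstab_iff[OF T] N by blast
      ultimately show ?thesis using cS(1) a by metis
    qed
    then show "p \<in> colstab ?nu S" using pm unfolding colstab_iff[OF S] by blast
  qed
  have eq: "tabloid mu (p \<circ> T) = tabloid mu ?U \<longleftrightarrow> tabloid ?nu (p \<circ> S) = tabloid ?nu U"
    if p: "p \<in> colstab ?nu S" for p
  proof -
    have "p \<circ> T = extend (p \<circ> S)" using p stab by (auto simp: TS fun_eq_iff)
    then show ?thesis
      using tabloid_extend_eq_iff[OF tableau_comp[OF colstab_permutes[OF p] S] U] by simp
  qed
  have "polytabloid mu T (tabloid mu ?U)
      = (\<Sum>p\<in>colstab ?nu S. of_int (sign p) * (if tabloid mu (p \<circ> T) = tabloid mu ?U then 1 else 0))"
    unfolding polytabloid_at_tabloid using stab fixn by (intro sum.mono_neutral_right) auto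
  also have "\<dots> = polytabloid ?nu S (tabloid ?nu U)"
    unfolding polytabloid_at_tabloid using eq by (intro sum.cong) auto
  finally show "restrict_op (polytabloid mu T) (tabloid ?nu U) = polytabloid ?nu (T(corner mu j := 0)) (tabloid ?nu U)"
    using restrict_op_tabloid[OF U] S_def by simp
qed

text \<open>The largest entry sits in column \<open>k - 1\<close>, which is too short to reach the
  row of the corner of \<open>j\<close>, so no column permutation brings it there.\<close>

lemma restrict_op_polytabloid_higher:
  assumes T: "T \<in> tableaux mu" and k: "k \<in># mu" "j < k" and n: "T (corner mu k) = psize mu"
  shows "restrict_op (polytabloid mu T) = 0"
proof (rule tabloid_space_eqI[OF restrict_op_in_tabloid_space])
  let ?n = "psize mu"
  show "0 \<in> tabloid_space (lower j mu)" by (rule cfun.subspace_0[OF subspace_tabloid_space])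
  fix U assume U: "U \<in> tableaux (lower j mu)"
  let ?U = "extend U"
  have kD: "corner mu k \<in> diagram mu"
    using diagram_lower[OF k(1)] k(2) by auto
  have "tabloid mu (p \<circ> T) \<noteq> tabloid mu ?U" if p: "p \<in> colstab mu T" for p
  proof
    assume eq: "tabloid mu (p \<circ> T) = tabloid mu ?U"
    note pos = colstab_extend_position[OF T U p eq]
    have "col_of mu T (inv p ?n) = k - 1" using pos(3) cell_tableau[OF T kD] n by (simp add: corner_def)
    then have "row_of mu T (inv p ?n) < col_length mu (k - 1)"
      using cell_in[OF T pos(1)] diagram_iff by (metis prod.collapse)
    moreover have "col_length mu (k - 1) \<le> col_length mu j"
      using k(2) by (intro col_length_antimono) auto
    ultimately show False using pos(2) col_length_corner[OF j] by (simp add: corner_def)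
  qed
  then show "restrict_op (polytabloid mu T) (tabloid (lower j mu) U) = 0 (tabloid (lower j mu) U)"
    unfolding restrict_op_tabloid[OF U] polytabloid_at_tabloid by simp
qed

end

section \<open>The filtration by the corner holding the largest entry\<close>

definition corner_tableaux :: "nat multiset \<Rightarrow> nat \<Rightarrow> (nat \<times> nat \<Rightarrow> nat) set"
  where "corner_tableaux mu x = {T \<in> tableaux mu. \<exists>j. j \<in># mu \<and> x < j \<and> T (corner mu j) = psize mu}"

text \<open>A decreasing filtration indexed by all \<open>x\<close>, not only by parts, so that
  plain induction applies; it can drop only from \<open>x\<close> to \<open>Suc x\<close> with
  \<open>Suc x\<close> a part. That its first member is the whole Specht module is known only after
  the dimension count.\<close>

definition branch_space :: "nat multiset \<Rightarrow> nat \<Rightarrow> tabfun set"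
  where "branch_space mu x = cfun.span (polytabloid mu ` corner_tableaux mu x)"

lemma branch_space_span:
  "finite (polytabloid mu ` corner_tableaux mu x)"
  "cfun.span (polytabloid mu ` corner_tableaux mu x) = branch_space mu x"
  by (auto simp: corner_tableaux_def branch_space_def)

lemma subspace_branch_space: "cfun.subspace (branch_space mu x)"
  by (simp add: branch_space_def)

lemma branch_space_antimono: "x \<le> y \<Longrightarrow> branch_space mu y \<subseteq> branch_space mu x"
  unfolding branch_space_def by (intro cfun.span_mono image_mono) (auto simp: corner_tableaux_def)

lemma branch_space_subset_specht: "branch_space mu x \<subseteq> specht mu"
  unfolding branch_space_def specht_module_def by (intro cfun.span_mono image_mono) (auto simp: corner_tableaux_def)

lemma branch_space_eq_Suc:
  assumes "Suc x \<notin># mu" shows "branch_space mu x = branch_space mu (Suc x)"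
proof -
  have "j \<in># mu \<Longrightarrow> x < j \<longleftrightarrow> Suc x < j" for j using assms by (cases "j = Suc x") auto
  then have "corner_tableaux mu x = corner_tableaux mu (Suc x)" by (auto simp: corner_tableaux_def)
  then show ?thesis by (simp add: branch_space_def)
qed

lemma branch_space_top: "branch_space mu (psize mu) = {0}"
proof -
  have "corner_tableaux mu (psize mu) = {}" using part_le_sum by (fastforce simp: corner_tableaux_def)
  then show ?thesis by (simp add: branch_space_def)
qed

lemma restrict_op_branch_space_Suc:
  assumes j: "Suc x \<in># mu" and v: "v \<in> branch_space mu (Suc x)"
  shows "restrict_op mu (Suc x) v = 0"
proof -
  have "branch_space mu (Suc x) \<subseteq> {v. restrict_op mu (Suc x) v \<in> {0}}"
    unfolding branch_space_def
  proof (rule cfun.span_minimal)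
    show "cfun.subspace {v. restrict_op mu (Suc x) v \<in> {0}}"
      using j by (intro subspace_clinear_vimage clinear_restrict_op) auto
    show "polytabloid mu ` corner_tableaux mu (Suc x) \<subseteq> {v. restrict_op mu (Suc x) v \<in> {0}}"
      using restrict_op_polytabloid_higher[OF j] by (auto simp: corner_tableaux_def)
  qed
  then show ?thesis using v by blast
qed

text \<open>Surjectivity holds because every tableau of the smaller shape extends by the corner; the
  polytabloids of the higher corners are killed.\<close>

lemma restrict_op_image_branch_space:
  assumes j: "Suc x \<in># mu"
  shows "restrict_op mu (Suc x) ` branch_space mu x = specht (lower (Suc x) mu)"
proof -
  let ?j = "Suc x" let ?nu = "lower ?j mu" and ?f = "restrict_op mu ?j"
  have j0: "?j > 0" by simp
  have lin: "clinear ?f" using clinear_restrict_op[OF j j0] .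
  interpret f: Vector_Spaces.linear fun_scale fun_scale ?f by (rule lin)
  have img: "?f ` branch_space mu x = cfun.span (?f ` polytabloid mu ` corner_tableaux mu x)"
    unfolding branch_space_def by (rule f.span_image[symmetric])
  have "?f ` polytabloid mu ` corner_tableaux mu x \<subseteq> specht ?nu"
  proof clarify
    fix T assume "T \<in> corner_tableaux mu x"
    then obtain k where T: "T \<in> tableaux mu" and k: "k \<in># mu" "x < k" "T (corner mu k) = psize mu"
      by (auto simp: corner_tableaux_def)
    show "?f (polytabloid mu T) \<in> specht ?nu"
    proof (cases "k = ?j")
      case True
      then show ?thesis
        using restrict_op_polytabloid[OF j j0 T] restrict_tableau[OF j j0 T] k(3) polytabloid_in_specht by simp
    next
      case False
      then have "?f (polytabloid mu T) = 0" using restrict_op_polytabloid_higher[OF j j0 T k(1) _ k(3)] k(2) by simp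
      then show ?thesis using cfun.subspace_0[OF subspace_specht] by simp
    qed
  qed
  then have le: "cfun.span (?f ` polytabloid mu ` corner_tableaux mu x) \<subseteq> specht ?nu"
    by (intro cfun.span_minimal subspace_specht)
  have "polytabloid ?nu ` tableaux ?nu \<subseteq> ?f ` polytabloid mu ` corner_tableaux mu x"
  proof clarify
    fix U assume U: "U \<in> tableaux ?nu"
    let ?T = "U(corner mu ?j := psize mu)"
    have T: "?T \<in> tableaux mu" "?T (corner mu ?j) = psize mu" using extend_tableau[OF j j0 U] by auto
    have "U (corner mu ?j) = 0" using tableauxD(2)[OF U corner_notin[OF j j0]] .
    then have "?T(corner mu ?j := 0) = U" by (auto simp: fun_eq_iff)
    then have "?f (polytabloid mu ?T) = polytabloid ?nu U"
      using restrict_op_polytabloid[OF j j0 T] by (simp only:)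
    moreover have "?T \<in> corner_tableaux mu x"
      unfolding corner_tableaux_def mem_Collect_eq using T j by (intro conjI exI[of _ ?j]) auto
    ultimately show "polytabloid ?nu U \<in> ?f ` polytabloid mu ` corner_tableaux mu x" by (metis imageI)
  qed
  then have "specht ?nu \<subseteq> cfun.span (?f ` polytabloid mu ` corner_tableaux mu x)"
    unfolding specht_module_def by (rule cfun.span_mono)
  then show ?thesis using img le by simp
qed

text \<open>The dimension that the branching rule predicts for \<open>branch_space mu x\<close>. The
  rank argument alone yields it as a lower bound.\<close>

definition branch_dim :: "nat multiset \<Rightarrow> nat \<Rightarrow> nat"
  where "branch_dim mu x = (\<Sum>j | j \<in># mu \<and> x < j. specht_dim (lower j mu))"

lemma sum_parts_above:
  "(\<Sum>j | j \<in># mu \<and> x < j. f j)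
    = (\<Sum>j | j \<in># mu \<and> Suc x < j. f j) + (if Suc x \<in># mu then f (Suc x) else 0)"
  for f :: "nat \<Rightarrow> 'a :: comm_monoid_add"
proof (cases "Suc x \<in># mu")
  case True
  then have "{j. j \<in># mu \<and> x < j} = insert (Suc x) {j. j \<in># mu \<and> Suc x < j}" by auto
  then show ?thesis using True by (simp add: add.commute)
next
  case False
  then have "j \<in># mu \<Longrightarrow> x < j \<longleftrightarrow> Suc x < j" for j by (cases "j = Suc x") auto
  then have "{j. j \<in># mu \<and> x < j} = {j. j \<in># mu \<and> Suc x < j}" by auto
  then show ?thesis using False by simp
qed

text \<open>The restriction map is onto the smaller Specht module and kills the next member of the
  filtration; whether its kernel is larger remains open here.\<close>

lemma dim_branch_space_step:
  "cfun.dim (branch_space mu (Suc x)) + (if Suc x \<in># mu then specht_dim (lower (Suc x) mu) else 0)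
    \<le> cfun.dim (branch_space mu x)"
proof (cases "Suc x \<in># mu")
  case True
  then show ?thesis
    using dim_kernel_image_le[OF branch_space_span[of mu x] subspace_branch_space[of mu "Suc x"]
        branch_space_antimono[of x "Suc x" mu] clinear_restrict_op[OF True] restrict_op_branch_space_Suc[OF True]]
      restrict_op_image_branch_space[OF True] by simp
qed (simp add: branch_space_eq_Suc)

lemma branch_dim_le: "x \<le> psize mu \<Longrightarrow> branch_dim mu x \<le> cfun.dim (branch_space mu x)"
proof (induction x rule: inc_induct)
  case base
  have "{j. j \<in># mu \<and> psize mu < j} = {}" using part_le_sum by fastforce
  then have "branch_dim mu (psize mu) = 0" unfolding branch_dim_def by (metis sum.empty)
  then show ?case by simp
next
  case (step x)
  have "branch_dim mu x = branch_dim mu (Suc x) + (if Suc x \<in># mu then specht_dim (lower (Suc x) mu) else 0)"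
    unfolding branch_dim_def by (rule sum_parts_above)
  then show ?case using step.IH dim_branch_space_step[of mu x] by linarith
qed

lemma branch_dim_0: "0 \<notin># mu \<Longrightarrow> branch_dim mu 0 = (\<Sum>j\<in>set_mset mu. specht_dim (lower j mu))"
  unfolding branch_dim_def by (intro sum.cong) (auto intro: parts_pos)

lemma dim_subspace_le:
  assumes "finite S" "cfun.span S = V" "cfun.subspace W" "W \<subseteq> V"
  shows "cfun.dim W \<le> cfun.dim V"
    and "cfun.dim V \<le> cfun.dim W \<Longrightarrow> W = V"
proof -
  obtain A B where B: "finite B" "A \<subseteq> B" "cfun.span A = W" "cfun.span B = V"
    "cfun.dim W = card A" "cfun.dim V = card B"
    using adapted_basis_exists[OF assms] by metis
  then show "cfun.dim W \<le> cfun.dim V" by (simp add: card_mono)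
  show "W = V" if "cfun.dim V \<le> cfun.dim W" using B that by (metis card_seteq)
qed

lemma specht_dim_ge:
  assumes "0 \<notin># mu"
  shows "(\<Sum>j\<in>set_mset mu. specht_dim (lower j mu)) \<le> specht_dim mu"
  using branch_dim_le[of 0 mu] branch_dim_0[OF assms]
    dim_subspace_le(1)[OF specht_span subspace_branch_space branch_space_subset_specht, of mu 0] by simp

subsection \<open>The trace of powers of the sum of star transpositions\<close>

text \<open>The last Jucys-Murphy element, acting on functions.\<close>

definition star_sum where
  "star_sum n v = (\<Sum>a\<in>{1..<n}. act (transpose a n) v)"

lemma clinear_star_sum: "clinear (star_sum n)"
  unfolding star_sum_def by (rule clinear_sum_act)

lemma transp_sum_Suc: "transp_sum (Suc m) v = transp_sum m v + fun_scale 2 (star_sum (Suc m) v)"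
proof -
  let ?f = "\<lambda>(a, b). act (transpose a b) v"
  let ?A = "(\<lambda>a. (a, Suc m)) ` {1..<Suc m}" and ?B = "(\<lambda>a. (Suc m, a)) ` {1..<Suc m}"
  have eq: "ordered_pairs (Suc m) = ordered_pairs m \<union> (?A \<union> ?B)"
    by (auto simp: ordered_pairs_def)
  have "transp_sum (Suc m) v = sum ?f (ordered_pairs m) + (sum ?f ?A + sum ?f ?B)"
    unfolding transp_sum_def eq
    by (subst sum.union_disjoint, simp, simp, force simp: ordered_pairs_def)
      (subst sum.union_disjoint, auto)
  moreover have "sum ?f ?A = star_sum (Suc m) v"
    unfolding star_sum_def by (subst sum.reindex) (auto simp: inj_on_def)
  moreover have "sum ?f ?B = star_sum (Suc m) v"
    unfolding star_sum_def by (subst sum.reindex) (auto simp: inj_on_def transpose_commute)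
  ultimately show ?thesis by (simp add: transp_sum_def fun_eq_iff)
qed

text \<open>The sum of all transpositions is a scalar on the Specht module, so there the star sum
  depends only on the transpositions of \<open>{1..m}\<close>. Hence it preserves every subspace
  that the permutations of \<open>{1..m}\<close> preserve.\<close>

lemma star_sum_specht:
  assumes "v \<in> specht mu" "psize mu = Suc m"
  shows "star_sum (Suc m) v = fun_scale (1/2) (fun_scale (of_int (content_sum mu)) v - transp_sum m v)"
proof
  fix t
  have "transp_sum m v t + 2 * star_sum (Suc m) v t = of_int (content_sum mu) * v t"
    using fun_cong[OF transp_sum_Suc[of m v], of t] fun_cong[OF transp_sum_specht[OF assms(1)], of t] assms(2)
    by simp
  then show "star_sum (Suc m) v t
      = fun_scale (1/2) (fun_scale (of_int (content_sum mu)) v - transp_sum m v) t"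
    by (simp add: field_simps)
qed

lemma act_branch_space:
  assumes w: "w permutes {1..m}" and n: "psize mu = Suc m" and v: "v \<in> branch_space mu x"
  shows "act w v \<in> branch_space mu x"
proof -
  have w': "w permutes entries mu" using n by (intro permutes_subset[OF w]) auto
  have wn: "w (psize mu) = psize mu" using permutes_not_in[OF w] n by auto
  have "branch_space mu x \<subseteq> {v. act w v \<in> branch_space mu x}"
    unfolding branch_space_def
  proof (rule cfun.span_minimal)
    show "cfun.subspace {v. act w v \<in> cfun.span (polytabloid mu ` corner_tableaux mu x)}"
      by (intro subspace_clinear_vimage clinear_act) auto
    have "act w (polytabloid mu T) \<in> polytabloid mu ` corner_tableaux mu x"
      if "T \<in> corner_tableaux mu x" for T
    proof -
      have "T \<in> tableaux mu" using that by (simp add: corner_tableaux_def)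
      moreover have "w \<circ> T \<in> corner_tableaux mu x"
        using that wn tableau_comp[OF w'] unfolding corner_tableaux_def by auto
      ultimately show ?thesis using act_polytabloid[OF _ w'] by (metis imageI)
    qed
    then show "polytabloid mu ` corner_tableaux mu x
        \<subseteq> {v. act w v \<in> cfun.span (polytabloid mu ` corner_tableaux mu x)}"
      by (auto intro: cfun.span_base)
  qed
  then show ?thesis using v by blast
qed

lemma transp_sum_branch_space:
  assumes "psize mu = Suc m" "v \<in> branch_space mu x"
  shows "transp_sum m v \<in> branch_space mu x"
  unfolding transp_sum_def
  by (intro cfun.subspace_sum subspace_branch_space)
    (auto simp: ordered_pairs_def intro!: act_branch_space[OF _ assms] transpose_permutes)

lemma star_sum_branch_space:
  assumes "psize mu = Suc m" "v \<in> branch_space mu x"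
  shows "star_sum (Suc m) v \<in> branch_space mu x"
  using assms transp_sum_branch_space[OF assms] branch_space_subset_specht[of mu x]
  by (subst star_sum_specht)
    (auto intro!: cfun.subspace_scale cfun.subspace_diff subspace_branch_space)

text \<open>The restriction map commutes with the permutations of \<open>{1..m}\<close> and lands in
  a Specht module, where their transposition sum is a scalar too. Half the difference of the two
  content sums is the content of the corner.\<close>

lemma restrict_op_star_sum:
  assumes j: "Suc x \<in># mu" and n: "psize mu = Suc m" and v: "v \<in> branch_space mu x"
  shows "restrict_op mu (Suc x) (star_sum (Suc m) v)
    = fun_scale (of_int (part_content mu (Suc x))) (restrict_op mu (Suc x) v)"
proof -
  let ?f = "restrict_op mu (Suc x)" and ?nu = "lower (Suc x) mu"
  have j0: "Suc x > 0" by simp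
  have m: "psize ?nu = m" using sum_lower[OF j j0] n by simp
  have lin: "clinear ?f" by (rule clinear_restrict_op[OF j j0])
  interpret f: Vector_Spaces.linear fun_scale fun_scale ?f by (rule lin)
  have fv: "?f v \<in> specht ?nu" using restrict_op_image_branch_space[OF j] v by blast
  have "?f (transp_sum m v) = transp_sum m (?f v)"
    unfolding transp_sum_def clinear_sum[OF lin]
  proof (rule sum.cong[OF refl], clarify)
    fix a b assume "(a, b) \<in> ordered_pairs m"
    then have "transpose a b permutes entries ?nu"
      unfolding m by (intro transpose_permutes) (auto simp: ordered_pairs_def)
    then show "?f (act (transpose a b) v) = act (transpose a b) (?f v)"
      by (rule restrict_op_act[OF j j0])
  qed
  also have "\<dots> = fun_scale (of_int (content_sum ?nu)) (?f v)"
    using transp_sum_specht[OF fv] m by simp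
  finally have "?f (star_sum (Suc m) v)
      = fun_scale (1/2) (fun_scale (of_int (content_sum mu)) (?f v) - fun_scale (of_int (content_sum ?nu)) (?f v))"
    using star_sum_specht[OF _ n, of v] v branch_space_subset_specht[of mu x]
    by (simp add: f.scale f.diff subset_iff)
  then show ?thesis
    using content_sum_lower[OF j j0] by (simp add: fun_eq_iff algebra_simps)
qed

lemma clinear_funpow: "clinear F \<Longrightarrow> clinear (F ^^ r)"
  for F :: "('x \<Rightarrow> complex) \<Rightarrow> 'x \<Rightarrow> complex"
  by (induction r) (auto simp: clinear_iff)

text \<open>The assumption on dimensions makes every step of the filtration exact, and the trace is
  then collected from the zero space upwards, one corner at a time.\<close>

lemma trace_star_sum:
  assumes mu: "0 \<notin># mu" and n: "psize mu = Suc m"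
    and dim: "specht_dim mu = (\<Sum>j\<in>set_mset mu. specht_dim (lower j mu))"
  shows "trace_on (specht mu) (star_sum (Suc m) ^^ r)
    = (\<Sum>j\<in>set_mset mu. of_nat (specht_dim (lower j mu)) * of_int (part_content mu j) ^ r)"
proof -
  let ?J = "star_sum (Suc m)"
  define h where "h j = of_nat (specht_dim (lower j mu)) * (of_int (part_content mu j) ^ r :: complex)" for j
  \<comment> \<open>The assumption closes the gap between \<open>branch_dim_le\<close> and the
    inclusion in \<open>specht mu\<close>, so the polytabloids with the largest entry in a corner
    already span.\<close>
  have top: "branch_space mu 0 = specht mu" "cfun.dim (branch_space mu 0) = branch_dim mu 0"
    using dim_subspace_le[OF specht_span subspace_branch_space branch_space_subset_specht, of mu 0]
      branch_dim_le[of 0 mu] branch_dim_0[OF mu] dim by auto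
  \<comment> \<open>Equality passes down the filtration: each step bounds the next dimension from
    above, and \<open>branch_dim_le\<close> bounds it from below.\<close>
  have dims: "cfun.dim (branch_space mu x) = branch_dim mu x" if "x \<le> Suc m" for x
    using that
  proof (induction x)
    case (Suc x)
    have "branch_dim mu x = branch_dim mu (Suc x) + (if Suc x \<in># mu then specht_dim (lower (Suc x) mu) else 0)"
      unfolding branch_dim_def by (rule sum_parts_above)
    moreover have "branch_dim mu (Suc x) \<le> cfun.dim (branch_space mu (Suc x))"
      using Suc.prems n by (intro branch_dim_le) simp
    moreover have "cfun.dim (branch_space mu x) = branch_dim mu x" using Suc.IH Suc.prems Suc_leD by blast
    ultimately show ?case using dim_branch_space_step[of mu x] by linarith
  qed (use top in simp)
  have pow_inv: "(?J ^^ r) v \<in> branch_space mu x" if "v \<in> branch_space mu x" for v x r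
    using that star_sum_branch_space[OF n] by (induction r) auto
  have "trace_on (branch_space mu x) (?J ^^ r) = (\<Sum>j | j \<in># mu \<and> x < j. h j)" if "x \<le> Suc m" for x
    using that
  proof (induction x rule: inc_induct)
    case base
    have "trace_on {0} (?J ^^ r) = (\<Sum>b\<in>{}. cfun.representation {} ((?J ^^ r) b) b)"
      using pow_inv[of _ "Suc m" r] branch_space_top[of mu] n
      by (intro trace_on_basis clinear_funpow clinear_star_sum) (auto simp: cfun.independent_empty)
    moreover have "{j. j \<in># mu \<and> Suc m < j} = {}" using part_le_sum n by fastforce
    moreover have "branch_space mu (Suc m) = {0}" using branch_space_top[of mu] n by simp
    ultimately show ?case by (simp only: sum.empty)
  next
    case (step x)
    show ?case
    proof (cases "Suc x \<in># mu")
      case False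
      then show ?thesis using step.IH branch_space_eq_Suc[OF False] sum_parts_above[of h mu x] by simp
    next
      case True
      let ?f = "restrict_op mu (Suc x)" and ?c = "of_int (part_content mu (Suc x)) :: complex"
      let ?W = "branch_space mu (Suc x)" and ?V = "branch_space mu x"
      note lin = clinear_restrict_op[OF True, simplified]
      interpret f: Vector_Spaces.linear fun_scale fun_scale ?f by (rule lin)
      interpret J: Vector_Spaces.linear fun_scale fun_scale ?J by (rule clinear_star_sum)
      have sub: "?W \<subseteq> ?V" by (rule branch_space_antimono) simp
      have dimV: "cfun.dim ?V = cfun.dim ?W + specht_dim (lower (Suc x) mu)"
        using dims[of x] dims[of "Suc x"] step.hyps True sum_parts_above[of _ mu x] by (simp add: branch_dim_def)
      \<comment> \<open>The difference lies in the kernel of the restriction map on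
        \<open>?V\<close>, and the exact dimensions make this kernel equal to
        \<open>?W\<close>.\<close>
      have one: "?J v - fun_scale ?c v \<in> ?W" if v: "v \<in> ?V" for v
      proof (rule kernel_subset_if_dim_le[OF branch_space_span subspace_branch_space sub lin
            restrict_op_branch_space_Suc[OF True]])
        show "cfun.dim ?V \<le> cfun.dim ?W + cfun.dim (?f ` ?V)"
          using dimV restrict_op_image_branch_space[OF True] by simp
        show "?J v - fun_scale ?c v \<in> ?V"
          using v star_sum_branch_space[OF n v]
          by (intro cfun.subspace_diff cfun.subspace_scale subspace_branch_space)
        show "?f (?J v - fun_scale ?c v) = 0"
          using restrict_op_star_sum[OF True n v] by (simp add: f.diff f.scale)
      qed
      have pow: "(?J ^^ r) v - fun_scale (?c ^ r) v \<in> ?W" if v: "v \<in> ?V" for v r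
      proof (induction r)
        case 0
        show ?case using cfun.subspace_0[OF subspace_branch_space] by (simp add: zero_fun_def)
      next
        case (Suc r)
        \<comment> \<open>The first summand stays in \<open>?W\<close> because \<open>?J\<close>
          preserves it, the second because \<open>?J\<close> is the scalar \<open>?c\<close> modulo
          \<open>?W\<close>.\<close>
        have "(?J ^^ Suc r) v - fun_scale (?c ^ Suc r) v
            = ?J ((?J ^^ r) v - fun_scale (?c ^ r) v) + fun_scale (?c ^ r) (?J v - fun_scale ?c v)"
          by (simp add: J.diff J.scale cfun.scale_right_diff_distrib mult.commute)
        then show ?case
          using star_sum_branch_space[OF n Suc.IH] one[OF v]
          by (metis cfun.subspace_add cfun.subspace_scale subspace_branch_space)
      qed
      have "trace_on ?V (?J ^^ r) = trace_on ?W (?J ^^ r)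
          + ?c ^ r * (of_nat (cfun.dim ?V) - of_nat (cfun.dim ?W))"
        by (rule trace_on_triangular[OF branch_space_span subspace_branch_space sub
              clinear_funpow[OF clinear_star_sum] pow_inv pow])
      then show ?thesis
        using step.IH dimV True sum_parts_above[of h mu x] by (simp add: h_def mult.commute)
    qed
  qed
  from this[of 0] have "trace_on (specht mu) (?J ^^ r) = (\<Sum>j | j \<in># mu \<and> 0 < j. h j)"
    using top(1) by simp
  also have "{j. j \<in># mu \<and> 0 < j} = set_mset mu" using parts_pos[OF mu] by auto
  finally show ?thesis unfolding h_def .
qed

subsection \<open>Counting standard tableaux\<close>

lemma standard_tableaux_subset: "standard_tableaux mu \<subseteq> tableaux mu"
  by (auto simp: standard_tableaux_def)

lemma finite_standard_tableaux [simp]: "finite (standard_tableaux mu)"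
  using finite_subset[OF standard_tableaux_subset] by simp

lemma standard_tableauxD:
  assumes "T \<in> standard_tableaux mu"
  shows "\<lbrakk>(i, k) \<in> diagram mu; (i, k') \<in> diagram mu; k < k'\<rbrakk> \<Longrightarrow> T (i, k) < T (i, k')"
    and "\<lbrakk>(i, k) \<in> diagram mu; (i', k) \<in> diagram mu; i < i'\<rbrakk> \<Longrightarrow> T (i, k) < T (i', k)"
  using assms unfolding standard_tableaux_def by blast+

lemma standard_tableauxI:
  assumes "T \<in> tableaux mu"
    and "\<And>i k k'. \<lbrakk>(i, k) \<in> diagram mu; (i, k') \<in> diagram mu; k < k'\<rbrakk> \<Longrightarrow> T (i, k) < T (i, k')"
    and "\<And>i i' k. \<lbrakk>(i, k) \<in> diagram mu; (i', k) \<in> diagram mu; i < i'\<rbrakk> \<Longrightarrow> T (i, k) < T (i', k)"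
  shows "T \<in> standard_tableaux mu"
  using assms unfolding standard_tableaux_def by blast

lemma corner_maximal:
  assumes j: "j \<in># mu" "j > 0" and x: "corner mu j = (i, k)"
  shows "(i, k') \<in> diagram mu \<Longrightarrow> k' \<le> k" "(i', k) \<in> diagram mu \<Longrightarrow> i' \<le> i"
proof -
  have ik: "i = col_length mu (j - 1) - 1" "k = j - 1" using x by (auto simp: corner_def)
  show "i' \<le> i" if "(i', k) \<in> diagram mu" using that ik by (simp add: diagram_iff)
  show "k' \<le> k" if "(i, k') \<in> diagram mu"
  proof (rule ccontr)
    assume "\<not> k' \<le> k"
    then have "j \<le> k'" using ik j by simp
    then have "col_length mu k' \<le> col_length mu j" by (rule col_length_antimono)
    moreover have "i < col_length mu k'" using that by (simp add: diagram_iff)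
    ultimately show False using col_length_corner[OF j] ik by simp
  qed
qed

lemma extend_standard:
  assumes j: "j \<in># mu" "j > 0" and U: "U \<in> standard_tableaux (lower j mu)"
  shows "U(corner mu j := psize mu) \<in> standard_tableaux mu"
proof -
  let ?V = "U(corner mu j := psize mu)" and ?D = "diagram (lower j mu)"
  have UT: "U \<in> tableaux (lower j mu)" using U standard_tableaux_subset by blast
  have D: "c \<in> diagram mu \<longleftrightarrow> c = corner mu j \<or> c \<in> ?D" for c
    using diagram_lower[OF j] by auto
  have less: "U c < psize mu" if "c \<in> ?D" for c
    using tableau_in[OF UT that] sum_lower[OF j] by simp
  obtain x y where xy: "corner mu j = (x, y)" by force
  note max = corner_maximal[OF j xy]
  show ?thesis
  proof (rule standard_tableauxI[OF extend_tableau[OF j UT]])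
    fix i k k' assume *: "(i, k) \<in> diagram mu" "(i, k') \<in> diagram mu" "k < k'"
    have "(i, k) \<noteq> corner mu j" using * max(1)[of k'] xy by auto
    then have "(i, k) \<in> ?D" using * D by blast
    then show "?V (i, k) < ?V (i, k')"
      using * D less standard_tableauxD(1)[OF U] \<open>(i, k) \<noteq> corner mu j\<close> by (cases "(i, k') = corner mu j") auto
  next
    fix i i' k assume *: "(i, k) \<in> diagram mu" "(i', k) \<in> diagram mu" "i < i'"
    have "(i, k) \<noteq> corner mu j" using * max(2)[of i'] xy by auto
    then have "(i, k) \<in> ?D" using * D by blast
    then show "?V (i, k) < ?V (i', k)"
      using * D less standard_tableauxD(2)[OF U] \<open>(i, k) \<noteq> corner mu j\<close> by (cases "(i', k) = corner mu j") auto
  qed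
qed

lemma restrict_standard:
  assumes j: "j \<in># mu" "j > 0" and T: "T \<in> standard_tableaux mu" "T (corner mu j) = psize mu"
  shows "T(corner mu j := 0) \<in> standard_tableaux (lower j mu)"
proof -
  have D: "c \<in> diagram mu" "c \<noteq> corner mu j" if "c \<in> diagram (lower j mu)" for c
    using that diagram_lower[OF j] corner_notin[OF j] by auto
  show ?thesis
    using T standard_tableaux_subset standard_tableauxD[OF T(1)] D
    by (intro standard_tableauxI restrict_tableau[OF j]) auto
qed

text \<open>The cell of the largest entry has no neighbour to the right or below. So its column
  \<open>k\<close> is strictly longer than the next one, and \<open>Suc k\<close> is a part.\<close>

lemma standard_tableau_max_corner:
  assumes T: "T \<in> standard_tableaux mu" and n: "psize mu > 0"
  obtains j where "j \<in># mu" "j > 0" "T (corner mu j) = psize mu"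
proof -
  let ?n = "psize mu"
  have TT: "T \<in> tableaux mu" using T standard_tableaux_subset by blast
  have n1: "?n \<in> {1..?n}" using n by auto
  obtain i k where ik: "cell mu T ?n = (i, k)" by force
  have D: "(i, k) \<in> diagram mu" "T (i, k) = ?n"
    using cell_in[OF TT n1] tableau_cell[OF TT n1] ik by auto
  have le: "T c \<le> ?n" if "c \<in> diagram mu" for c using tableau_in[OF TT that] by simp
  have "(Suc i, k) \<notin> diagram mu"
    using standard_tableauxD(2)[OF T D(1), of "Suc i"] D(2) le by fastforce
  then have 1: "col_length mu k = Suc i" using D(1) by (simp add: diagram_iff)
  have "(i, Suc k) \<notin> diagram mu"
    using standard_tableauxD(1)[OF T D(1), of "Suc k"] D(2) le by fastforce
  then have "col_length mu (Suc k) \<le> i" by (simp add: diagram_iff)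
  then have "Suc k \<in># mu" using 1 count_eq_col_length_diff(2)[of mu k]
    by (metis Suc_n_not_le_n add.right_neutral not_in_iff)
  moreover have "corner mu (Suc k) = (i, k)" using 1 by (simp add: corner_def)
  ultimately show ?thesis using that[of "Suc k"] D(2) by simp
qed

text \<open>Standard tableaux are sorted by the corner holding the largest entry; corners of
  distinct parts lie in distinct columns.\<close>

lemma num_syt_rec:
  assumes mu: "0 \<notin># mu" and n: "psize mu > 0"
  shows "num_syt mu = (\<Sum>j\<in>set_mset mu. num_syt (lower j mu))"
proof -
  let ?n = "psize mu"
  define A where "A j = {T \<in> standard_tableaux mu. T (corner mu j) = ?n}" for j
  have finA: "finite (A j)" "finite (set_mset mu)" for j by (simp_all add: A_def)
  have "standard_tableaux mu = (\<Union>j\<in>set_mset mu. A j)"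
    using standard_tableau_max_corner[OF _ n] by (force simp: A_def)
  moreover have "A j \<inter> A k = {}" if "j \<in># mu" "k \<in># mu" "j \<noteq> k" for j k
  proof (rule ccontr)
    assume "A j \<inter> A k \<noteq> {}"
    then obtain T where "T \<in> A j" "T \<in> A k" by blast
    then have T: "T \<in> tableaux mu" "T (corner mu j) = T (corner mu k)"
      using standard_tableaux_subset[of mu] by (auto simp: A_def)
    have pos: "j > 0" "k > 0" using that parts_pos[OF mu] by auto
    have "corner mu j \<in> diagram mu" "corner mu k \<in> diagram mu"
      using that pos diagram_lower by blast+
    then have "corner mu j = corner mu k" using T cell_tableau by metis
    then have "j - 1 = k - 1" by (simp add: corner_def)
    then show False using that(3) pos by linarith
  qed
  ultimately have "num_syt mu = (\<Sum>j\<in>set_mset mu. card (A j))"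
    unfolding num_syt_def using card_UN_disjoint[of "set_mset mu" A] finA by metis
  also have "\<dots> = (\<Sum>j\<in>set_mset mu. num_syt (lower j mu))"
  proof (rule sum.cong[OF refl])
    fix j assume j: "j \<in># mu"
    have j0: "j > 0" using parts_pos[OF mu j] .
    have "bij_betw (\<lambda>U. U(corner mu j := ?n)) (standard_tableaux (lower j mu)) (A j)"
    proof (rule bij_betwI[of _ _ _ "\<lambda>T. T(corner mu j := 0)"])
      fix U assume U: "U \<in> standard_tableaux (lower j mu)"
      then have "U (corner mu j) = 0"
        using tableauxD(2)[OF _ corner_notin[OF j j0]] standard_tableaux_subset by blast
      then show "(U(corner mu j := ?n))(corner mu j := 0) = U" by (auto simp: fun_eq_iff)
    qed (auto simp: A_def extend_standard[OF j j0] restrict_standard[OF j j0] fun_eq_iff)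
    then show "card (A j) = num_syt (lower j mu)"
      unfolding num_syt_def by (simp add: bij_betw_same_card)
  qed
  finally show ?thesis .
qed

lemma num_syt_empty: "num_syt {#} = 1"
proof -
  have D: "diagram {#} = {}" using card_diagram[of "{#}"] by simp
  have "standard_tableaux {#} = {\<lambda>_. 0}"
    unfolding standard_tableaux_def tableaux_def D by (auto simp: fun_eq_iff bij_betw_def)
  then show ?thesis by (simp add: num_syt_def)
qed

section \<open>Up and down moves in Young's lattice\<close>

definition raise_part :: "nat \<Rightarrow> nat multiset \<Rightarrow> nat multiset"
  where "raise_part k mu = add_mset (Suc k) (if k = 0 then mu else mu - {#k#})"

text \<open>The added \<open>0\<close> is a virtual part whose raising starts a new row. It accounts
  for the one raising by which up moves outnumber down moves.\<close>

abbreviation raisable :: "nat multiset \<Rightarrow> nat set"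
  where "raisable mu \<equiv> insert 0 (set_mset mu)"

lemma lower_raise_part:
  assumes "0 \<notin># mu" "k \<in> raisable mu"
  shows "lower (Suc k) (raise_part k mu) = mu"
  using assms by (cases "k = 0") (auto simp: lower_part_def raise_part_def)

lemma raise_lower:
  assumes "0 \<notin># mu" "j \<in># mu"
  shows "raise_part (j - 1) (lower j mu) = mu"
  using assms parts_pos[OF assms] by (cases "j = 1") (auto simp: lower_part_def raise_part_def)

lemma raise_part_partition:
  assumes "0 \<notin># mu" "k \<in> raisable mu"
  shows "0 \<notin># raise_part k mu" "psize (raise_part k mu) = Suc (psize mu)" "Suc k \<in># raise_part k mu"
proof -
  show "0 \<notin># raise_part k mu" "Suc k \<in># raise_part k mu"
    using assms by (auto simp: raise_part_def dest: in_diffD)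
  show "psize (raise_part k mu) = Suc (psize mu)"
    using assms sum_mset.remove[of k mu] by (cases "k = 0") (auto simp: raise_part_def)
qed

lemma lower_raisable:
  assumes "0 \<notin># mu" "j \<in># mu"
  shows "j - 1 \<in> raisable (lower j mu)"
  by (simp add: lower_part_def)

text \<open>Pairs of moves on independent parts. Lowering \<open>Suc k\<close> would undo the
  raising of \<open>k\<close>, and raising one \<open>k\<close> while lowering another requires two
  copies of it.\<close>

definition updown_pairs :: "nat multiset \<Rightarrow> (nat \<times> nat) set"
  where "updown_pairs mu = {(k, j). k \<in> raisable mu \<and> j \<in># mu \<and> j \<noteq> Suc k \<and> (j = k \<longrightarrow> count mu j \<ge> 2)}"

lemma in_diff_single_iff: "x \<in># M - {#y#} \<longleftrightarrow> x \<in># M \<and> (x = y \<longrightarrow> count M x \<ge> 2)"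
  by (auto simp: count_greater_zero_iff[symmetric] simp del: count_greater_zero_iff)

lemma lower_raise_commute:
  assumes mu: "0 \<notin># mu" and kj: "(k, j) \<in> updown_pairs mu"
  shows "lower j (raise_part k mu) = raise_part k (lower j mu)"
proof -
  have j: "j \<in># mu" "j > 0" "j \<noteq> Suc k" using kj parts_pos[OF mu] by (auto simp: updown_pairs_def)
  show ?thesis
  proof (cases "k = 0")
    case True
    then show ?thesis using j by (auto simp: raise_part_def lower_part_def)
  next
    case False
    then have "k \<in># mu" "j \<in># mu - {#k#}"
      using kj unfolding in_diff_single_iff by (auto simp: updown_pairs_def)
    then obtain R where "mu = add_mset k (add_mset j R)" by (metis insert_DiffM)
    then show ?thesis using False j by (auto simp: raise_part_def lower_part_def)
  qed
qed

text \<open>This and its companion below show that both orders of the two moves are indexed by the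
  same pairs once the second move that undoes the first is set aside.\<close>

lemma updown_left:
  assumes mu: "0 \<notin># mu"
  shows "(SIGMA k:raisable mu. set_mset (raise_part k mu) - {Suc k}) = updown_pairs mu"
  using mu by (auto simp: updown_pairs_def raise_part_def in_diff_single_iff split: if_splits)

lemma updown_right:
  assumes mu: "0 \<notin># mu"
  shows "prod.swap ` (SIGMA j:set_mset mu. raisable (lower j mu) - {j - 1}) = updown_pairs mu"
proof -
  have "k \<in> raisable (lower j mu) - {j - 1} \<longleftrightarrow> (k, j) \<in> updown_pairs mu" if "j \<in># mu" for k j
  proof -
    have "j > 0" using parts_pos[OF mu that] .
    then show ?thesis
      using that mu by (auto simp: updown_pairs_def lower_part_def in_diff_single_iff split: if_splits)
  qed
  then have "(k, j) \<in> prod.swap ` (SIGMA j:set_mset mu. raisable (lower j mu) - {j - 1})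
      \<longleftrightarrow> (k, j) \<in> updown_pairs mu" for k j
    unfolding pair_in_swap_image mem_Sigma_iff by (auto simp: updown_pairs_def)
  then show ?thesis by (simp only: set_eq_iff split_paired_All) blast
qed

text \<open>Independent moves commute, so the two orders differ only in their round trips back to
  \<open>mu\<close>. There are \<open>card (raisable mu)\<close> trips that begin upwards and
  \<open>card (set_mset mu)\<close> that begin downwards, one fewer.\<close>

lemma sum_num_syt_raise:
  assumes "0 \<notin># mu"
  shows "(\<Sum>k\<in>raisable mu. num_syt (raise_part k mu)) = Suc (psize mu) * num_syt mu"
  using assms
proof (induction "psize mu" arbitrary: mu rule: less_induct)
  case (less mu)
  note mu = less.prems
  let ?A = "\<lambda>k. set_mset (raise_part k mu) - {Suc k}" and ?B = "\<lambda>j. raisable (lower j mu) - {j - 1}"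
  define s where "s = (\<Sum>(k, j)\<in>updown_pairs mu. num_syt (raise_part k (lower j mu)))"
  have "(\<Sum>k\<in>raisable mu. num_syt (raise_part k mu))
      = (\<Sum>k\<in>raisable mu. num_syt mu + (\<Sum>j\<in>?A k. num_syt (lower j (raise_part k mu))))"
  proof (rule sum.cong[OF refl])
    fix k assume k: "k \<in> raisable mu"
    note r = raise_part_partition[OF mu k]
    show "num_syt (raise_part k mu)
        = num_syt mu + (\<Sum>j\<in>?A k. num_syt (lower j (raise_part k mu)))"
      using num_syt_rec[OF r(1)] r(2,3) lower_raise_part[OF mu k] by (simp add: sum.remove[of _ "Suc k"])
  qed
  also have "\<dots> = card (raisable mu) * num_syt mu
      + (\<Sum>k\<in>raisable mu. \<Sum>j\<in>?A k. num_syt (lower j (raise_part k mu)))"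
    by (simp add: sum.distrib)
  also have "(\<Sum>k\<in>raisable mu. \<Sum>j\<in>?A k. num_syt (lower j (raise_part k mu)))
      = (\<Sum>(k, j)\<in>updown_pairs mu. num_syt (lower j (raise_part k mu)))"
    unfolding updown_left[OF mu, symmetric] by (rule sum.Sigma) auto
  also have "\<dots> = s"
    unfolding s_def using lower_raise_commute[OF mu] by (intro sum.cong) auto
  finally have up: "(\<Sum>k\<in>raisable mu. num_syt (raise_part k mu)) = card (raisable mu) * num_syt mu + s" .
  \<comment> \<open>For a smaller partition \<open>psize mu\<close> is the successor of its size, so
    the induction hypothesis turns this factor into a sum over raisings.\<close>
  have "psize mu * num_syt mu = (\<Sum>j\<in>set_mset mu. psize mu * num_syt (lower j mu))"
  proof (cases "psize mu > 0")
    case True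
    show ?thesis unfolding sum_distrib_left[symmetric] num_syt_rec[OF mu True] ..
  next
    case False
    then have "psize mu = 0" by blast
    then show ?thesis by (simp only: mult_zero_left sum.neutral_const)
  qed
  also have "\<dots> = (\<Sum>j\<in>set_mset mu. num_syt mu
      + (\<Sum>k\<in>?B j. num_syt (raise_part k (lower j mu))))"
  proof (rule sum.cong[OF refl])
    fix j assume j: "j \<in># mu"
    have j0: "j > 0" using parts_pos[OF mu j] .
    let ?nu = "lower j mu"
    have "psize mu * num_syt ?nu = Suc (psize ?nu) * num_syt ?nu"
      using sum_lower[OF j j0] by (metis Suc_eq_plus1)
    also have "\<dots> = (\<Sum>k\<in>raisable ?nu. num_syt (raise_part k ?nu))"
    proof -
      have "psize ?nu < psize mu" using sum_lower[OF j j0] by linarith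
      then show ?thesis using less.hyps[of ?nu] zero_notin_lower[OF j j0 mu] by metis
    qed
    also have "\<dots> = num_syt (raise_part (j - 1) ?nu) + (\<Sum>k\<in>raisable ?nu - {j - 1}. num_syt (raise_part k ?nu))"
      using lower_raisable[OF mu j] by (intro sum.remove) auto
    finally show "psize mu * num_syt ?nu = num_syt mu + (\<Sum>k\<in>raisable ?nu - {j - 1}. num_syt (raise_part k ?nu))"
      using raise_lower[OF mu j] by simp
  qed
  also have "\<dots> = card (set_mset mu) * num_syt mu
      + (\<Sum>j\<in>set_mset mu. \<Sum>k\<in>?B j. num_syt (raise_part k (lower j mu)))"
    by (simp add: sum.distrib)
  also have "(\<Sum>j\<in>set_mset mu. \<Sum>k\<in>?B j. num_syt (raise_part k (lower j mu)))
      = (\<Sum>(j, k)\<in>(SIGMA j:set_mset mu. ?B j). num_syt (raise_part k (lower j mu)))"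
    by (rule sum.Sigma) auto
  also have "\<dots> = s"
    unfolding s_def updown_right[OF mu, symmetric]
    by (subst sum.reindex) (auto simp: case_prod_unfold inj_on_def intro!: sum.cong)
  finally have down: "psize mu * num_syt mu = card (set_mset mu) * num_syt mu + s" .
  have "card (raisable mu) = Suc (card (set_mset mu))" using mu by simp
  then show ?case using up down by simp
qed

section \<open>Sums of squares over the partitions of \<open>n\<close>\<close>

abbreviation partitions :: "nat \<Rightarrow> nat multiset set"
  where "partitions n \<equiv> {mu. mu partition_of n}"

lemma finite_partitions [simp]: "finite (partitions n)"
proof (rule finite_subset)
  show "partitions n \<subseteq> mset ` {xs. set xs \<subseteq> {0..n} \<and> length xs \<le> n}"
  proof
    fix mu assume "mu \<in> partitions n"
    then have mu: "0 \<notin># mu" "psize mu = n" by (auto simp: is_partition_def)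
    have "size mu \<le> psize mu" using mu(1) by (induction mu) auto
    moreover have "set_mset mu \<subseteq> {0..n}" using part_le_sum mu(2) by auto
    moreover obtain xs where "mset xs = mu" using ex_mset by blast
    ultimately show "mu \<in> mset ` {xs. set xs \<subseteq> {0..n} \<and> length xs \<le> n}"
      using mu(2) by (intro image_eqI[of _ _ xs]) auto
  qed
  show "finite (mset ` {xs. set xs \<subseteq> {0..n} \<and> length xs \<le> n})"
    by (intro finite_imageI finite_lists_length_le) simp
qed

text \<open>A sum over the edges of Young's lattice between two levels, grouped in two ways: by the
  larger partition through \<open>num_syt_rec\<close>, by the smaller one through
  \<open>sum_num_syt_raise\<close>.\<close>

lemma sum_num_syt_squares: "(\<Sum>mu\<in>partitions n. num_syt mu ^ 2) = fact n"
proof (induction n)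
  case 0
  have "partitions 0 = {{#}}" by (auto simp: is_partition_def) (metis multiset_nonemptyE)
  then show ?case by (simp add: num_syt_empty)
next
  case (Suc n)
  have "(\<Sum>mu\<in>partitions (Suc n). num_syt mu ^ 2)
      = (\<Sum>mu\<in>partitions (Suc n). \<Sum>j\<in>set_mset mu. num_syt mu * num_syt (lower j mu))"
    using num_syt_rec
    by (intro sum.cong) (auto simp: is_partition_def power2_eq_square sum_distrib_left[symmetric])
  also have "\<dots> = (\<Sum>(mu, j)\<in>(SIGMA mu:partitions (Suc n). set_mset mu). num_syt mu * num_syt (lower j mu))"
    by (rule sum.Sigma) auto
  also have "\<dots> = (\<Sum>(nu, k)\<in>(SIGMA nu:partitions n. raisable nu). num_syt (raise_part k nu) * num_syt nu)"
  proof (rule sum.reindex_bij_witness[of _ "\<lambda>(nu, k). (raise_part k nu, Suc k)" "\<lambda>(mu, j). (lower j mu, j - 1)"])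
    fix a assume "a \<in> (SIGMA mu:partitions (Suc n). set_mset mu)"
    then obtain mu j where a: "a = (mu, j)" "0 \<notin># mu" "psize mu = Suc n" "j \<in># mu"
      by (auto simp: is_partition_def)
    have j0: "j > 0" using parts_pos a by blast
    note l = raise_lower[OF a(2,4)] sum_lower[OF a(4) j0] zero_notin_lower[OF a(4) j0 a(2)]
      lower_raisable[OF a(2,4)]
    show "(case case a of (mu, j) \<Rightarrow> (lower j mu, j - 1) of (nu, k) \<Rightarrow> (raise_part k nu, Suc k)) = a"
      "(case a of (mu, j) \<Rightarrow> (lower j mu, j - 1)) \<in> (SIGMA nu:partitions n. raisable nu)"
      "(case case a of (mu, j) \<Rightarrow> (lower j mu, j - 1) of (nu, k) \<Rightarrow> num_syt (raise_part k nu) * num_syt nu)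
        = (case a of (mu, j) \<Rightarrow> num_syt mu * num_syt (lower j mu))"
      using l a j0 by (auto simp: is_partition_def)
  next
    fix b assume "b \<in> (SIGMA nu:partitions n. raisable nu)"
    then obtain nu k where b: "b = (nu, k)" "0 \<notin># nu" "psize nu = n" "k \<in> raisable nu"
      by (auto simp: is_partition_def)
    show "(case case b of (nu, k) \<Rightarrow> (raise_part k nu, Suc k) of (mu, j) \<Rightarrow> (lower j mu, j - 1)) = b"
      "(case b of (nu, k) \<Rightarrow> (raise_part k nu, Suc k)) \<in> (SIGMA mu:partitions (Suc n). set_mset mu)"
      using raise_part_partition[OF b(2,4)] lower_raise_part[OF b(2,4)] b by (auto simp: is_partition_def)
  qed
  also have "\<dots> = (\<Sum>nu\<in>partitions n. \<Sum>k\<in>raisable nu. num_syt (raise_part k nu) * num_syt nu)"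
    by (rule sum.Sigma[symmetric]) auto
  also have "\<dots> = (\<Sum>nu\<in>partitions n. Suc n * num_syt nu ^ 2)"
  proof (rule sum.cong[OF refl])
    fix nu assume "nu \<in> partitions n"
    then have nu: "0 \<notin># nu" "psize nu = n" by (auto simp: is_partition_def)
    show "(\<Sum>k\<in>raisable nu. num_syt (raise_part k nu) * num_syt nu) = Suc n * num_syt nu ^ 2"
      using sum_num_syt_raise[OF nu(1)] nu(2) by (simp only: sum_distrib_right[symmetric] power2_eq_square mult.assoc)
  qed
  also have "\<dots> = Suc n * fact n" using Suc.IH by (simp only: sum_distrib_left[symmetric])
  finally show ?case by simp
qed

text \<open>The recursion that \<open>num_syt\<close> satisfies with equality holds for
  \<open>specht_dim\<close> as an inequality. This stands in for the independence of the standard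
  polytabloids.\<close>

lemma num_syt_le_specht_dim:
  assumes "0 \<notin># mu"
  shows "num_syt mu \<le> specht_dim mu"
  using assms
proof (induction "psize mu" arbitrary: mu rule: less_induct)
  case (less mu)
  note mu = less.prems
  show ?case
  proof (cases "psize mu = 0")
    case True
    then have "mu = {#}" using mu by (metis multiset_nonemptyE sum_mset_0_iff)
    then show ?thesis using specht_dim_nonzero[of "{#}"] num_syt_empty by simp
  next
    case False
    then have "num_syt mu = (\<Sum>j\<in>set_mset mu. num_syt (lower j mu))"
      using num_syt_rec[OF mu] gr0I by blast
    also have "\<dots> \<le> (\<Sum>j\<in>set_mset mu. specht_dim (lower j mu))"
    proof (rule sum_mono)
      fix j assume j: "j \<in># mu"
      have j0: "j > 0" using parts_pos[OF mu j] .
      show "num_syt (lower j mu) \<le> specht_dim (lower j mu)"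
        using less.hyps[of "lower j mu"] sum_lower[OF j j0] zero_notin_lower[OF j j0 mu] by simp
    qed
    also have "\<dots> \<le> specht_dim mu" by (rule specht_dim_ge[OF mu])
    finally show ?thesis .
  qed
qed

subsection \<open>Completeness of the Specht characters\<close>

lemma partitionsD: "mu \<in> partitions n \<Longrightarrow> 0 \<notin># mu \<and> psize mu = n"
  by (simp add: is_partition_def)

text \<open>Both claims come from one computation: the squared norm of the difference of the two sides of
  the second one is \<open>n!\<close> times the difference of \<open>n!\<close> and the sum of the squared dimensions.\<close>

lemma
  shows specht_dim_eq_num_syt: "mu \<in> partitions n \<Longrightarrow> specht_dim mu = num_syt mu"
    and regular_character: "w \<in> perms n \<Longrightarrow>
      (\<Sum>mu\<in>partitions n. of_nat (specht_dim mu) * spechar mu w) = (if w = id then fact n else 0)"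
proof -
  let ?d = "\<lambda>mu. of_nat (specht_dim mu) :: complex"
  define phi where "phi w = (\<Sum>mu\<in>partitions n. ?d mu * spechar mu w)" for w
  \<comment> \<open>Passing to real numbers makes the squares below nonnegative, so the norm yields
    both the upper bound on \<open>S\<close> and, once it vanishes, the values themselves.\<close>
  define R where "R w = Re (phi w)" for w
  define S where "S = (\<Sum>mu\<in>partitions n. specht_dim mu ^ 2)"
  have chi: "spechar mu w \<in> \<real>" if "mu \<in> partitions n" "w \<in> perms n" for mu w
    using spechar_real[of w mu] that partitionsD by auto
  have phi_R: "phi w = of_real (R w)" if "w \<in> perms n" for w
  proof -
    have "phi w \<in> \<real>" unfolding phi_def using chi that by (intro sum_in_Reals Reals_mult) auto
    then show ?thesis by (simp add: R_def)
  qed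
  have phi_id: "phi id = of_nat S"
    by (simp add: phi_def S_def spechar_id power2_eq_square)
  have orth: "(\<Sum>w\<in>perms n. spechar mu w * spechar nu w) = (if mu = nu then fact n else 0)"
    if "mu \<in> partitions n" "nu \<in> partitions n" for mu nu
    using character_norm[of mu] character_orthogonal[of nu mu] that partitionsD by auto
  have "(\<Sum>w\<in>perms n. phi w * phi w)
      = (\<Sum>w\<in>perms n. \<Sum>mu\<in>partitions n. \<Sum>nu\<in>partitions n.
          ?d mu * ?d nu * (spechar mu w * spechar nu w))"
    unfolding phi_def sum_product by (simp add: mult_ac)
  also have "\<dots> = (\<Sum>mu\<in>partitions n. \<Sum>nu\<in>partitions n. \<Sum>w\<in>perms n.
          ?d mu * ?d nu * (spechar mu w * spechar nu w))"
    by (subst sum.swap, rule sum.cong[OF refl], rule sum.swap)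
  also have "\<dots> = (\<Sum>mu\<in>partitions n. \<Sum>nu\<in>partitions n.
          ?d mu * ?d nu * (if mu = nu then fact n else 0))"
    unfolding sum_distrib_left[symmetric] using orth by (intro sum.cong) auto
  also have "\<dots> = (\<Sum>mu\<in>partitions n. ?d mu * ?d mu * fact n)"
    by (intro sum.cong refl) (simp add: if_distrib[of "\<lambda>x. _ * x"] cong: if_cong)
  also have "\<dots> = of_nat S * fact n"
    unfolding S_def by (simp add: sum_distrib_right power2_eq_square)
  finally have "(\<Sum>w\<in>perms n. phi w * phi w) = of_nat S * fact n" .
  moreover have "(\<Sum>w\<in>perms n. phi w * phi w) = of_real (\<Sum>w\<in>perms n. R w * R w)"
    unfolding of_real_sum using phi_R by (intro sum.cong) auto
  ultimately have "complex_of_real (\<Sum>w\<in>perms n. R w * R w) = of_real (real S * fact n)" by simp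
  then have RR: "(\<Sum>w\<in>perms n. R w * R w) = real S * fact n" by (simp only: of_real_eq_iff)
  have id: "id \<in> perms n" by (simp add: permutes_id)
  have Rid: "R id = real S" using phi_id by (simp add: R_def)
  define E where "E w = R w - (if w = id then fact n else 0)" for w
  have "(\<Sum>w\<in>perms n. E w ^ 2)
      = (\<Sum>w\<in>perms n. R w * R w + (if w = id then fact n * fact n - 2 * R id * fact n else 0))"
    by (intro sum.cong) (auto simp: E_def power2_eq_square algebra_simps)
  also have "\<dots> = real S * fact n + (fact n * fact n - 2 * real S * fact n)"
    unfolding sum.distrib RR sum.delta[OF finite_perms] if_P[OF id] Rid by simp
  finally have E: "(\<Sum>w\<in>perms n. E w ^ 2) = fact n * (fact n - real S)" by (simp add: algebra_simps)
  have le: "num_syt mu ^ 2 \<le> specht_dim mu ^ 2" if "mu \<in> partitions n" for mu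
    using num_syt_le_specht_dim[of mu] partitionsD[OF that] by (intro power_mono) auto
  have "(\<Sum>mu\<in>partitions n. num_syt mu ^ 2) \<le> S" unfolding S_def using le by (rule sum_mono)
  then have "fact n \<le> S" by (simp only: sum_num_syt_squares)
  then have ge: "fact n \<le> real S" by (metis of_nat_fact of_nat_le_iff)
  have "0 \<le> (\<Sum>w\<in>perms n. E w ^ 2)" by (intro sum_nonneg) auto
  then have "0 \<le> fact n - real S" unfolding E using zero_le_mult_iff fact_gt_zero by (metis not_less)
  then have "real S \<le> fact n" by simp
  with ge have S: "real S = fact n" by simp
  then have "S = fact n" by (metis of_nat_fact of_nat_eq_iff)
  then have "(\<Sum>mu\<in>partitions n. num_syt mu ^ 2) = (\<Sum>mu\<in>partitions n. specht_dim mu ^ 2)"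
    by (simp add: sum_num_syt_squares S_def)
  from sum_mono_inv[OF this le] show "specht_dim mu = num_syt mu" if "mu \<in> partitions n"
    using that by simp
  have "(\<Sum>w\<in>perms n. E w ^ 2) = 0" using E S by simp
  then have "E w = 0" if "w \<in> perms n" for w
    using that sum_nonneg_eq_0_iff[OF finite_perms, of n "\<lambda>w. E w ^ 2"] by simp
  then show "(\<Sum>mu\<in>partitions n. ?d mu * spechar mu w) = (if w = id then fact n else 0)"
    if "w \<in> perms n"
    using that phi_R[OF that] unfolding phi_def[symmetric] by (auto simp: E_def)
qed

subsection \<open>Cycle types and conjugacy\<close>

lemma permutes_imp_permutation: "w permutes {1..n::nat} \<Longrightarrow> permutation w"
  by (auto simp: permutation_permutes)

lemma cycle_type_conj:
  assumes g: "g permutes {1..n}" and w: "w permutes {1..n}"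
  shows "cycle_type n (g \<circ> w \<circ> inv g) = cycle_type n w"
proof -
  let ?u = "g \<circ> w \<circ> inv g"
  have orb: "orbit ?u (g x) = g ` orbit w x" for x
    by (rule orbit_inverse[symmetric, OF permutation_self_in_orbit[OF permutes_imp_permutation[OF w]]])
      (simp add: permutes_inverses[OF g])
  have "orbit ?u ` {1..n} = (\<lambda>x. orbit ?u (g x)) ` {1..n}"
    using permutes_image[OF g] by (metis image_image)
  also have "\<dots> = (\<lambda>X. g ` X) ` (orbit w ` {1..n})" by (simp add: orb image_image)
  finally have img: "orbit ?u ` {1..n} = (\<lambda>X. g ` X) ` (orbit w ` {1..n})" .
  have "inj_on (\<lambda>X. g ` X) (orbit w ` {1..n})"
    using permutes_inj[OF g] by (simp add: inj_on_def inj_image_eq_iff)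
  then have "cycle_type n ?u = image_mset card (image_mset (\<lambda>X. g ` X) (mset_set (orbit w ` {1..n})))"
    unfolding cycle_type_def img by (simp add: image_mset_mset_set)
  also have "\<dots> = cycle_type n w"
    using permutes_inj[OF g] by (simp add: cycle_type_def multiset.map_comp comp_def card_image inj_on_subset)
  finally show ?thesis .
qed

text \<open>Used to pair the cycles of two permutations of the same type with cycles of equal
  length.\<close>

lemma image_mset_eq_imp_bij:
  assumes "finite A" "finite B" "image_mset f (mset_set A) = image_mset g (mset_set B)"
  shows "\<exists>h. bij_betw h A B \<and> (\<forall>a\<in>A. g (h a) = f a)"
  using assms
proof (induction A arbitrary: B rule: finite_induct)
  case empty
  then have "B = {}" by (simp add: mset_set_empty_iff)
  then show ?case by (auto simp: bij_betw_def)
next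
  case (insert a A)
  then have "add_mset (f a) (image_mset f (mset_set A)) = image_mset g (mset_set B)" by simp
  then have "f a \<in># image_mset g (mset_set B)" by (metis union_single_eq_member)
  then obtain b where b: "b \<in> B" "g b = f a" using insert.prems(1) by auto
  define B' where "B' = B - {b}"
  have B: "B = insert b B'" "b \<notin> B'" "finite B'" using b insert.prems(1) by (auto simp: B'_def)
  then have "image_mset f (mset_set A) = image_mset g (mset_set B')" using insert b by simp
  then obtain h where h: "bij_betw h A B'" "\<forall>a\<in>A. g (h a) = f a" using insert.IH B(3) by blast
  have "bij_betw (h(a := b)) A B'" using h(1) insert.hyps(2) by (subst bij_betw_cong[of _ _ h]) auto
  then have "bij_betw (h(a := b)) (A \<union> {a}) (B' \<union> {(h(a := b)) a})"
    using insert.hyps(2) B(2) by (subst notIn_Un_bij_betw3[symmetric]) auto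
  then have "bij_betw (h(a := b)) (insert a A) B" using B(1) by simp
  moreover have "\<forall>x\<in>insert a A. g ((h(a := b)) x) = f x" using h(2) b(2) by simp
  ultimately show ?case by blast
qed

text \<open>Which exponents reach the same point depends only on the size of the cycle, so relations
  between powers transfer between cycles of equal length.\<close>

lemma funpow_eq_iff_mod_card_orbit:
  assumes "permutation w"
  shows "(w ^^ i) a = (w ^^ k) a \<longleftrightarrow> i mod card (orbit w a) = k mod card (orbit w a)"
proof -
  define m where "m = (LEAST m. 0 < m \<and> (w ^^ m) a = a)"
  have "\<exists>m. 0 < m \<and> (w ^^ m) a = a"
    using permutation_self_in_orbit[OF assms, of a] unfolding orbit_altdef by force
  from LeastI_ex[OF this] have m: "0 < m" "(w ^^ m) a = a" unfolding m_def by auto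
  have least: "\<not> (0 < l \<and> (w ^^ l) a = a)" if "l < m" for l
    using not_less_Least[of l] that unfolding m_def by blast
  have inj: "inj (w ^^ i)" for i
    by (rule inj_fn[OF bij_is_inj[OF permutation_bijective[OF assms]]])
  have "i = k" if "i \<le> k" "k < m" "(w ^^ i) a = (w ^^ k) a" for i k
  proof -
    have "(w ^^ i) a = (w ^^ i) ((w ^^ (k - i)) a)"
      using that by (metis comp_apply funpow_add le_add_diff_inverse)
    then have "(w ^^ (k - i)) a = a" using inj by (metis injD)
    then show ?thesis using least[of "k - i"] that by force
  qed
  then have inj_m: "i = k" if "i < m" "k < m" "(w ^^ i) a = (w ^^ k) a" for i k
    using that by (metis nat_le_linear)
  have "orbit w a = (\<lambda>i. (w ^^ i) a) ` {..<m}"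
    using orbit_altdef_bounded[OF m(2,1)] by auto
  then have card: "card (orbit w a) = m"
    using inj_m by (simp add: card_image inj_on_def)
  have "(w ^^ (i mod m)) a = (w ^^ i) a" for i using funpow_mod_eq[OF m(2)] .
  then show ?thesis unfolding card using inj_m m(1) by (metis mod_less_divisor)
qed

text \<open>Cycles of equal length are paired by \<open>h\<close> and given base points. The point
  reached after some steps from a base point of \<open>w\<close> goes to the point reached after as
  many steps in the paired cycle of \<open>u\<close>.\<close>

lemma same_cycle_type_imp_conj:
  assumes w: "w permutes {1..n}" and u: "u permutes {1..n}" and type: "cycle_type n w = cycle_type n u"
  obtains g where "g permutes {1..n}" "u = g \<circ> w \<circ> inv g"
proof -
  let ?N = "{1..n}"
  note wp = permutes_imp_permutation[OF w] and up = permutes_imp_permutation[OF u]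
  obtain h where h: "bij_betw h (orbit w ` ?N) (orbit u ` ?N)" "\<forall>X\<in>orbit w ` ?N. card (h X) = card X"
    using image_mset_eq_imp_bij[of "orbit w ` ?N" "orbit u ` ?N" card card] type by (auto simp: cycle_type_def)
  define a where "a X = (SOME y. y \<in> X)" for X :: "nat set"
  have orb: "a (orbit v x) \<in> orbit v x" "orbit v (a (orbit v x)) = orbit v x" if "permutation v" for v x
  proof -
    show "a (orbit v x) \<in> orbit v x"
      unfolding a_def using orbit_nonempty[of v x] by (metis some_in_eq)
    then show "orbit v (a (orbit v x)) = orbit v x"
      using orbit_cyclic_eq3[OF cyclic_on_orbit'[OF that]] by blast
  qed
  define s where "s x = a (orbit w x)" for x
  define t where "t x = a (h (orbit w x))" for x
  \<comment> \<open>The number of steps from the base point to \<open>x\<close>. It is determined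
    only modulo the cycle length, which \<open>transfer\<close> shows to be harmless.\<close>
  define e where "e x = (SOME k. (w ^^ k) (s x) = x)" for x
  have e: "(w ^^ e x) (s x) = x" for x
  proof -
    have "x \<in> orbit w (s x)" unfolding s_def orb(2)[OF wp] by (rule permutation_self_in_orbit[OF wp])
    then have "\<exists>k. (w ^^ k) (s x) = x" unfolding orbit_altdef by (force intro: sym)
    then show ?thesis unfolding e_def by (rule someI_ex)
  qed
  define g where "g x = (if x \<in> ?N then (u ^^ e x) (t x) else x)" for x
  have hx: "h (orbit w x) \<in> orbit u ` ?N" if "x \<in> ?N" for x
    using bij_betwE[OF h(1)] that by blast
  have ut: "orbit u (t x) = h (orbit w x)" "t x \<in> ?N" if x: "x \<in> ?N" for x
  proof -
    obtain y where y: "y \<in> ?N" "h (orbit w x) = orbit u y" using hx[OF x] by blast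
    show "orbit u (t x) = h (orbit w x)" unfolding t_def y(2) by (rule orb(2)[OF up])
    show "t x \<in> ?N" unfolding t_def y(2) using orb(1)[OF up] permutes_orbit_subset[OF u y(1)] by blast
  qed
  have transfer: "(u ^^ i) (t x) = (u ^^ k) (t x)" if "x \<in> ?N" "(w ^^ i) (s x) = (w ^^ k) (s x)" for x i k
  proof -
    have "card (orbit w (s x)) = card (orbit u (t x))"
      unfolding s_def orb(2)[OF wp] ut(1)[OF that(1)] using h(2) that(1) by simp
    then show ?thesis
      using that(2) unfolding funpow_eq_iff_mod_card_orbit[OF wp] funpow_eq_iff_mod_card_orbit[OF up] by simp
  qed
  have gk: "g x = (u ^^ k) (t x)" if "x \<in> ?N" "(w ^^ k) (s x) = x" for x k
    using transfer[OF that(1), of "e x" k] e[of x] that by (simp add: g_def)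
  have fN: "(v ^^ k) x \<in> ?N" if "v permutes ?N" "x \<in> ?N" for v k x
    using that(2) permutes_in_image[OF that(1)] by (induction k) auto
  have gN: "g x \<in> ?N" if "x \<in> ?N" for x using that fN[OF u ut(2)[OF that]] unfolding g_def by simp
  have "?N \<subseteq> g ` ?N"
  proof
    fix y assume y: "y \<in> ?N"
    then have "orbit u y \<in> h ` orbit w ` ?N" using bij_betw_imp_surj_on[OF h(1)] by blast
    then obtain x where x: "x \<in> ?N" "h (orbit w x) = orbit u y" by auto
    have "y \<in> orbit u (t x)" using ut(1)[OF x(1)] x(2) permutation_self_in_orbit[OF up] by simp
    then obtain k where k: "(u ^^ k) (t x) = y" unfolding orbit_altdef by blast
    define z where "z = (w ^^ k) (s x)"
    have sx: "s x \<in> orbit w x" unfolding s_def by (rule orb(1)[OF wp])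
    then have "z \<in> orbit w x" unfolding z_def by (rule funpow_in_orbit)
    then have "orbit w z = orbit w x" using orbit_cyclic_eq3[OF cyclic_on_orbit'[OF wp]] by blast
    then have st: "s z = s x" "t z = t x" unfolding s_def t_def by simp_all
    have zN: "z \<in> ?N" using \<open>z \<in> orbit w x\<close> permutes_orbit_subset[OF w x(1)] by blast
    have "g z = (u ^^ k) (t z)" by (rule gk[OF zN]) (simp only: st z_def[symmetric])
    then show "y \<in> g ` ?N" using k st zN by (metis imageI)
  qed
  then have surj: "g ` ?N = ?N" using gN by blast
  then have "bij_betw g ?N ?N" by (simp add: bij_betw_def eq_card_imp_inj_on)
  then have g: "g permutes ?N" by (rule bij_imp_permutes) (simp only: g_def if_False)
  have "g (w x) = u (g x)" for x
  proof (cases "x \<in> ?N")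
    case True
    then have wx: "w x \<in> ?N" using permutes_in_image[OF w] by blast
    have "orbit w (w x) = orbit w x" by (rule permutation_orbit_step[OF wp])
    then have st: "s (w x) = s x" "t (w x) = t x" unfolding s_def t_def by simp_all
    have "g (w x) = (u ^^ Suc (e x)) (t (w x))" by (rule gk[OF wx]) (simp add: st e)
    then show ?thesis using True st by (simp add: g_def)
  next
    case False
    then show ?thesis using permutes_not_in[OF w] permutes_not_in[OF u] permutes_not_in[OF g] by metis
  qed
  then have "u x = (g \<circ> w \<circ> inv g) x" for x using permutes_inverses[OF g] by simp
  then show ?thesis using that[OF g] by blast
qed

subsection \<open>Star factorizations\<close>

lemma cycle_class_iff: "psize la = n \<Longrightarrow> w \<in> cycle_class la \<longleftrightarrow> w permutes {1..n} \<and> cycle_type n w = la"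
  by (auto simp: cycle_class_def)

lemma finite_cycle_class [simp]: "finite (cycle_class la)"
  by (rule finite_subset[OF _ finite_perms[of "psize la"]]) (auto simp: cycle_class_def)

lemma sum_cycle_class_conj:
  assumes n: "psize la = n" and g: "g permutes {1..n}"
  shows "(\<Sum>w\<in>cycle_class la. f (g \<circ> w \<circ> inv g)) = (\<Sum>w\<in>cycle_class la. f w)"
proof (rule sum.reindex_bij_witness[of _ "\<lambda>w. inv g \<circ> w \<circ> g" "\<lambda>w. g \<circ> w \<circ> inv g"])
  show "inv g \<circ> (g \<circ> w \<circ> inv g) \<circ> g = w" "g \<circ> (inv g \<circ> w \<circ> g) \<circ> inv g = w" for w
    using permutes_inv_o[OF g] by (simp_all add: comp_assoc permutes_cancel[OF g])
  fix w assume "w \<in> cycle_class la"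
  then have w: "w permutes {1..n}" "cycle_type n w = la" using cycle_class_iff[OF n] by auto
  show "g \<circ> w \<circ> inv g \<in> cycle_class la"
    using w cycle_type_conj[OF g w(1)] g unfolding cycle_class_iff[OF n]
    by (auto intro!: permutes_compose permutes_inv)
  have gi: "inv g permutes {1..n}" by (rule permutes_inv[OF g])
  have "cycle_type n (inv g \<circ> w \<circ> inv (inv g)) = la" using w cycle_type_conj[OF gi w(1)] by simp
  then show "inv g \<circ> w \<circ> g \<in> cycle_class la"
    using w g gi unfolding cycle_class_iff[OF n] permutes_inv_inv[OF g]
    by (auto intro!: permutes_compose)
qed simp

definition class_sum where
  "class_sum la v = (\<Sum>w\<in>cycle_class la. act w v)"

lemma equivariant_class_sum: "psize la = n \<Longrightarrow> equivariant n (class_sum la)"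
  unfolding class_sum_def
  by (rule equivariant_conj_invariant_sum) (simp_all add: cycle_class_iff sum_cycle_class_conj)

lemma irr_char_eq:
  assumes mu: "psize mu = psize la" and w: "w \<in> cycle_class la"
  shows "spechar mu w = irr_char mu la"
proof -
  define w0 where "w0 = (SOME w. w \<in> cycle_class la)"
  have w0: "w0 \<in> cycle_class la" unfolding w0_def using w by (metis someI)
  obtain g where g: "g permutes entries la" "w = g \<circ> w0 \<circ> inv g"
    using same_cycle_type_imp_conj[of w0 "psize la" w] w0 w by (auto simp: cycle_class_def)
  show ?thesis
    using spechar_conj[of g mu w0] g w0 mu unfolding irr_char_def w0_def[symmetric]
    by (simp add: cycle_class_def)
qed

text \<open>The class sum acts as a scalar, which the trace determines up to the dimension. The
  dimension stays on the left because it is the weight of the character in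
  \<open>regular_character\<close>; \<open>spechar_inv\<close> removes the inverse of
  \<open>p\<close> on the right.\<close>

lemma class_character_sum:
  assumes mu: "psize mu = n" and la: "psize la = n" and p: "p permutes {1..n}"
  shows "of_nat (specht_dim mu) * (\<Sum>w\<in>cycle_class la. spechar mu (inv p \<circ> w))
    = of_nat (card (cycle_class la)) * irr_char mu la * spechar mu p"
proof -
  let ?C = "cycle_class la" and ?q = "frame_const mu"
  have C: "w permutes entries mu" if "w \<in> ?C" for w
    using that la mu by (auto simp: cycle_class_def)
  have equiv: "equivariant (psize mu) (class_sum la)" using equivariant_class_sum[OF la] mu by simp
  have "class_sum la (polytabloid mu T) \<in> specht mu" if "T \<in> tableaux mu" for T
    unfolding class_sum_def using act_in_specht[OF C polytabloid_in_specht[OF that]]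
    by (intro cfun.subspace_sum subspace_specht)
  then have into: "class_sum la (polytabloid mu T) \<in> tabloid_space mu" if "T \<in> tableaux mu" for T
    using that specht_subset_tabloid_space by blast
  obtain z where z: "\<And>v. v \<in> specht mu \<Longrightarrow> class_sum la v = fun_scale z v"
    using schur_scalar[OF equiv into] by metis
  have *: "(\<Sum>w\<in>?C. spechar mu (p \<circ> w)) = z * spechar mu p" if p: "p permutes entries mu" for p
  proof -
    have "(\<Sum>w\<in>?C. spechar mu (p \<circ> w))
        = (\<Sum>w\<in>?C. (\<Sum>U\<in>tableaux mu. alt_eval mu U (act p (act w (polytabloid mu U)))) / ?q)"
      using spechar_eq[OF permutes_compose[OF C p]] act_comp[OF p C] by (intro sum.cong) auto
    also have "\<dots> = (\<Sum>U\<in>tableaux mu. alt_eval mu U (act p (class_sum la (polytabloid mu U)))) / ?q"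
      unfolding class_sum_def clinear_sum[OF clinear_act] alt_eval_sum sum_divide_distrib[symmetric]
      by (subst sum.swap) rule
    also have "\<dots> = (\<Sum>U\<in>tableaux mu. z * alt_eval mu U (act p (polytabloid mu U))) / ?q"
      using z[OF polytabloid_in_specht] clinear_act[of p] by (simp add: clinear_iff alt_eval_scale)
    also have "\<dots> = z * spechar mu p"
      unfolding spechar_eq[OF p] by (simp add: sum_distrib_left)
    finally show ?thesis .
  qed
  have "z * of_nat (specht_dim mu) = (\<Sum>w\<in>?C. spechar mu w)"
    using *[OF permutes_id] spechar_id by simp
  also have "\<dots> = (\<Sum>w\<in>?C. irr_char mu la)"
    using irr_char_eq mu la by (intro sum.cong) auto
  finally have zd: "z * of_nat (specht_dim mu) = of_nat (card ?C) * irr_char mu la" by simp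
  have "(\<Sum>w\<in>?C. spechar mu (inv p \<circ> w)) = z * spechar mu p"
    using *[of "inv p"] spechar_inv[of p mu] p mu permutes_inv by auto
  then show ?thesis unfolding zd[symmetric] by (simp only: mult_ac)
qed

section \<open>Words in star transpositions\<close>

definition star_lists :: "nat \<Rightarrow> nat \<Rightarrow> (nat \<Rightarrow> nat) list set"
  where "star_lists n r = {ts. length ts = r \<and> set ts \<subseteq> star_transpositions n}"

lemma finite_star_transpositions [simp]: "finite (star_transpositions n)"
proof -
  have "star_transpositions n = (\<lambda>j. transpose j n) ` {1..<n}" by (auto simp: star_transpositions_def)
  then show ?thesis by simp
qed

lemma finite_star_lists [simp]: "finite (star_lists n r)"
  using finite_lists_length_eq[of "star_transpositions n" r] by (simp add: star_lists_def conj_commute)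

lemma star_transpositions_permutes: "t \<in> star_transpositions n \<Longrightarrow> t permutes {1..n}"
  by (auto simp: star_transpositions_def intro!: transpose_permutes)

lemma foldr_permutes: "set ts \<subseteq> perms n \<Longrightarrow> foldr (\<circ>) ts id permutes {1..n}"
  by (induction ts) (auto intro: permutes_compose permutes_id)

lemma star_lists_permutes: "ts \<in> star_lists n r \<Longrightarrow> foldr (\<circ>) ts id permutes {1..n}"
  using star_transpositions_permutes by (intro foldr_permutes) (auto simp: star_lists_def)

lemma star_sum_eq: "star_sum n v = (\<Sum>t\<in>star_transpositions n. act t v)"
proof -
  have "star_transpositions n = (\<lambda>j. transpose j n) ` {1..<n}" by (auto simp: star_transpositions_def)
  moreover have "inj_on (\<lambda>j. transpose j n) {1..<n}"
    by (rule inj_onI) (metis transpose_apply_second)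
  ultimately show ?thesis by (simp add: star_sum_def sum.reindex)
qed

lemma star_sum_funpow:
  "(star_sum n ^^ r) v = (\<Sum>ts\<in>star_lists n r. act (foldr (\<circ>) ts id) v)"
proof (induction r)
  case 0
  have "star_lists n 0 = {[]}" by (auto simp: star_lists_def)
  then show ?case by (simp add: act_id[unfolded id_def])
next
  case (Suc r)
  have "(star_sum n ^^ Suc r) v
      = (\<Sum>t\<in>star_transpositions n. \<Sum>ts\<in>star_lists n r. act t (act (foldr (\<circ>) ts id) v))"
    unfolding funpow.simps comp_apply Suc star_sum_eq[of n "sum _ _"] clinear_sum[OF clinear_act] ..
  also have "\<dots> = (\<Sum>(t, ts)\<in>star_transpositions n \<times> star_lists n r. act (foldr (\<circ>) (t # ts) id) v)"
    using act_comp[OF star_transpositions_permutes star_lists_permutes]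
    by (subst sum.cartesian_product) (auto intro!: sum.cong)
  also have "\<dots> = (\<Sum>ts\<in>star_lists n (Suc r). act (foldr (\<circ>) ts id) v)"
    by (rule sum.reindex_bij_witness[of _ "\<lambda>ts. (hd ts, tl ts)" "\<lambda>(t, ts). t # ts"])
      (auto simp: star_lists_def length_Suc_conv)
  finally show ?case .
qed

lemma sum_star_lists_character:
  assumes mu: "psize mu = n"
  shows "(\<Sum>ts\<in>star_lists n r. spechar mu (foldr (\<circ>) ts id)) = trace_on (specht mu) (star_sum n ^^ r)"
proof -
  let ?q = "frame_const mu"
  have perm: "foldr (\<circ>) ts id permutes entries mu" if "ts \<in> star_lists n r" for ts
    using star_lists_permutes[OF that] mu by simp
  have "(star_sum n ^^ r) v \<in> specht mu" if "v \<in> specht mu" for v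
    unfolding star_sum_funpow using act_in_specht[OF perm that]
    by (intro cfun.subspace_sum subspace_specht)
  then have "trace_on (specht mu) (star_sum n ^^ r)
      = (\<Sum>U\<in>tableaux mu. \<Sum>ts\<in>star_lists n r. alt_eval mu U (act (foldr (\<circ>) ts id) (polytabloid mu U))) / ?q"
    using trace_on_specht[OF clinear_funpow[OF clinear_star_sum]] by (simp add: star_sum_funpow alt_eval_sum)
  also have "\<dots> = (\<Sum>ts\<in>star_lists n r. (\<Sum>U\<in>tableaux mu. alt_eval mu U (act (foldr (\<circ>) ts id) (polytabloid mu U))) / ?q)"
    by (subst sum.swap) (simp add: sum_divide_distrib)
  also have "\<dots> = (\<Sum>ts\<in>star_lists n r. spechar mu (foldr (\<circ>) ts id))"
    using spechar_eq[OF perm] by (intro sum.cong) auto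
  finally show ?thesis by simp
qed

lemma trace_star_sum_num_syt:
  assumes mu: "mu \<in> partitions n" and n: "n > 0"
  shows "trace_on (specht mu) (star_sum n ^^ r)
    = (\<Sum>j\<in>set_mset mu. of_nat (num_syt (lower j mu)) * of_int (part_content mu j) ^ r)"
proof -
  obtain m where m: "n = Suc m" using n by (cases n) auto
  have mu': "0 \<notin># mu" "psize mu = n" using partitionsD[OF mu] by auto
  have lower: "specht_dim (lower j mu) = num_syt (lower j mu)" if j: "j \<in># mu" for j
    using sum_lower[OF j parts_pos[OF mu'(1) j]] zero_notin_lower[OF j parts_pos[OF mu'(1) j] mu'(1)] mu'(2) m
    by (intro specht_dim_eq_num_syt[of _ m]) (simp add: is_partition_def)
  have "specht_dim mu = (\<Sum>j\<in>set_mset mu. specht_dim (lower j mu))"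
    using specht_dim_eq_num_syt[OF mu] num_syt_rec[OF mu'(1)] mu'(2) n lower by simp
  from trace_star_sum[OF mu'(1) mu'(2)[unfolded m] this] show ?thesis
    unfolding m by (simp add: lower)
qed

theorem theorem4p3:
  fixes n r :: nat and la :: "nat multiset"
  assumes "la partition_of n" and "r \<ge> 1"
  shows "of_nat (card {ts. length ts = r \<and> set ts \<subseteq> star_transpositions n \<and>
                           foldr (\<circ>) ts id \<in> cycle_class la}) =
         of_nat (card (cycle_class la)) / fact n *
         (\<Sum>mu | mu partition_of n.
            (\<Sum>j\<in>set_mset mu. of_nat (num_syt (lower_part j mu)) * of_int (part_content mu j) ^ r)
            * irr_char mu la)"
proof (cases "n = 0")
  case True
  \<comment> \<open>With \<open>n = 0\<close> there are no star transpositions, and as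
    \<open>r\<close> is positive nothing is counted. On the right the only partition is empty, and
    so is its sum over parts.\<close>
  have "{ts. length ts = r \<and> set ts \<subseteq> star_transpositions n \<and> foldr (\<circ>) ts id \<in> cycle_class la} = {}"
    using assms(2) True by (auto simp: star_transpositions_def Suc_le_length_iff)
  moreover have "partitions n = {{#}}"
    using True by (auto simp: is_partition_def) (metis multiset_nonemptyE)
  ultimately show ?thesis by (simp only: card.empty) simp
next
  case False
  then have n: "n > 0" by simp
  have la: "psize la = n" using assms(1) by (simp add: is_partition_def)
  let ?C = "cycle_class la" and ?P = "\<lambda>ts. foldr (\<circ>) ts id"
    and ?d = "\<lambda>mu. of_nat (specht_dim mu) :: complex"
  have C: "w permutes {1..n}" if "w \<in> ?C" for w using that cycle_class_iff[OF la] by blast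
  \<comment> \<open>The product lies in the class iff it equals one \<open>w\<close> of the class,
    and the regular character detects when \<open>inv (?P ts) \<circ> w\<close> is the
    identity.\<close>
  have indicator: "(if ?P ts \<in> ?C then 1 else 0) = (\<Sum>w\<in>?C. \<Sum>mu\<in>partitions n.
      ?d mu * spechar mu (inv (?P ts) \<circ> w)) / fact n" if ts: "ts \<in> star_lists n r" for ts
  proof -
    have "(\<Sum>w\<in>?C. \<Sum>mu\<in>partitions n. ?d mu * spechar mu (inv (?P ts) \<circ> w))
        = (\<Sum>w\<in>?C. if ?P ts = w then fact n else 0)"
    proof (rule sum.cong[OF refl])
      fix w assume w: "w \<in> ?C"
      note p = star_lists_permutes[OF ts]
      have "inv (?P ts) \<circ> w = id \<longleftrightarrow> ?P ts = w"
        using permutes_cancel(2)[OF p, of w] permutes_inv_o(2)[OF p] by auto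
      moreover have "inv (?P ts) \<circ> w \<in> perms n"
        using permutes_compose[OF C[OF w] permutes_inv[OF p]] by simp
      ultimately show "(\<Sum>mu\<in>partitions n. ?d mu * spechar mu (inv (?P ts) \<circ> w))
          = (if ?P ts = w then fact n else 0)"
        using regular_character by simp
    qed
    then show ?thesis by simp
  qed
  have "{ts. length ts = r \<and> set ts \<subseteq> star_transpositions n \<and> ?P ts \<in> ?C} = {ts \<in> star_lists n r. ?P ts \<in> ?C}"
    by (auto simp: star_lists_def)
  then have "of_nat (card {ts. length ts = r \<and> set ts \<subseteq> star_transpositions n \<and> ?P ts \<in> ?C})
      = (\<Sum>ts\<in>star_lists n r. if ?P ts \<in> ?C then 1 else (0 :: complex))"
    by (simp add: sum.If_cases Int_def)
  also have "\<dots> = (\<Sum>ts\<in>star_lists n r. (\<Sum>w\<in>?C. \<Sum>mu\<in>partitions n.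
      ?d mu * spechar mu (inv (?P ts) \<circ> w)) / fact n)"
    by (rule sum.cong[OF refl indicator])
  also have "\<dots> = (\<Sum>ts\<in>star_lists n r. \<Sum>mu\<in>partitions n.
      ?d mu * (\<Sum>w\<in>?C. spechar mu (inv (?P ts) \<circ> w))) / fact n"
    unfolding sum_divide_distrib[symmetric] sum_distrib_left by (subst (2) sum.swap) rule
  \<comment> \<open>The dimension is absorbed, and the dependence on the word is reduced to the
    character at its product. Summing that over all words gives the trace of a power of the star
    sum.\<close>
  also have "\<dots> = (\<Sum>ts\<in>star_lists n r. \<Sum>mu\<in>partitions n.
      of_nat (card ?C) * irr_char mu la * spechar mu (?P ts)) / fact n"
    using class_character_sum[OF _ la star_lists_permutes] partitionsD
    by (intro arg_cong2[of _ _ _ _ "(/)"] sum.cong refl) auto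
  also have "\<dots> = (\<Sum>mu\<in>partitions n. of_nat (card ?C) * irr_char mu la
      * trace_on (specht mu) (star_sum n ^^ r)) / fact n"
    using sum_star_lists_character partitionsD
    by (subst sum.swap) (auto simp: sum_distrib_left[symmetric] intro!: sum.cong)
  also have "\<dots> = (\<Sum>mu\<in>partitions n. of_nat (card ?C) / fact n *
      ((\<Sum>j\<in>set_mset mu. of_nat (num_syt (lower j mu)) * of_int (part_content mu j) ^ r) * irr_char mu la))"
    unfolding sum_divide_distrib using trace_star_sum_num_syt[OF _ n] by (intro sum.cong) (auto simp: mult_ac)
  also have "\<dots> = of_nat (card ?C) / fact n * (\<Sum>mu\<in>partitions n.
      (\<Sum>j\<in>set_mset mu. of_nat (num_syt (lower j mu)) * of_int (part_content mu j) ^ r) * irr_char mu la)"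
    by (rule sum_distrib_left[symmetric])
  finally show ?thesis .
qed

end
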